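(* Let $\rho_0\in\mathcal P_{2,\mathrm{ac}}(\mathbb R^n)$, $\rho_1\in\mathcal P_2(\mathbb R^n)$, $\bar t\in(0,1)$, and let $\lambda:[0,1)\to[0,\infty)$ be continuously differentiable on $[0,\bar t]$. Suppose that the Existence assumption and the Stability assumption stated in the context hold, with constants $h_{\bar t}$ and $L_{\bar t}$. Let $\rho_k^h$ be the (random) conditional laws generated by the randomized iterative sliced controller with sampling period $h$, and $\rho_t$ the averaged flow. Then there exists a constant $C_{\bar t}<\infty$, independent of $h$, such that for every $h\in(0,h_{\bar t}]$ $$\mathbb E_{\{\theta_k\}}\Bigl[\max_{0\le k\le K_h}W_2^2(\rho_k^h,\rho_{t_k})\Bigr]\le C_{\bar t}\,h,$$ $$\mathbb E_{\{\theta_k\}}\Bigl[\max_{0\le k\le K_h}SW_2^2(\rho_k^h,\rho_{t_k})\Bigr]\le \frac{C_{\bar t}}{n}\,h,$$ where $t_k=kh$, $K_h=\lfloor\bar t/h\rfloor$ and $\mathbb E_{\{\theta_k\}}$ is the expectation over the sampled directions. Moreover, for each fixed $t\in[0,\bar t]$, with $k_h:=\lfloor t/h\rfloor$, $$\lim_{h\searrow0}\mathbb E_{\{\theta_k\}}\bigl[W_2^2(\rho_{k_h}^h,\rho_t)\bigr]=0 .$$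
   Context: $\mathcal P_2(\mathbb R^n)$: Borel probability measures with finite second moment; $\mathcal P_{2,\mathrm{ac}}(\mathbb R^n)$: those absolutely continuous with respect to Lebesgue measure. $\mathcal S^{n-1}$: unit sphere, $\sigma$: its uniform probability measure; $\mu_\theta$: pushforward of $\mu$ under $x\mapsto\theta^\top x$; $SW_2^2(\mu,\nu)=\int_{\mathcal S^{n-1}}W_2^2(\mu_\theta,\nu_\theta)\,\sigma(\mathrm d\theta)$, with $W_2$ the Wasserstein-2 distance. For $\rho\in\mathcal P_{2,\mathrm{ac}}(\mathbb R^n)$ let $\mathcal T_\rho^\theta=F_{\rho_{1,\theta}}^{-1}\circ F_{\rho_\theta}$ be the monotone optimal transport map from $\rho_\theta$ to $\rho_{1,\theta}=(\rho_1)_\theta$, and $$g_\theta[\rho](x)=\bigl(\theta^\top x-\mathcal T_\rho^\theta(\theta^\top x)\bigr)\theta,\qquad \bar g[\rho](x)=\int_{\mathcal S^{n-1}}g_\theta[\rho](x)\,\sigma(\mathrm d\theta).$$ Set $\Lambda_{\bar t}=\max_{[0,\bar t]}\lambda$. Randomized scheme: $x_0\sim\rho_0$ lives on a probability space $(\Omega_0,\mathcal F_0,\mathbb P_0)$, with $\|X\|_{L^2(\Omega_0)}^2=\mathbb E_0[\|X\|^2]$. On a separate probability space, $\{\theta_k\}_{k\ge0}$ is i.i.d. with law $\sigma$, independent of $x_0$. $\Theta_k$ is the sigma-algebra generated by $\theta_0,\dots,\theta_{k-1}$. With $x_0^h=x_0$ and $\rho_k^h=\mathrm{Law}(x_k^h\mid\Theta_k)$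 (i.e. the law under $\mathbb P_0$ for a fixed realization of the directions), $$x_{k+1}^h=x_k^h-h\lambda(t_k)\,g_{\theta_k}[\rho_k^h](x_k^h).$$ Existence assumption: there exist a $W_2$-continuous curve $\{\rho_t\}_{t\in[0,\bar t]}\subset\mathcal P_{2,\mathrm{ac}}(\mathbb R^n)$ (starting at $\rho_0$) and Borel maps $\Phi_t:\mathbb R^n\to\mathbb R^n$ with $\Phi_0=\mathrm{Id}$ such that for every $x$ the curve $t\mapsto\Phi_t(x)$ is absolutely continuous on $[0,\bar t]$, and for a.e. $t\in(0,\bar t)$ and $\rho_0$-a.e. $x$, $\frac{\mathrm d}{\mathrm dt}\Phi_t(x)=-\lambda(t)\bar g[\rho_t](\Phi_t(x))$, with $\rho_t=(\Phi_t)_\#\rho_0$. Set $y(t):=\Phi_t(x_0)$, so $y(t)\sim\rho_t$. Stability assumption: there exist $h_{\bar t}\in(0,1]$ and $L_{\bar t}<\infty$ such that $h_{\bar t}\Lambda_{\bar t}<1$ and: (1) for every $h\in(0,h_{\bar t}]$, $k\in\{0,\dots,K_h\}$ and almost every realization of the direction history, $\|\bar g[\rho_k^h](x_k^h)-\bar g[\rho_{t_k}](y(t_k))\|_{L^2(\Omega_0)}\le L_{\bar t}\|x_k^h-y(t_k)\|_{L^2(\Omega_0)}$; (2) for all $s,t\in[0,\bar t]$, $\|\bar g[\rho_s](y(s))-\bar g[\rho_t](y(t))\|_{L^2(\Omega_0)}\le L_{\bar t}\|y(s)-y(t)\|_{L^2(\Omega_0)}$. *)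

theory Defs
  imports "HOL-Probability.Probability"
begin

text \<open>Borel probability measures with finite second moment, and the Lebesgue-absolutely
  continuous ones among them.\<close>

definition P2 :: "'a::euclidean_space measure set" where
  "P2 = {\<mu>. sets \<mu> = sets borel \<and> prob_space \<mu> \<and> integrable \<mu> (\<lambda>x. (norm x)\<^sup>2)}"

definition P2ac :: "'a::euclidean_space measure set" where
  "P2ac = {\<mu> \<in> P2. absolutely_continuous lborel \<mu>}"

definition couplings :: "'a::euclidean_space measure \<Rightarrow> 'a measure \<Rightarrow> ('a \<times> 'a) measure set" where
  "couplings \<mu> \<nu> = {\<pi>. sets \<pi> = sets (borel \<Otimes>\<^sub>M borel) \<and> prob_space \<pi> \<and>
     distr \<pi> borel fst = \<mu> \<and> distr \<pi> borel snd = \<nu>}"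

text \<open>The square of the Wasserstein-2 distance. It is extended-real valued, so that
  no value has to be invented when the transport cost is infinite; it is finite on \<^const>\<open>P2\<close>.\<close>

definition W2sq :: "'a::euclidean_space measure \<Rightarrow> 'a measure \<Rightarrow> ennreal" where
  "W2sq \<mu> \<nu> = (INF \<pi>\<in>couplings \<mu> \<nu>. \<integral>\<^sup>+ z. ennreal ((dist (fst z) (snd z))\<^sup>2) \<partial>\<pi>)"

text \<open>The uniform probability measure on the unit sphere: the normalized cone measure, i.e. the
  law of \<open>x / norm x\<close> for \<open>x\<close> uniform in the unit ball. It is a measure on the Borel sets of
  the whole space that is concentrated on the sphere. The three lemmas below confirm that it is
  the rotation invariant probability measure on the sphere; the sort in the last one comes from
  the library's change of variables for linear maps.\<close>

definition unif_sphere :: "'a::euclidean_space measure" where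
  "unif_sphere = distr (uniform_measure lborel (ball 0 1)) borel (\<lambda>x. x /\<^sub>R norm x)"

lemma prob_space_unif_sphere: "prob_space (unif_sphere :: 'a::euclidean_space measure)"
proof -
  have "prob_space (uniform_measure lborel (ball (0::'a) 1))"
  proof (rule prob_space_uniform_measure)
    have "unit_ball_vol (real DIM('a)) > 0" by (rule unit_ball_vol_pos) simp
    then show "emeasure lborel (ball (0::'a) 1) \<noteq> 0"
      using emeasure_ball[of 1 "0::'a"] by (simp del: unit_ball_vol_pos)
  qed (simp add: emeasure_lborel_ball_finite[THEN less_imp_neq, unfolded infinity_ennreal_def])
  then show ?thesis
    unfolding unif_sphere_def by (intro prob_space.prob_space_distr) auto
qed

lemma AE_unif_sphere: "AE \<theta> in unif_sphere. \<theta> \<in> sphere (0::'a::euclidean_space) 1"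
proof -
  have 1: "AE x in uniform_measure lborel (ball (0::'a) 1). x \<noteq> 0"
  proof (rule AE_uniform_measureI)
    have "AE x in lborel. x \<noteq> (0::'a)" by (rule AE_lborel_singleton)
    then show "AE x in lborel. x \<in> ball (0::'a) 1 \<longrightarrow> x \<noteq> 0" by eventually_elim auto
  qed simp
  have m: "{x \<in> space borel. x \<in> sphere (0::'a) 1} \<in> sets borel" by simp
  show ?thesis
    unfolding unif_sphere_def
    by (subst AE_distr_iff[OF _ m]) (use 1 in \<open>auto elim!: eventually_mono\<close>)
qed

lemma distr_unif_sphere_orthogonal:
  fixes f :: "real^'n::{finite,wellorder} \<Rightarrow> real^'n::_"
  assumes f: "orthogonal_transformation f"
  shows "distr unif_sphere borel f = unif_sphere"
proof (rule measure_eqI)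
  fix A assume "A \<in> sets (distr unif_sphere borel f)"
  then have A: "A \<in> sets borel" by simp
  have lin: "linear f" using f by (rule orthogonal_transformation_linear)
  have fm[measurable]: "f \<in> borel_measurable borel"
    using lin by (simp add: borel_measurable_continuous_onI linear_continuous_on
        linear_conv_bounded_linear)
  have nf: "norm (f x) = norm x" for x using f by (rule orthogonal_transformation_norm)
  define s where "s x = x /\<^sub>R norm x" for x :: "real^'n::_"
  have s[measurable]: "s \<in> borel_measurable borel" unfolding s_def by simp
  have us: "unif_sphere = distr (uniform_measure lborel (ball 0 1)) borel s"
    unfolding unif_sphere_def s_def ..
  have sf: "s (f x) = f (s x)" for x
    using lin by (simp add: s_def nf linear_cmul)
  have fA: "f -` A \<in> sets borel" using measurable_sets[OF fm A] by simp
  have ss: "ball 0 1 \<inter> s -` B \<in> sets borel" if "B \<in> sets borel" for B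
    using measurable_sets[OF s that] by simp
  have lm: "ball 0 1 \<inter> s -` B \<in> lmeasurable" if "B \<in> sets borel" for B
    by (rule bounded_set_imp_lmeasurable)
       (use ss[OF that] in \<open>auto intro: bounded_subset[OF bounded_ball]\<close>)
  have im: "f ` (ball 0 1 \<inter> s -` f -` A) = ball 0 1 \<inter> s -` A"
  proof (intro set_eqI iffI)
    fix y assume y: "y \<in> ball 0 1 \<inter> s -` A"
    obtain x where "y = f x" using orthogonal_transformation_surj[OF f] by blast
    then show "y \<in> f ` (ball 0 1 \<inter> s -` f -` A)" using y by (auto simp: nf sf)
  qed (auto simp: nf sf)
  have "emeasure lebesgue (ball 0 1 \<inter> s -` A) = emeasure lebesgue (ball 0 1 \<inter> s -` f -` A)"
    using measure_orthogonal_image[OF f lm[OF fA]]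
    by (simp only: im emeasure_eq_measure2[OF lm[OF A]] emeasure_eq_measure2[OF lm[OF fA]])
  then have eq: "emeasure lborel (ball 0 1 \<inter> s -` A) = emeasure lborel (ball 0 1 \<inter> s -` f -` A)"
    using ss[OF A] ss[OF fA] by simp
  have ev: "emeasure unif_sphere B
      = emeasure lborel (ball 0 1 \<inter> s -` B) / emeasure lborel (ball (0::real^'n::_) 1)"
    if B: "B \<in> sets borel" for B
    using B measurable_sets[OF s B] unfolding us by (simp add: emeasure_distr)
  have "f \<in> measurable unif_sphere borel"
    unfolding unif_sphere_def by simp
  then have "emeasure (distr unif_sphere borel f) A = emeasure unif_sphere (f -` A)"
    using A by (subst emeasure_distr) (auto simp: unif_sphere_def)
  also have "\<dots> = emeasure unif_sphere A"
    by (simp add: ev[OF A] ev[OF fA] eq)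
  finally show "emeasure (distr unif_sphere borel f) A = emeasure unif_sphere A" .
qed (simp add: unif_sphere_def)

definition proj_law :: "'a::euclidean_space \<Rightarrow> 'a measure \<Rightarrow> real measure" where
  "proj_law \<theta> \<mu> = distr \<mu> borel (\<lambda>x. \<theta> \<bullet> x)"

definition SW2sq :: "'a::euclidean_space measure \<Rightarrow> 'a measure \<Rightarrow> ennreal" where
  "SW2sq \<mu> \<nu> = (\<integral>\<^sup>+ \<theta>. W2sq (proj_law \<theta> \<mu>) (proj_law \<theta> \<nu>) \<partial>unif_sphere)"

text \<open>The generalized inverse of the distribution function. It is meaningful for \<open>0 < u < 1\<close>;
  the levels 0 and 1 matter only on null sets in the transport maps below.\<close>

definition quantile :: "real measure \<Rightarrow> real \<Rightarrow> real" where
  "quantile \<mu> u = Inf {s. u \<le> cdf \<mu> s}"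

text \<open>In the next three definitions \<open>\<rho>1\<close> is the target measure, \<open>\<rho>\<close> the current one.\<close>

definition transport ::
  "'a::euclidean_space measure \<Rightarrow> 'a measure \<Rightarrow> 'a \<Rightarrow> real \<Rightarrow> real" where
  "transport \<rho>1 \<rho> \<theta> s = quantile (proj_law \<theta> \<rho>1) (cdf (proj_law \<theta> \<rho>) s)"

definition sliced_dir ::
  "'a::euclidean_space measure \<Rightarrow> 'a measure \<Rightarrow> 'a \<Rightarrow> 'a \<Rightarrow> 'a" where
  "sliced_dir \<rho>1 \<rho> \<theta> x = (\<theta> \<bullet> x - transport \<rho>1 \<rho> \<theta> (\<theta> \<bullet> x)) *\<^sub>R \<theta>"

definition avg_dir :: "'a::euclidean_space measure \<Rightarrow> 'a measure \<Rightarrow> 'a \<Rightarrow> 'a" where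
  "avg_dir \<rho>1 \<rho> x = (\<integral> \<theta>. sliced_dir \<rho>1 \<rho> \<theta> x \<partial>unif_sphere)"

definition L2norm :: "'w measure \<Rightarrow> ('w \<Rightarrow> 'a::euclidean_space) \<Rightarrow> real" where
  "L2norm P X = sqrt (\<integral> \<omega>. (norm (X \<omega>))\<^sup>2 \<partial>P)"

text \<open>The randomized scheme for a fixed realization \<open>\<theta>\<close> of the directions: \<open>iterate \<dots> k\<close>
  is a random variable on the initial-data space \<open>P0\<close> and depends on \<open>\<theta> 0, \<dots>, \<theta> (k - 1)\<close>
  only. Its law under \<open>P0\<close> is therefore the conditional law given these directions, the
  directions living on a separate probability space.\<close>

primrec iterate :: "'w measure \<Rightarrow> ('w \<Rightarrow> 'a::euclidean_space) \<Rightarrow> 'a measure \<Rightarrow> (real \<Rightarrow> real) \<Rightarrow>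
    real \<Rightarrow> (nat \<Rightarrow> 'a) \<Rightarrow> nat \<Rightarrow> 'w \<Rightarrow> 'a" where
  "iterate P0 x0 \<rho>1 lam h \<theta> 0 = x0"
| "iterate P0 x0 \<rho>1 lam h \<theta> (Suc k) = (\<lambda>\<omega>. iterate P0 x0 \<rho>1 lam h \<theta> k \<omega>
     - (h * lam (real k * h)) *\<^sub>R sliced_dir \<rho>1 (distr P0 borel (iterate P0 x0 \<rho>1 lam h \<theta> k)) (\<theta> k)
         (iterate P0 x0 \<rho>1 lam h \<theta> k \<omega>))"

definition iterate_law :: "'w measure \<Rightarrow> ('w \<Rightarrow> 'a::euclidean_space) \<Rightarrow> 'a measure \<Rightarrow>
    (real \<Rightarrow> real) \<Rightarrow> real \<Rightarrow> (nat \<Rightarrow> 'a) \<Rightarrow> nat \<Rightarrow> 'a measure" where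
  "iterate_law P0 x0 \<rho>1 lam h \<theta> k = distr P0 borel (iterate P0 x0 \<rho>1 lam h \<theta> k)"

definition num_steps :: "real \<Rightarrow> real \<Rightarrow> nat" where
  "num_steps t h = nat \<lfloor>t / h\<rfloor>"

definition C1_on_interval :: "(real \<Rightarrow> real) \<Rightarrow> real \<Rightarrow> real \<Rightarrow> bool" where
  "C1_on_interval f a b \<longleftrightarrow> (\<exists>f'. continuous_on {a..b} f' \<and>
     (\<forall>t\<in>{a..b}. (f has_real_derivative f' t) (at t within {a..b})))"

text \<open>Absolute continuity of a curve on \<open>[a, b]\<close>; \<open>I\<close> is a finite family of non-overlapping
  subintervals, each represented by its pair of endpoints.\<close>

definition abs_cont_on_interval :: "(real \<Rightarrow> 'a::real_normed_vector) \<Rightarrow> real \<Rightarrow> real \<Rightarrow> bool" where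
  "abs_cont_on_interval f a b \<longleftrightarrow> (\<forall>\<epsilon>>0. \<exists>\<delta>>0. \<forall>I.
     finite I \<and> (\<forall>(u, v)\<in>I. a \<le> u \<and> u \<le> v \<and> v \<le> b) \<and>
     disjoint_family_on (\<lambda>(u, v). {u<..<v}) I \<and> (\<Sum>(u, v)\<in>I. v - u) < \<delta>
     \<longrightarrow> (\<Sum>(u, v)\<in>I. norm (f v - f u)) < \<epsilon>)"

definition averaged_flow :: "real \<Rightarrow> (real \<Rightarrow> real) \<Rightarrow> 'a::euclidean_space measure \<Rightarrow> 'a measure \<Rightarrow>
    (real \<Rightarrow> 'a measure) \<Rightarrow> (real \<Rightarrow> 'a \<Rightarrow> 'a) \<Rightarrow> bool" where
  "averaged_flow tbar lam \<rho>0 \<rho>1 \<rho> \<Phi> \<longleftrightarrow>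
     (\<forall>t\<in>{0..tbar}. \<rho> t \<in> P2ac) \<and>
     (\<forall>t\<in>{0..tbar}. ((\<lambda>s. W2sq (\<rho> s) (\<rho> t)) \<longlongrightarrow> 0) (at t within {0..tbar})) \<and>
     \<rho> 0 = \<rho>0 \<and>
     (\<forall>t\<in>{0..tbar}. \<Phi> t \<in> borel_measurable borel) \<and>
     \<Phi> 0 = id \<and>
     (\<forall>x. abs_cont_on_interval (\<lambda>t. \<Phi> t x) 0 tbar) \<and>
     (AE t in lborel. t \<in> {0<..<tbar} \<longrightarrow>
        (AE x in \<rho>0. ((\<lambda>s. \<Phi> s x) has_vector_derivative
            - (lam t *\<^sub>R avg_dir \<rho>1 (\<rho> t) (\<Phi> t x))) (at t))) \<and>
     (\<forall>t\<in>{0..tbar}. \<rho> t = distr \<rho>0 borel (\<Phi> t))"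

text \<open>\<open>Q\<close> is the probability space carrying the random directions \<open>\<theta>\<close>, \<open>hbar\<close> and \<open>L\<close> are the
  constants of the assumption. All random variables below lie in \<open>L\<^sup>2(P0)\<close> under the standing
  assumptions.\<close>

definition stability :: "real \<Rightarrow> (real \<Rightarrow> real) \<Rightarrow> 'w measure \<Rightarrow> ('w \<Rightarrow> 'a::euclidean_space) \<Rightarrow>
    'a measure \<Rightarrow> 'v measure \<Rightarrow> (nat \<Rightarrow> 'v \<Rightarrow> 'a) \<Rightarrow>
    (real \<Rightarrow> 'a measure) \<Rightarrow> (real \<Rightarrow> 'a \<Rightarrow> 'a) \<Rightarrow> real \<Rightarrow> real \<Rightarrow> bool" where
  "stability tbar lam P0 x0 \<rho>1 Q \<theta> \<rho> \<Phi> hbar L \<longleftrightarrow>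
     0 < hbar \<and> hbar \<le> 1 \<and> hbar * (SUP t\<in>{0..tbar}. lam t) < 1 \<and>
     (\<forall>h\<in>{0<..hbar}. \<forall>k\<le>num_steps tbar h. AE \<omega> in Q.
        L2norm P0 (\<lambda>w. avg_dir \<rho>1 (iterate_law P0 x0 \<rho>1 lam h (\<lambda>j. \<theta> j \<omega>) k)
                           (iterate P0 x0 \<rho>1 lam h (\<lambda>j. \<theta> j \<omega>) k w)
                         - avg_dir \<rho>1 (\<rho> (real k * h)) (\<Phi> (real k * h) (x0 w)))
        \<le> L * L2norm P0 (\<lambda>w. iterate P0 x0 \<rho>1 lam h (\<lambda>j. \<theta> j \<omega>) k w
                             - \<Phi> (real k * h) (x0 w))) \<and>
     (\<forall>s\<in>{0..tbar}. \<forall>t\<in>{0..tbar}.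
        L2norm P0 (\<lambda>w. avg_dir \<rho>1 (\<rho> s) (\<Phi> s (x0 w)) - avg_dir \<rho>1 (\<rho> t) (\<Phi> t (x0 w)))
        \<le> L * L2norm P0 (\<lambda>w. \<Phi> s (x0 w) - \<Phi> t (x0 w)))"

end

theory Submission
  imports Defs
begin

text \<open>Write \<open>X k\<close> for the iterates and \<open>Y t = \<Phi> t (x0)\<close>, both seen as elements of \<open>L\<^sup>2(P0)\<close> for
  fixed directions. Since \<open>h * \<Lambda> < 1\<close>, one step of the scheme has a Lipschitz inverse on a set of
  full measure, so all conditional laws stay absolutely continuous, their projections have no atoms
  and the transport maps push them forward to the projections of the target; this bounds the
  directions in \<open>L\<^sup>2\<close>, uniformly in \<open>h\<close>. The error \<open>X k - Y (k * h)\<close> splits into the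
  \<open>L\<^sup>2(P0)\<close>-valued martingale of the centred directions, whose maximum is \<open>O(h)\<close> in mean
  square by Doob's inequality, and a remainder controlled by a discrete Gronwall argument. The
  \<open>O(h\<^sup>2)\<close> local error of the Euler step for the averaged flow follows from the Lipschitz
  dependence of \<open>lam t *\<^sub>R avg_dir \<rho>1 (\<rho> t) (Y t)\<close> on time, which in turn uses that second moments
  along the \<open>W\<^sub>2\<close>-continuous curve \<open>\<rho>\<close> are bounded.\<close>

section \<open>Square integrable random vectors\<close>

text \<open>Adding up the deviations of the single steps by the triangle inequality proves nothing:
  each of the roughly \<open>tbar / h\<close> sampled steps differs from the averaged one by O(h),
  which sums to O(1). Centring makes the squares add instead, and \<open>(tbar / h) * h^2\<close> is
  O(h). This is why Gronwall is run on the error with the martingale removed: the martingale then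
  acts as a forcing term bounded by its maximum over all steps, and the argument works separately
  for each realization. A second obstacle is that a direction depends on the current law, which is
  itself random through the past directions. Every object is therefore written as a function of a
  direction sequence, measurability is proved jointly in that sequence and in the point of
  \<open>P0\<close>, and conditional expectations become Fubini integrals with the history frozen.
  Finally, the stability assumption compares averaged directions only, so the size of a sampled
  direction has to be controlled through the transport map itself.\<close>

definition sqint :: "'w measure \<Rightarrow> ('w \<Rightarrow> 'a::euclidean_space) \<Rightarrow> bool" where
  "sqint P X \<longleftrightarrow> X \<in> borel_measurable P \<and> integrable P (\<lambda>w. (norm (X w))\<^sup>2)"

lemma sqint_integrable: "sqint P X \<Longrightarrow> integrable P (\<lambda>w. (norm (X w))\<^sup>2)"
  by (simp add: sqint_def)

lemma sqint_scaleR: "sqint P X \<Longrightarrow> sqint P (\<lambda>w. c *\<^sub>R X w)"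
  by (auto simp: sqint_def power_mult_distrib intro!: borel_measurable_scaleR)

lemma norm_add_sq_le: "(norm (x + y))\<^sup>2 \<le> 2 * (norm x)\<^sup>2 + 2 * (norm (y::'a::real_inner))\<^sup>2"
proof -
  have "0 \<le> (norm (x - y))\<^sup>2" by simp
  then show ?thesis
    by (simp add: power2_norm_eq_inner inner_add_left inner_add_right inner_diff_left
        inner_diff_right inner_commute)
qed

lemma sqint_add:
  assumes "sqint P X" "sqint P Y"
  shows "sqint P (\<lambda>w. X w + Y w)"
proof -
  have [measurable]: "X \<in> borel_measurable P" "Y \<in> borel_measurable P"
    using assms by (auto simp: sqint_def)
  have "integrable P (\<lambda>w. (norm (X w + Y w))\<^sup>2)"
    by (rule Bochner_Integration.integrable_bound[where f="\<lambda>w. 2 * (norm (X w))\<^sup>2 + 2 * (norm (Y w))\<^sup>2"])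
      (use assms in \<open>auto simp: sqint_def norm_add_sq_le\<close>)
  then show ?thesis by (simp add: sqint_def)
qed

lemma sqint_uminus: "sqint P X \<Longrightarrow> sqint P (\<lambda>w. - X w)"
  by (simp add: sqint_def)

lemma sqint_diff: "sqint P X \<Longrightarrow> sqint P Y \<Longrightarrow> sqint P (\<lambda>w. X w - Y w)"
  using sqint_add[of P X "\<lambda>w. - Y w"] by (simp add: sqint_uminus)

lemma sqint_zero: "sqint P (\<lambda>w. 0)"
  by (simp add: sqint_def)

lemma integrable_inner_sqint:
  fixes X Y :: "'w \<Rightarrow> 'a::euclidean_space"
  assumes "sqint P X" "sqint P Y"
  shows "integrable P (\<lambda>w. X w \<bullet> Y w)"
proof -
  have [measurable]: "X \<in> borel_measurable P" "Y \<in> borel_measurable P"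
    using assms by (auto simp: sqint_def)
  have "\<bar>x \<bullet> y\<bar> \<le> (norm x)\<^sup>2 + (norm y)\<^sup>2" for x y :: 'a
  proof -
    have "\<bar>x \<bullet> y\<bar> \<le> norm x * norm y" by (rule Cauchy_Schwarz_ineq2)
    also have "\<dots> \<le> (norm x)\<^sup>2 + (norm y)\<^sup>2"
      using sum_squares_bound[of "norm x" "norm y"] mult_nonneg_nonneg[OF norm_ge_zero[of x] norm_ge_zero[of y]]
      by linarith
    finally show ?thesis .
  qed
  then show ?thesis
    by (intro Bochner_Integration.integrable_bound[where f="\<lambda>w. (norm (X w))\<^sup>2 + (norm (Y w))\<^sup>2" and g="\<lambda>w. X w \<bullet> Y w"])
      (use assms in \<open>auto simp: sqint_def\<close>)
qed

lemma L2norm_nonneg: "0 \<le> L2norm P X"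
  by (simp add: L2norm_def)

lemma L2norm_sq: "(L2norm P X)\<^sup>2 = (\<integral>w. (norm (X w))\<^sup>2 \<partial>P)"
  by (simp add: L2norm_def)

lemma L2norm_scaleR: "L2norm P (\<lambda>w. c *\<^sub>R X w) = \<bar>c\<bar> * L2norm P X"
  by (simp add: L2norm_def power_mult_distrib real_sqrt_mult)

lemma L2norm_uminus: "L2norm P (\<lambda>w. - X w) = L2norm P X"
  by (simp add: L2norm_def)

lemma L2norm_zero: "L2norm P (\<lambda>w. 0) = 0"
  by (simp add: L2norm_def)

lemma nn_integral_sqint:
  assumes "sqint P X"
  shows "(\<integral>\<^sup>+w. ennreal ((norm (X w))\<^sup>2) \<partial>P) = ennreal ((L2norm P X)\<^sup>2)"
  using assms by (simp add: L2norm_sq sqint_def nn_integral_eq_integral)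

text \<open>\<open>L2norm\<close> is a Bochner integral with default value 0 outside L2, so a bound
  on it alone says little. Tonelli arguments run in \<open>ennreal\<close> and return to
  \<open>L2norm\<close> here, with membership and bound together.\<close>

lemma sqint_if_nn_integral_le:
  assumes X: "X \<in> borel_measurable P" and c: "0 \<le> c"
    and le: "(\<integral>\<^sup>+w. ennreal ((norm (X w))\<^sup>2) \<partial>P) \<le> ennreal (c\<^sup>2)"
  shows "sqint P X" "L2norm P X \<le> c"
proof -
  show s: "sqint P X"
    unfolding sqint_def
    by (intro conjI X integrableI_bounded) (use X le in \<open>auto simp: le_less_trans[OF le]\<close>)
  have "(L2norm P X)\<^sup>2 \<le> c\<^sup>2"
    using le by (simp add: nn_integral_sqint[OF s])
  then show "L2norm P X \<le> c" using c by (rule power2_le_imp_le)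
qed

lemma L2norm_add_sq:
  assumes "sqint P X" "sqint P Y"
  shows "(L2norm P (\<lambda>w. X w + Y w))\<^sup>2
    = (L2norm P X)\<^sup>2 + 2 * (\<integral>w. Y w \<bullet> X w \<partial>P) + (L2norm P Y)\<^sup>2"
proof -
  have "(norm (X w + Y w))\<^sup>2 = (norm (X w))\<^sup>2 + 2 * (Y w \<bullet> X w) + (norm (Y w))\<^sup>2" for w
    by (simp add: power2_norm_eq_inner inner_add_left inner_add_right inner_commute)
  then show ?thesis
    using assms integrable_inner_sqint[OF assms(2,1)] by (simp add: L2norm_sq sqint_def)
qed

lemma L2_Cauchy_Schwarz:
  fixes X Y :: "'w \<Rightarrow> 'a::euclidean_space"
  assumes X: "sqint P X" and Y: "sqint P Y"
  shows "(\<integral>w. X w \<bullet> Y w \<partial>P) \<le> L2norm P X * L2norm P Y"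
proof (cases "L2norm P X = 0 \<or> L2norm P Y = 0")
  case True
  have *: "AE w in P. Z w = 0" if "sqint P Z" "L2norm P Z = 0" for Z :: "'w \<Rightarrow> 'a"
    using that integral_nonneg_eq_0_iff_AE[of P "\<lambda>w. (norm (Z w))\<^sup>2"]
    by (auto simp: sqint_def L2norm_def)
  have "AE w in P. X w \<bullet> Y w = 0" using True *[OF X] *[OF Y] by (auto elim!: eventually_mono)
  then show ?thesis using True by (auto simp: integral_eq_zero_AE)
next
  case False
  define a b where "a = L2norm P X" and "b = L2norm P Y"
  have ab: "a > 0" "b > 0"
    using False L2norm_nonneg[of P X] L2norm_nonneg[of P Y] unfolding a_def b_def by auto
  \<comment> \<open>Young's inequality with the weight \<open>b / a\<close>, which balances the two
    terms: after integration each of them equals \<open>a * b / 2\<close>.\<close>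
  have *: "x \<bullet> y \<le> (b / (2 * a)) * (norm x)\<^sup>2 + (a / (2 * b)) * (norm y)\<^sup>2" for x y :: 'a
  proof -
    define c where "c = b / a"
    have c: "c > 0" using ab by (simp add: c_def)
    have "0 \<le> (norm (c *\<^sub>R x - y))\<^sup>2" by simp
    also have "\<dots> = c\<^sup>2 * (norm x)\<^sup>2 - 2 * c * (x \<bullet> y) + (norm y)\<^sup>2"
      unfolding power2_norm_eq_inner
      by (simp add: inner_diff_left inner_diff_right inner_commute power2_eq_square)
    finally have "2 * c * (x \<bullet> y) \<le> c\<^sup>2 * (norm x)\<^sup>2 + (norm y)\<^sup>2" by simp
    then have "inverse (2 * c) * (2 * c * (x \<bullet> y)) \<le> inverse (2 * c) * (c\<^sup>2 * (norm x)\<^sup>2 + (norm y)\<^sup>2)"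
      using c by (intro mult_left_mono) auto
    then have "x \<bullet> y \<le> (c / 2) * (norm x)\<^sup>2 + (1 / (2 * c)) * (norm y)\<^sup>2"
      using c by (simp add: distrib_left power2_eq_square inverse_eq_divide)
    then show ?thesis by (simp add: c_def)
  qed
  have "(\<integral>w. X w \<bullet> Y w \<partial>P) \<le> (\<integral>w. (b / (2 * a)) * (norm (X w))\<^sup>2 + (a / (2 * b)) * (norm (Y w))\<^sup>2 \<partial>P)"
    by (intro integral_mono integrable_inner_sqint X Y *) (use X Y in \<open>auto simp: sqint_def\<close>)
  also have "\<dots> = (b / (2 * a)) * a\<^sup>2 + (a / (2 * b)) * b\<^sup>2"
    using X Y by (simp add: sqint_def a_def b_def L2norm_sq)
  also have "\<dots> = a * b" using ab by (simp add: field_simps power2_eq_square)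
  finally show ?thesis by (simp add: a_def b_def)
qed

lemma L2_Cauchy_Schwarz_abs:
  assumes X: "sqint P X" and Y: "sqint P Y"
  shows "\<bar>\<integral>w. X w \<bullet> Y w \<partial>P\<bar> \<le> L2norm P X * L2norm P Y"
  using L2_Cauchy_Schwarz[OF X Y] L2_Cauchy_Schwarz[OF sqint_uminus[OF X] Y]
  by (simp add: L2norm_uminus abs_le_iff)

lemma L2norm_triangle:
  assumes X: "sqint P X" and Y: "sqint P Y"
  shows "L2norm P (\<lambda>w. X w + Y w) \<le> L2norm P X + L2norm P Y"
proof (rule power2_le_imp_le)
  show "(L2norm P (\<lambda>w. X w + Y w))\<^sup>2 \<le> (L2norm P X + L2norm P Y)\<^sup>2"
    using L2_Cauchy_Schwarz[OF Y X] by (simp add: L2norm_add_sq[OF X Y] power2_sum algebra_simps)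
qed (simp add: L2norm_nonneg)

lemma L2norm_triangle_diff:
  assumes "sqint P X" "sqint P Y"
  shows "L2norm P (\<lambda>w. X w - Y w) \<le> L2norm P X + L2norm P Y"
  using L2norm_triangle[OF assms(1) sqint_uminus[OF assms(2)]] by (simp add: L2norm_uminus)

section \<open>Quantile functions and measurability of the sliced directions\<close>

text \<open>The Galois connection between quantile and distribution function; right continuity makes
  the infimum attained. The witness \<open>y\<close> keeps the superlevel set nonempty, since
  \<open>Inf {}\<close> is an unspecified real.\<close>

lemma (in real_distribution) quantile_le_iff:
  assumes u: "0 < u" and ne: "u \<le> cdf M y"
  shows "quantile M u \<le> x \<longleftrightarrow> u \<le> cdf M x"
proof
  let ?F = "{s. u \<le> cdf M s}"
  have mono: "mono (cdf M)" by (auto intro: monoI cdf_nondecreasing)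
  obtain z where "cdf M z < u"
    by (metis eventually_happens' trivial_limit_at_bot_linorder order_tendstoD(2) cdf_lim_at_bot u)
  with mono have bdd: "bdd_below ?F"
    by (auto intro!: bdd_belowI[of _ z] elim: mono_invE[OF _ less_le_trans])
  have ne: "?F \<noteq> {}" using ne by auto
  show "u \<le> cdf M x \<Longrightarrow> quantile M u \<le> x"
    unfolding quantile_def by (auto intro!: cInf_lower bdd)
  assume *: "quantile M u \<le> x"
  have "u \<le> (INF s\<in>?F. cdf M s)"
    by (rule cINF_greatest[OF ne]) auto
  also have "\<dots> = cdf M (Inf ?F)"
    using continuous_at_Inf_mono[OF mono cdf_is_right_cont ne bdd] ..
  also have "\<dots> \<le> cdf M x"
    using * by (intro cdf_nondecreasing) (simp add: quantile_def)
  finally show "u \<le> cdf M x" .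
qed

lemma (in real_distribution) cdf_exceeds:
  assumes "u < 1"
  obtains m :: nat where "u \<le> cdf M (real m)"
proof -
  obtain y where y: "u < cdf M y"
    by (metis eventually_happens' trivial_limit_at_top_linorder order_tendstoD(1) cdf_lim_at_top_prob assms)
  obtain m :: nat where "y \<le> real m" using real_arch_simple by blast
  then show thesis using that[of m] y cdf_nondecreasing[of y "real m"] by linarith
qed

lemma (in real_distribution) quantile_mono:
  assumes "0 < u" "u \<le> v" "v < 1"
  shows "quantile M u \<le> quantile M v"
proof -
  obtain m where "v \<le> cdf M (real m)" using cdf_exceeds[OF assms(3)] by blast
  then have "v \<le> cdf M (quantile M v)"
    using quantile_le_iff[of v "real m" "quantile M v"] assms by auto
  then show ?thesis using quantile_le_iff[of u "quantile M v" "quantile M v"] assms by auto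
qed

text \<open>One inequality is the Galois connection. For the other, points to the left of the
  quantile have cdf below \<open>u\<close>, and the absence of atoms lets this bound pass to the
  limit from the left.\<close>

lemma (in real_distribution) cdf_quantile:
  assumes cont: "\<And>x. measure M {x} = 0" and u: "0 < u" "u < 1"
  shows "cdf M (quantile M u) = u"
proof (rule antisym)
  obtain m where m: "u \<le> cdf M (real m)" using cdf_exceeds[OF u(2)] by blast
  show "u \<le> cdf M (quantile M u)"
    using quantile_le_iff[OF u(1) m, of "quantile M u"] by simp
  have "isCont (cdf M) (quantile M u)" by (simp add: isCont_cdf cont)
  then have lim: "(cdf M \<longlongrightarrow> cdf M (quantile M u)) (at_left (quantile M u))"
    by (simp add: isCont_def filterlim_at_split)
  show "cdf M (quantile M u) \<le> u"
  proof (rule tendsto_upperbound[OF lim])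
    show "\<forall>\<^sub>F s in at_left (quantile M u). cdf M s \<le> u"
      unfolding eventually_at_filter
      using quantile_le_iff[OF u(1) m] by (intro always_eventually) (auto simp: not_le[symmetric] intro: less_imp_le)
  qed simp
qed

lemma borel_measurable_quantile:
  assumes K: "\<And>\<omega>. \<omega> \<in> space N \<Longrightarrow> real_distribution (K \<omega>)"
    and m[measurable]: "(\<lambda>(\<omega>, s). cdf (K \<omega>) s) \<in> borel_measurable (N \<Otimes>\<^sub>M borel)"
  shows "(\<lambda>(\<omega>, u). quantile (K \<omega>) u) \<in> borel_measurable (N \<Otimes>\<^sub>M borel)"
proof -
  have [measurable]: "(\<lambda>p. cdf (K (fst p)) x) \<in> borel_measurable (N \<Otimes>\<^sub>M borel)" for x :: real
    using measurable_compose[OF _ m, of "\<lambda>p. (fst p, x)" "N \<Otimes>\<^sub>M borel"] by simp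
  \<comment> \<open>Where the superlevel set is the whole line or empty, \<open>quantile\<close>
    equals the constant \<open>Inf UNIV\<close> or \<open>Inf {}\<close>, whatever their values;
    elsewhere the Galois connection applies. Nonemptiness is tested at natural numbers to keep the
    condition countable.\<close>
  have eq: "{p \<in> space (N \<Otimes>\<^sub>M borel). quantile (K (fst p)) (snd p) \<le> x} =
    {p \<in> space (N \<Otimes>\<^sub>M borel). (snd p \<le> 0 \<and> Inf UNIV \<le> x)
      \<or> (0 < snd p \<and> (\<exists>m::nat. snd p \<le> cdf (K (fst p)) (real m)) \<and> snd p \<le> cdf (K (fst p)) x)
      \<or> (0 < snd p \<and> \<not> (\<exists>m::nat. snd p \<le> cdf (K (fst p)) (real m)) \<and> Inf {} \<le> x)}"
    for x :: real
  proof (rule Collect_cong, rule conj_cong[OF refl])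
    fix p :: "'a \<times> real" assume "p \<in> space (N \<Otimes>\<^sub>M borel)"
    then interpret real_distribution "K (fst p)" using K by (auto simp: space_pair_measure)
    let ?u = "snd p"
    consider "?u \<le> 0" | m :: nat where "0 < ?u" "?u \<le> cdf (K (fst p)) (real m)"
      | "0 < ?u" "\<not> (\<exists>m::nat. ?u \<le> cdf (K (fst p)) (real m))" by fastforce
    then show "(quantile (K (fst p)) ?u \<le> x) \<longleftrightarrow> ((?u \<le> 0 \<and> Inf UNIV \<le> x)
      \<or> (0 < ?u \<and> (\<exists>m::nat. ?u \<le> cdf (K (fst p)) (real m)) \<and> ?u \<le> cdf (K (fst p)) x)
      \<or> (0 < ?u \<and> \<not> (\<exists>m::nat. ?u \<le> cdf (K (fst p)) (real m)) \<and> Inf {} \<le> x))"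
    proof cases
      case 1
      then have "{s. ?u \<le> cdf (K (fst p)) s} = UNIV" using cdf_nonneg order_trans by blast
      then show ?thesis using 1 by (simp add: quantile_def)
    next
      case 2
      then show ?thesis using quantile_le_iff[OF 2] by auto
    next
      case 3
      have "{s. ?u \<le> cdf (K (fst p)) s} = {}"
      proof (rule ccontr)
        assume "\<not> ?thesis"
        then obtain s where s: "?u \<le> cdf (K (fst p)) s" by auto
        obtain m :: nat where "s \<le> real m" using real_arch_simple by blast
        then have "?u \<le> cdf (K (fst p)) (real m)" using s cdf_nondecreasing order_trans by blast
        then show False using 3 by blast
      qed
      then show ?thesis using 3 by (simp add: quantile_def)
    qed
  qed
  show ?thesis
    unfolding borel_measurable_iff_le case_prod_beta by (simp only: eq) measurable
qed

text \<open>The cdf is the integral over \<open>P\<close> of an indicator that is jointly measurable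
  in parameter, level and sample point.\<close>

lemma borel_measurable_cdf_distr:
  fixes X :: "'n \<Rightarrow> 'w \<Rightarrow> real"
  assumes "prob_space P" and m[measurable]: "(\<lambda>(\<omega>, w). X \<omega> w) \<in> borel_measurable (N \<Otimes>\<^sub>M P)"
  shows "(\<lambda>(\<omega>, s). cdf (distr P borel (X \<omega>)) s) \<in> borel_measurable (N \<Otimes>\<^sub>M borel)"
proof -
  interpret prob_space P by fact
  have "cdf (distr P borel (X \<omega>)) s = (\<integral>w. indicator {..s} (X \<omega> w) \<partial>P)" if "\<omega> \<in> space N" for \<omega> s
  proof -
    have [measurable]: "X \<omega> \<in> borel_measurable P" using measurable_Pair2[OF m that] by simp
    have "(\<integral>w. indicator {..s} (X \<omega> w) \<partial>P) = (\<integral>w. (indicator (X \<omega> -` {..s} \<inter> space P) w :: real) \<partial>P)"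
      by (intro Bochner_Integration.integral_cong) (auto simp: indicator_def)
    then show ?thesis
      by (simp add: cdf_def measure_distr)
  qed
  then have *: "p \<in> space (N \<Otimes>\<^sub>M borel) \<Longrightarrow> (case p of (\<omega>, s) \<Rightarrow> cdf (distr P borel (X \<omega>)) s)
      = (\<integral>w. (if X (fst p) w \<le> snd p then 1 else 0) \<partial>P)" for p
    by (auto simp: space_pair_measure indicator_def of_bool_def)
  have [measurable]: "(\<lambda>q. X (fst (fst q)) (snd q)) \<in> borel_measurable ((N \<Otimes>\<^sub>M (borel :: real measure)) \<Otimes>\<^sub>M P)"
    using measurable_compose[OF _ m, of "\<lambda>q. (fst (fst q), snd q)" "(N \<Otimes>\<^sub>M borel) \<Otimes>\<^sub>M P"] by simp
  show ?thesis
    by (subst measurable_cong[OF *]) (auto intro!: borel_measurable_lebesgue_integral simp: case_prod_beta)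
qed

lemma proj_law_distr:
  fixes X :: "'w \<Rightarrow> 'a::euclidean_space"
  assumes [measurable]: "X \<in> borel_measurable P"
  shows "proj_law \<theta> (distr P borel X) = distr P borel (\<lambda>w. \<theta> \<bullet> X w)"
  unfolding proj_law_def by (subst distr_distr) (auto simp: comp_def)

lemma real_distribution_proj_law:
  fixes \<mu> :: "'a::euclidean_space measure"
  assumes "prob_space \<mu>" "sets \<mu> = sets borel"
  shows "real_distribution (proj_law \<theta> \<mu>)"
proof -
  have m: "(\<lambda>x. \<theta> \<bullet> x) \<in> borel_measurable \<mu>" using assms(2) by (simp cong: measurable_cong_sets)
  interpret prob_space "distr \<mu> borel (\<lambda>x. \<theta> \<bullet> x)" by (rule prob_space.prob_space_distr[OF assms(1) m])
  show ?thesis unfolding proj_law_def by standard auto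
qed

text \<open>The law itself varies with the parameter. The space \<open>N\<close> will carry
  direction sequences, time, or a single point.\<close>

lemma borel_measurable_sliced_dir:
  fixes X :: "'n \<Rightarrow> 'w \<Rightarrow> 'a::euclidean_space" and \<rho>1 :: "'a measure"
  assumes P: "prob_space P" and m[measurable]: "(\<lambda>(\<omega>, w). X \<omega> w) \<in> borel_measurable (N \<Otimes>\<^sub>M P)"
    and \<rho>1: "prob_space \<rho>1" "sets \<rho>1 = sets borel"
    and f[measurable]: "f \<in> measurable M N" "g \<in> borel_measurable M" "x \<in> borel_measurable M"
  shows "(\<lambda>z. sliced_dir \<rho>1 (distr P borel (X (f z))) (g z) (x z)) \<in> borel_measurable M"
proof -
  have 1: "(\<lambda>(q, s). cdf (distr P borel (\<lambda>w. snd q \<bullet> X (fst q) w)) s)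
      \<in> borel_measurable ((N \<Otimes>\<^sub>M borel) \<Otimes>\<^sub>M borel)"
  proof (rule borel_measurable_cdf_distr[OF P])
    have [measurable]: "(\<lambda>q. X (fst (fst q)) (snd q)) \<in> borel_measurable ((N \<Otimes>\<^sub>M (borel :: 'a measure)) \<Otimes>\<^sub>M P)"
      using measurable_compose[OF _ m, of "\<lambda>q. (fst (fst q), snd q)" "(N \<Otimes>\<^sub>M borel) \<Otimes>\<^sub>M P"] by simp
    show "(\<lambda>(\<omega>, w). snd \<omega> \<bullet> X (fst \<omega>) w) \<in> borel_measurable ((N \<Otimes>\<^sub>M borel) \<Otimes>\<^sub>M P)"
      by (simp add: case_prod_beta)
  qed
  have 2: "(\<lambda>(\<theta>, u). quantile (proj_law \<theta> \<rho>1) u) \<in> borel_measurable ((borel :: 'a measure) \<Otimes>\<^sub>M borel)"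
  proof (rule borel_measurable_quantile)
    show "real_distribution (proj_law \<theta> \<rho>1)" for \<theta>
      by (rule real_distribution_proj_law[OF \<rho>1])
    have "sets ((borel :: 'a measure) \<Otimes>\<^sub>M \<rho>1) = sets (borel \<Otimes>\<^sub>M borel)"
      using \<rho>1(2) by (rule sets_pair_measure_cong[OF refl])
    then show "(\<lambda>(\<theta>, s). cdf (proj_law \<theta> \<rho>1) s) \<in> borel_measurable ((borel :: 'a measure) \<Otimes>\<^sub>M borel)"
      unfolding proj_law_def
      by (intro borel_measurable_cdf_distr \<rho>1) (simp add: case_prod_beta cong: measurable_cong_sets)
  qed
  have 3: "(\<lambda>z. cdf (distr P borel (\<lambda>w. g z \<bullet> X (f z) w)) (g z \<bullet> x z)) \<in> borel_measurable M"
    using measurable_compose[OF _ 1, of "\<lambda>z. ((f z, g z), g z \<bullet> x z)" M] by simp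
  have "cdf (proj_law (g z) (distr P borel (X (f z)))) (g z \<bullet> x z)
     = cdf (distr P borel (\<lambda>w. g z \<bullet> X (f z) w)) (g z \<bullet> x z)" if "z \<in> space M" for z
  proof -
    have "f z \<in> space N" by (rule measurable_space[OF f(1) that])
    then have "X (f z) \<in> borel_measurable P" using measurable_Pair2[OF m] by simp
    then show ?thesis by (simp add: proj_law_distr)
  qed
  with 3 have [measurable]: "(\<lambda>z. cdf (proj_law (g z) (distr P borel (X (f z)))) (g z \<bullet> x z)) \<in> borel_measurable M"
    by (subst measurable_cong)
  have "(\<lambda>z. quantile (proj_law (g z) \<rho>1) (cdf (proj_law (g z) (distr P borel (X (f z)))) (g z \<bullet> x z)))
     \<in> borel_measurable M"
    using measurable_compose[OF _ 2, of "\<lambda>z. (g z, cdf (proj_law (g z) (distr P borel (X (f z)))) (g z \<bullet> x z))" M]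
    by simp
  then show ?thesis unfolding sliced_dir_def transport_def by measurable
qed

lemma sets_unif_sphere[measurable_cong]: "sets unif_sphere = sets borel"
  by (simp add: unif_sphere_def)

lemma borel_measurable_avg_dir:
  fixes X :: "'n \<Rightarrow> 'w \<Rightarrow> 'a::euclidean_space" and \<rho>1 :: "'a measure"
  assumes P: "prob_space P" and m: "(\<lambda>(\<omega>, w). X \<omega> w) \<in> borel_measurable (N \<Otimes>\<^sub>M P)"
    and \<rho>1: "prob_space \<rho>1" "sets \<rho>1 = sets borel"
    and f[measurable]: "f \<in> measurable M N" "x \<in> borel_measurable M"
  shows "(\<lambda>z. avg_dir \<rho>1 (distr P borel (X (f z))) (x z)) \<in> borel_measurable M"
proof -
  interpret prob_space "unif_sphere :: 'a measure" by (rule prob_space_unif_sphere)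
  have "(\<lambda>p. sliced_dir \<rho>1 (distr P borel (X (f (fst p)))) (snd p) (x (fst p)))
      \<in> borel_measurable (M \<Otimes>\<^sub>M unif_sphere)"
    by (rule borel_measurable_sliced_dir[OF P m \<rho>1]) auto
  then show ?thesis unfolding avg_dir_def
    by (intro borel_measurable_lebesgue_integral) (simp add: case_prod_beta)
qed

section \<open>Norm bounds for the sliced directions\<close>

lemma (in real_distribution) borel_measurable_quantile_fixed:
  "quantile M \<in> borel_measurable borel"
proof -
  have m[measurable]: "cdf M \<in> borel_measurable borel"
    by (intro borel_measurable_mono monoI cdf_nondecreasing)
  have "(\<lambda>(\<omega>::real, u). quantile M u) \<in> borel_measurable (borel \<Otimes>\<^sub>M borel)"
    by (rule borel_measurable_quantile) (auto simp: real_distribution_axioms case_prod_beta)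
  from measurable_compose[OF _ this, of "\<lambda>u. (0, u)" borel] show ?thesis by simp
qed

text \<open>Inverse transform sampling; \<open>quantile\<close> unfolds to the function used in the
  library's proof of Skorohod's theorem.\<close>

lemma distr_quantile:
  assumes "real_distribution \<mu>"
  shows "quantile \<mu> \<in> borel_measurable (restrict_space lborel {0<..<1})"
    and "distr (restrict_space lborel {0<..<1}) borel (quantile \<mu>) = \<mu>"
proof -
  interpret cdf_distribution \<mu> using assms by (simp add: cdf_distribution_def)
  have q: "quantile \<mu> = (\<lambda>u. Inf {s. u \<le> cdf \<mu> s})" by (simp add: quantile_def fun_eq_iff)
  show "quantile \<mu> \<in> borel_measurable (restrict_space lborel {0<..<1})"
    using measurable_CI unfolding q by (simp cong: measurable_cong_sets sets_restrict_space_cong)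
  show "distr (restrict_space lborel {0<..<1}) borel (quantile \<mu>) = \<mu>"
    using distr_I_eq_M unfolding q .
qed

text \<open>Write \<mu> as the law of its quantile at a uniform level. Without atoms,
  \<open>cdf \<mu>\<close> recovers the level, so both claims reduce to the uniform law, and the
  quantile of \<nu> then produces \<nu>: the monotone map transports \<mu> to \<nu>.\<close>

lemma
  assumes \<mu>: "real_distribution \<mu>" and \<nu>: "real_distribution \<nu>"
    and atomless: "\<And>x. measure \<mu> {x} = 0"
  shows AE_cdf_atomless: "AE s in \<mu>. 0 < cdf \<mu> s \<and> cdf \<mu> s < 1"
    and nn_integral_quantile_cdf: "f \<in> borel_measurable borel \<Longrightarrow>
      (\<integral>\<^sup>+s. f (quantile \<nu> (cdf \<mu> s)) \<partial>\<mu>) = (\<integral>\<^sup>+s. f s \<partial>\<nu>)"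
proof -
  let ?U = "restrict_space lborel {0<..<1::real}"
  note q[measurable] = distr_quantile(1)[OF \<mu>] distr_quantile(1)[OF \<nu>]
  have [measurable]: "cdf \<mu> \<in> borel_measurable borel"
    using \<mu> by (intro borel_measurable_mono monoI finite_borel_measure.cdf_nondecreasing)
      (auto simp: real_distribution.finite_borel_measure_M)
  have [measurable]: "quantile \<nu> \<in> borel_measurable borel"
    by (rule real_distribution.borel_measurable_quantile_fixed[OF \<nu>])
  have c: "cdf \<mu> (quantile \<mu> u) = u" if "u \<in> space ?U" for u
    using that real_distribution.cdf_quantile[OF \<mu> atomless] by (auto simp: space_restrict_space)
  have "AE u in ?U. 0 < cdf \<mu> (quantile \<mu> u) \<and> cdf \<mu> (quantile \<mu> u) < 1"
  proof (rule AE_I2)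
    fix u assume "u \<in> space ?U"
    then show "0 < cdf \<mu> (quantile \<mu> u) \<and> cdf \<mu> (quantile \<mu> u) < 1"
      using c[of u] by (simp add: space_restrict_space)
  qed
  then have "AE s in distr ?U borel (quantile \<mu>). 0 < cdf \<mu> s \<and> cdf \<mu> s < 1"
    by (subst AE_distr_iff) auto
  then show "AE s in \<mu>. 0 < cdf \<mu> s \<and> cdf \<mu> s < 1"
    by (simp only: distr_quantile(2)[OF \<mu>])
  assume [measurable]: "f \<in> borel_measurable borel"
  have "(\<integral>\<^sup>+s. f (quantile \<nu> (cdf \<mu> s)) \<partial>\<mu>)
      = (\<integral>\<^sup>+s. f (quantile \<nu> (cdf \<mu> s)) \<partial>distr ?U borel (quantile \<mu>))"
    by (simp add: distr_quantile(2)[OF \<mu>])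
  also have "\<dots> = (\<integral>\<^sup>+u. f (quantile \<nu> (cdf \<mu> (quantile \<mu> u))) \<partial>?U)"
    by (subst nn_integral_distr) auto
  also have "\<dots> = (\<integral>\<^sup>+u. f (quantile \<nu> u) \<partial>?U)"
    by (intro nn_integral_cong) (simp add: c)
  also have "\<dots> = (\<integral>\<^sup>+s. f s \<partial>distr ?U borel (quantile \<nu>))"
    by (subst nn_integral_distr) auto
  finally show "(\<integral>\<^sup>+s. f (quantile \<nu> (cdf \<mu> s)) \<partial>\<mu>) = (\<integral>\<^sup>+s. f s \<partial>\<nu>)"
    by (simp add: distr_quantile(2)[OF \<nu>])
qed

text \<open>An atom of the projection would be a hyperplane of positive mass, and hyperplanes are
  Lebesgue null.\<close>

lemma proj_law_atomless:
  assumes "\<rho> \<in> P2ac" "\<theta> \<noteq> 0"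
  shows "measure (proj_law \<theta> \<rho>) {s} = 0"
proof -
  have sets: "sets \<rho> = sets borel" and ac: "absolutely_continuous lborel \<rho>"
    using assms by (auto simp: P2ac_def P2_def)
  then have m: "(\<lambda>x. \<theta> \<bullet> x) \<in> borel_measurable \<rho>" by (simp cong: measurable_cong_sets)
  have "negligible {x. \<theta> \<bullet> x = s}" using assms(2) by (simp add: negligible_hyperplane)
  then have "{x. \<theta> \<bullet> x = s} \<in> null_sets lborel"
    by (simp add: negligible_iff_null_sets null_sets_completion_iff closed_hyperplane borel_closed)
  then have "{x. \<theta> \<bullet> x = s} \<in> null_sets \<rho>"
    using ac by (auto simp: absolutely_continuous_def)
  moreover have "(\<lambda>x. \<theta> \<bullet> x) -` {s} \<inter> space \<rho> = {x. \<theta> \<bullet> x = s}"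
    using sets_eq_imp_space_eq[OF sets] by auto
  moreover have "measure (proj_law \<theta> \<rho>) {s} = measure \<rho> ((\<lambda>x. \<theta> \<bullet> x) -` {s} \<inter> space \<rho>)"
    unfolding proj_law_def by (rule measure_distr[OF m]) simp
  ultimately show ?thesis
    by (simp add: measure_def null_setsD1)
qed

text \<open>Jensen's inequality for vector valued integrals, obtained by testing the integral
  against itself. The total mass is kept so that it serves both the sphere and a time interval of
  length \<open>v - u\<close>.\<close>

lemma norm_integral_sq_le:
  assumes "finite_measure M" and g: "sqint M g"
  shows "integrable M g" "(norm (\<integral>x. g x \<partial>M))\<^sup>2 \<le> measure M (space M) * (\<integral>x. (norm (g x))\<^sup>2 \<partial>M)"
proof -
  interpret finite_measure M by fact
  have [measurable]: "g \<in> borel_measurable M" using g by (simp add: sqint_def)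
  have n: "r \<le> 1 + r\<^sup>2" for r :: real
    using sum_squares_bound[of 1 r] zero_le_power2[of r] by (simp only: power_one mult_1_right)
  show i: "integrable M g"
    by (rule Bochner_Integration.integrable_bound[where f="\<lambda>x. 1 + (norm (g x))\<^sup>2"])
      (use g n in \<open>auto simp: sqint_def\<close>)
  define v where "v = (\<integral>x. g x \<partial>M)"
  define m where "m = measure M (space M)"
  have cv: "sqint M (\<lambda>x. v)" "L2norm M (\<lambda>x. v) = sqrt m * norm v"
    by (auto simp: sqint_def L2norm_def real_sqrt_mult m_def)
  have "norm v * norm v = (\<integral>x. v \<bullet> g x \<partial>M)"
    using i by (simp add: v_def power2_norm_eq_inner flip: power2_eq_square)
  also have "\<dots> \<le> norm v * (sqrt m * L2norm M g)"
    using L2_Cauchy_Schwarz[OF cv(1) g] by (simp add: cv(2) ac_simps)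
  finally have "norm v \<le> sqrt m * L2norm M g"
    by (cases "norm v = 0") (auto simp: L2norm_nonneg m_def)
  then have "(norm v)\<^sup>2 \<le> (sqrt m * L2norm M g)\<^sup>2" by (intro power_mono) auto
  then show "(norm (\<integral>x. g x \<partial>M))\<^sup>2 \<le> measure M (space M) * (\<integral>x. (norm (g x))\<^sup>2 \<partial>M)"
    by (simp add: v_def power_mult_distrib L2norm_sq m_def)
qed

locale sliced_target = prob_space P for P :: "'w measure" +
  fixes \<rho>1 :: "'a::euclidean_space measure"
  assumes target: "\<rho>1 \<in> P2"
begin

abbreviation law :: "('w \<Rightarrow> 'a) \<Rightarrow> 'a measure" where "law X \<equiv> distr P borel X"

text \<open>The class in which the iterates stay. As \<open>P2ac\<close> includes the second moment,
  membership yields square integrability as well as projections without atoms.\<close>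

definition ac_rv :: "('w \<Rightarrow> 'a) \<Rightarrow> bool" where
  "ac_rv X \<longleftrightarrow> X \<in> borel_measurable P \<and> law X \<in> P2ac"

definition R1 :: real where "R1 = L2norm \<rho>1 (\<lambda>x. x)"

lemma R1_nonneg: "0 \<le> R1"
  by (simp add: R1_def L2norm_nonneg)

lemma target_prob: "prob_space \<rho>1" and target_sets: "sets \<rho>1 = sets borel"
  and target_sqint: "sqint \<rho>1 (\<lambda>x. x)"
  using target by (auto simp: P2_def sqint_def cong: measurable_cong_sets)

lemma ac_rv_sqint: "ac_rv X \<Longrightarrow> sqint P X"
  by (auto simp: ac_rv_def sqint_def P2ac_def P2_def integrable_distr_eq)

lemma borel_measurable_sliced_dir_rv:
  assumes "ac_rv X"
  shows "(\<lambda>p. sliced_dir \<rho>1 (law X) (fst p) (X (snd p))) \<in> borel_measurable (borel \<Otimes>\<^sub>M P)"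
    and "(\<lambda>w. sliced_dir \<rho>1 (law X) \<theta> (X w)) \<in> borel_measurable P"
    and "sliced_dir \<rho>1 (law X) \<theta> \<in> borel_measurable borel"
    and "(\<lambda>w. avg_dir \<rho>1 (law X) (X w)) \<in> borel_measurable P"
proof -
  have [measurable]: "X \<in> borel_measurable P" using assms by (simp add: ac_rv_def)
  \<comment> \<open>A one-point parameter space specializes the parametrized lemmas to a fixed
    random vector.\<close>
  have X: "(\<lambda>(\<omega>, w). X w) \<in> borel_measurable (count_space (UNIV::unit set) \<Otimes>\<^sub>M P)" by simp
  note * = borel_measurable_sliced_dir[OF prob_space_axioms X target_prob target_sets, where f="\<lambda>_. ()"]
  show "(\<lambda>p. sliced_dir \<rho>1 (law X) (fst p) (X (snd p))) \<in> borel_measurable (borel \<Otimes>\<^sub>M P)"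
    by (rule *) auto
  show "(\<lambda>w. sliced_dir \<rho>1 (law X) \<theta> (X w)) \<in> borel_measurable P"
    by (rule *) auto
  show "sliced_dir \<rho>1 (law X) \<theta> \<in> borel_measurable borel"
    by (rule *) auto
  show "(\<lambda>w. avg_dir \<rho>1 (law X) (X w)) \<in> borel_measurable P"
    by (rule borel_measurable_avg_dir[OF prob_space_axioms X target_prob target_sets, where f="\<lambda>_. ()"]) auto
qed

text \<open>The direction is a difference of two vectors along \<theta>. The projected position is
  shorter than the position; the transported coordinate has the law of the projected target, so its
  second moment is at most \<open>R1\<close> squared.\<close>

lemma
  assumes X: "ac_rv X" and \<theta>: "norm \<theta> = 1"
  shows sqint_sliced_dir: "sqint P (\<lambda>w. sliced_dir \<rho>1 (law X) \<theta> (X w))"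
    and L2norm_sliced_dir: "L2norm P (\<lambda>w. sliced_dir \<rho>1 (law X) \<theta> (X w)) \<le> L2norm P X + R1"
proof -
  have Xm[measurable]: "X \<in> borel_measurable P" and ac: "law X \<in> P2ac" using X by (auto simp: ac_rv_def)
  have sX: "sqint P X" by (rule ac_rv_sqint[OF X])
  let ?\<mu> = "proj_law \<theta> (law X)" and ?\<nu> = "proj_law \<theta> \<rho>1"
  have \<mu>: "real_distribution ?\<mu>"
    by (intro real_distribution_proj_law prob_space_distr) auto
  have \<nu>: "real_distribution ?\<nu>"
    by (rule real_distribution_proj_law[OF target_prob target_sets])
  have atomless: "measure ?\<mu> {s} = 0" for s
    using proj_law_atomless[OF ac, of \<theta> s] \<theta> by fastforce
  have CS: "(\<theta> \<bullet> y)\<^sup>2 \<le> (norm y)\<^sup>2" for y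
    using Cauchy_Schwarz_ineq[of \<theta> y] \<theta> by (simp add: power2_norm_eq_inner)
      (metis mult_1 norm_eq_1)
  have [measurable]: "cdf ?\<mu> \<in> borel_measurable borel"
    using \<mu> by (intro borel_measurable_mono monoI finite_borel_measure.cdf_nondecreasing)
      (auto simp: real_distribution.finite_borel_measure_M)
  have [measurable]: "quantile ?\<nu> \<in> borel_measurable borel"
    by (rule real_distribution.borel_measurable_quantile_fixed[OF \<nu>])
  define T where "T w = quantile ?\<nu> (cdf ?\<mu> (\<theta> \<bullet> X w))" for w
  have [measurable]: "T \<in> borel_measurable P" unfolding T_def by measurable
  have "(\<integral>\<^sup>+w. ennreal ((norm (T w *\<^sub>R \<theta>))\<^sup>2) \<partial>P) = (\<integral>\<^sup>+w. ennreal ((T w)\<^sup>2) \<partial>P)"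
    by (simp add: \<theta>)
  also have "\<dots> = (\<integral>\<^sup>+s. ennreal ((quantile ?\<nu> (cdf ?\<mu> s))\<^sup>2) \<partial>distr P borel (\<lambda>w. \<theta> \<bullet> X w))"
    unfolding T_def by (subst nn_integral_distr) auto
  also have "\<dots> = (\<integral>\<^sup>+s. ennreal ((quantile ?\<nu> (cdf ?\<mu> s))\<^sup>2) \<partial>?\<mu>)"
    by (simp add: proj_law_distr)
  also have "\<dots> = (\<integral>\<^sup>+s. ennreal (s\<^sup>2) \<partial>?\<nu>)"
    by (rule nn_integral_quantile_cdf[OF \<mu> \<nu> atomless]) auto
  also have "\<dots> = (\<integral>\<^sup>+y. ennreal ((\<theta> \<bullet> y)\<^sup>2) \<partial>\<rho>1)"
    unfolding proj_law_def using target_sets by (subst nn_integral_distr) (auto cong: measurable_cong_sets)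
  also have "\<dots> \<le> (\<integral>\<^sup>+y. ennreal ((norm y)\<^sup>2) \<partial>\<rho>1)"
    by (intro nn_integral_mono ennreal_leI CS)
  also have "\<dots> = ennreal (R1\<^sup>2)"
    unfolding R1_def by (rule nn_integral_sqint[OF target_sqint])
  finally have T: "sqint P (\<lambda>w. T w *\<^sub>R \<theta>)" "L2norm P (\<lambda>w. T w *\<^sub>R \<theta>) \<le> R1"
    using sqint_if_nn_integral_le[of "\<lambda>w. T w *\<^sub>R \<theta>" P R1] R1_nonneg by auto
  have "(\<integral>\<^sup>+w. ennreal ((norm ((\<theta> \<bullet> X w) *\<^sub>R \<theta>))\<^sup>2) \<partial>P) \<le> (\<integral>\<^sup>+w. ennreal ((norm (X w))\<^sup>2) \<partial>P)"
    by (intro nn_integral_mono ennreal_leI) (simp add: \<theta> CS)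
  also have "\<dots> = ennreal ((L2norm P X)\<^sup>2)" by (rule nn_integral_sqint[OF sX])
  finally have S: "sqint P (\<lambda>w. (\<theta> \<bullet> X w) *\<^sub>R \<theta>)" "L2norm P (\<lambda>w. (\<theta> \<bullet> X w) *\<^sub>R \<theta>) \<le> L2norm P X"
    using sqint_if_nn_integral_le[of "\<lambda>w. (\<theta> \<bullet> X w) *\<^sub>R \<theta>" P "L2norm P X"] L2norm_nonneg by auto
  have eq: "sliced_dir \<rho>1 (law X) \<theta> (X w) = (\<theta> \<bullet> X w) *\<^sub>R \<theta> - T w *\<^sub>R \<theta>" for w
    by (simp add: sliced_dir_def transport_def T_def scaleR_left_diff_distrib)
  show "sqint P (\<lambda>w. sliced_dir \<rho>1 (law X) \<theta> (X w))"
    unfolding eq by (rule sqint_diff[OF S(1) T(1)])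
  show "L2norm P (\<lambda>w. sliced_dir \<rho>1 (law X) \<theta> (X w)) \<le> L2norm P X + R1"
    unfolding eq using L2norm_triangle_diff[OF S(1) T(1)] S(2) T(2) by linarith
qed

lemma nn_integral_sliced_dir_le:
  assumes X: "ac_rv X"
  shows "(\<integral>\<^sup>+\<theta>. \<integral>\<^sup>+w. ennreal ((norm (sliced_dir \<rho>1 (law X) \<theta> (X w)))\<^sup>2) \<partial>P \<partial>unif_sphere)
    \<le> ennreal ((L2norm P X + R1)\<^sup>2)"
proof -
  interpret U: prob_space "unif_sphere :: 'a measure" by (rule prob_space_unif_sphere)
  have "(\<integral>\<^sup>+\<theta>. \<integral>\<^sup>+w. ennreal ((norm (sliced_dir \<rho>1 (law X) \<theta> (X w)))\<^sup>2) \<partial>P \<partial>unif_sphere)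
    \<le> (\<integral>\<^sup>+(\<theta>::'a). ennreal ((L2norm P X + R1)\<^sup>2) \<partial>unif_sphere)"
  proof (rule nn_integral_mono_AE, use AE_unif_sphere in eventually_elim)
    case (elim \<theta>)
    then have \<theta>: "norm \<theta> = 1" by simp
    show ?case
      unfolding nn_integral_sqint[OF sqint_sliced_dir[OF X \<theta>]]
      by (intro ennreal_leI power_mono L2norm_sliced_dir[OF X \<theta>] L2norm_nonneg)
  qed
  then show ?thesis by (simp add: U.emeasure_space_1)
qed

text \<open>Jensen on the sphere for almost every sample point, then Tonelli. The last claim is
  recorded because \<open>avg_dir\<close> falls back to 0 at points where the integrand is not
  integrable, and linearity of the integral would fail there.\<close>

lemma
  assumes X: "ac_rv X"
  shows sqint_avg_dir: "sqint P (\<lambda>w. avg_dir \<rho>1 (law X) (X w))"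
    and L2norm_avg_dir: "L2norm P (\<lambda>w. avg_dir \<rho>1 (law X) (X w)) \<le> L2norm P X + R1"
    and AE_integrable_sliced_dir: "AE w in P. integrable unif_sphere (\<lambda>\<theta>. sliced_dir \<rho>1 (law X) \<theta> (X w))"
proof -
  interpret U: prob_space "unif_sphere :: 'a measure" by (rule prob_space_unif_sphere)
  interpret UP: pair_sigma_finite "unif_sphere :: 'a measure" P ..
  let ?g = "\<lambda>\<theta> w. sliced_dir \<rho>1 (law X) \<theta> (X w)"
  have [measurable]: "(\<lambda>p. ?g (fst p) (snd p)) \<in> borel_measurable (unif_sphere \<Otimes>\<^sub>M P)"
    using borel_measurable_sliced_dir_rv(1)[OF X] by (simp cong: measurable_cong_sets)
  have sw: "(\<integral>\<^sup>+w. \<integral>\<^sup>+\<theta>. ennreal ((norm (?g \<theta> w))\<^sup>2) \<partial>unif_sphere \<partial>P) \<le> ennreal ((L2norm P X + R1)\<^sup>2)"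
    using nn_integral_sliced_dir_le[OF X] by (subst UP.Fubini') simp_all
  have [measurable]: "(\<lambda>w. ennreal ((norm (?g \<theta> w))\<^sup>2)) \<in> borel_measurable P" for \<theta>
    using borel_measurable_sliced_dir_rv(2)[OF X] by simp
  have gm[measurable]: "(\<lambda>\<theta>. ?g \<theta> w) \<in> borel_measurable unif_sphere" if "w \<in> space P" for w
    using measurable_compose[OF _ borel_measurable_sliced_dir_rv(1)[OF X], of "\<lambda>\<theta>. (\<theta>, w)" borel] that
    by (simp cong: measurable_cong_sets)
  have [measurable]: "(\<lambda>p. ?g (snd p) (fst p)) \<in> borel_measurable (P \<Otimes>\<^sub>M unif_sphere)"
    using measurable_compose[OF _ borel_measurable_sliced_dir_rv(1)[OF X], of "\<lambda>p. (snd p, fst p)" "P \<Otimes>\<^sub>M unif_sphere"]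
    by simp
  have "AE w in P. (\<integral>\<^sup>+\<theta>. ennreal ((norm (?g \<theta> w))\<^sup>2) \<partial>unif_sphere) \<noteq> \<infinity>"
    by (rule nn_integral_PInf_AE) (use sw in \<open>auto simp: top_unique split_beta' intro!: U.borel_measurable_nn_integral\<close>)
  with AE_space have AE: "AE w in P. sqint unif_sphere (\<lambda>\<theta>. ?g \<theta> w)"
  proof eventually_elim
    case (elim w)
    then show ?case unfolding sqint_def
      by (intro conjI gm integrableI_bounded) (auto simp: less_top)
  qed
  from AE show "AE w in P. integrable unif_sphere (\<lambda>\<theta>. ?g \<theta> w)"
    by eventually_elim (rule norm_integral_sq_le(1)[OF U.finite_measure_axioms])
  have "(\<integral>\<^sup>+w. ennreal ((norm (avg_dir \<rho>1 (law X) (X w)))\<^sup>2) \<partial>P)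
    \<le> (\<integral>\<^sup>+w. \<integral>\<^sup>+\<theta>. ennreal ((norm (?g \<theta> w))\<^sup>2) \<partial>unif_sphere \<partial>P)"
  proof (rule nn_integral_mono_AE, use AE in eventually_elim)
    case (elim w)
    then show ?case
      using norm_integral_sq_le(2)[OF U.finite_measure_axioms elim]
      by (simp add: U.prob_space nn_integral_eq_integral sqint_integrable avg_dir_def)
  qed
  then have "(\<integral>\<^sup>+w. ennreal ((norm (avg_dir \<rho>1 (law X) (X w)))\<^sup>2) \<partial>P) \<le> ennreal ((L2norm P X + R1)\<^sup>2)"
    using sw by (rule order_trans)
  from sqint_if_nn_integral_le[OF borel_measurable_sliced_dir_rv(4)[OF X] _ this]
  show "sqint P (\<lambda>w. avg_dir \<rho>1 (law X) (X w))"
    "L2norm P (\<lambda>w. avg_dir \<rho>1 (law X) (X w)) \<le> L2norm P X + R1"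
    by (auto simp: L2norm_nonneg R1_nonneg)
qed

text \<open>The martingale property in weak form: for a test vector \<open>Z\<close> that does not
  depend on the sampled direction, exchanging the integrals turns the sliced direction into its
  average.\<close>

lemma integral_inner_sliced_dir_minus_avg_dir:
  assumes X: "ac_rv X" and Z: "sqint P Z"
  shows "(\<integral>\<theta>. (\<integral>w. (sliced_dir \<rho>1 (law X) \<theta> (X w) - avg_dir \<rho>1 (law X) (X w)) \<bullet> Z w \<partial>P) \<partial>unif_sphere) = 0"
proof -
  interpret U: prob_space "unif_sphere :: 'a measure" by (rule prob_space_unif_sphere)
  interpret UP: pair_sigma_finite "unif_sphere :: 'a measure" P ..
  let ?g = "\<lambda>\<theta> w. sliced_dir \<rho>1 (law X) \<theta> (X w)" and ?a = "\<lambda>w. avg_dir \<rho>1 (law X) (X w)"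
  have [measurable]: "(\<lambda>p. ?g (fst p) (snd p)) \<in> borel_measurable (unif_sphere \<Otimes>\<^sub>M P)"
    using borel_measurable_sliced_dir_rv(1)[OF X] by (simp cong: measurable_cong_sets)
  have [measurable]: "Z \<in> borel_measurable P" using Z by (simp add: sqint_def)
  have [measurable]: "(\<lambda>w. ennreal ((norm (?g \<theta> w))\<^sup>2)) \<in> borel_measurable P" for \<theta>
    using borel_measurable_sliced_dir_rv(2)[OF X] by simp
  have int: "integrable (unif_sphere \<Otimes>\<^sub>M P) (\<lambda>p. ?g (fst p) (snd p) \<bullet> Z (snd p))"
  proof (rule integrableI_bounded)
    have "\<bar>x \<bullet> y\<bar> \<le> (norm x)\<^sup>2 + (norm y)\<^sup>2" for x y :: 'a
      using Cauchy_Schwarz_ineq2[of x y] sum_squares_bound[of "norm x" "norm y"]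
        mult_nonneg_nonneg[OF norm_ge_zero[of x] norm_ge_zero[of y]] by linarith
    then have "(\<integral>\<^sup>+p. ennreal (norm (?g (fst p) (snd p) \<bullet> Z (snd p))) \<partial>(unif_sphere \<Otimes>\<^sub>M P))
      \<le> (\<integral>\<^sup>+p. ennreal ((norm (?g (fst p) (snd p)))\<^sup>2) + ennreal ((norm (Z (snd p)))\<^sup>2) \<partial>(unif_sphere \<Otimes>\<^sub>M P))"
      by (intro nn_integral_mono) (simp flip: ennreal_plus)
    also have "\<dots> = (\<integral>\<^sup>+\<theta>. \<integral>\<^sup>+w. ennreal ((norm (?g \<theta> w))\<^sup>2) \<partial>P \<partial>unif_sphere) + (\<integral>\<^sup>+w. ennreal ((norm (Z w))\<^sup>2) \<partial>P)"
      by (subst nn_integral_add; simp add: nn_integral_fst[symmetric] U.emeasure_space_1)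
    also have "\<dots> \<le> ennreal ((L2norm P X + R1)\<^sup>2) + ennreal ((L2norm P Z)\<^sup>2)"
      unfolding nn_integral_sqint[OF Z] by (intro add_right_mono nn_integral_sliced_dir_le X)
    finally show "(\<integral>\<^sup>+p. ennreal (norm (?g (fst p) (snd p) \<bullet> Z (snd p))) \<partial>(unif_sphere \<Otimes>\<^sub>M P)) < \<infinity>"
      by (rule le_less_trans) simp
  qed measurable
  have "(\<integral>\<theta>. (\<integral>w. (?g \<theta> w - ?a w) \<bullet> Z w \<partial>P) \<partial>unif_sphere)
    = (\<integral>\<theta>. (\<integral>w. ?g \<theta> w \<bullet> Z w \<partial>P) - (\<integral>w. ?a w \<bullet> Z w \<partial>P) \<partial>unif_sphere)"
  proof (rule integral_cong_AE)
    have [measurable]: "(\<lambda>p. ?a (snd p)) \<in> borel_measurable (unif_sphere \<Otimes>\<^sub>M P)"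
      using borel_measurable_sliced_dir_rv(4)[OF X] by measurable
    show "(\<lambda>\<theta>. \<integral>w. (?g \<theta> w - ?a w) \<bullet> Z w \<partial>P) \<in> borel_measurable unif_sphere"
      "(\<lambda>\<theta>. (\<integral>w. ?g \<theta> w \<bullet> Z w \<partial>P) - (\<integral>w. ?a w \<bullet> Z w \<partial>P)) \<in> borel_measurable unif_sphere"
      by (auto intro!: borel_measurable_diff borel_measurable_lebesgue_integral simp: case_prod_beta)
    show "AE \<theta> in unif_sphere. (\<integral>w. (?g \<theta> w - ?a w) \<bullet> Z w \<partial>P)
      = (\<integral>w. ?g \<theta> w \<bullet> Z w \<partial>P) - (\<integral>w. ?a w \<bullet> Z w \<partial>P)"
      using AE_unif_sphere
    proof eventually_elim
      case (elim \<theta>)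
      then have \<theta>: "norm \<theta> = 1" by simp
      show ?case
        using integrable_inner_sqint[OF sqint_sliced_dir[OF X \<theta>] Z] integrable_inner_sqint[OF sqint_avg_dir[OF X] Z]
        by (simp add: inner_diff_left)
    qed
  qed
  also have "\<dots> = (\<integral>\<theta>. (\<integral>w. ?g \<theta> w \<bullet> Z w \<partial>P) \<partial>unif_sphere) - (\<integral>w. ?a w \<bullet> Z w \<partial>P)"
    using UP.integrable_fst'[OF int] by (simp add: U.prob_space)
  also have "(\<integral>\<theta>. (\<integral>w. ?g \<theta> w \<bullet> Z w \<partial>P) \<partial>unif_sphere) = (\<integral>w. (\<integral>\<theta>. ?g \<theta> w \<bullet> Z w \<partial>unif_sphere) \<partial>P)"
    using int by (subst UP.Fubini_integral) (simp_all add: split_beta')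
  also have "\<dots> = (\<integral>w. ?a w \<bullet> Z w \<partial>P)"
  proof (rule integral_cong_AE)
    show "AE w in P. (\<integral>\<theta>. ?g \<theta> w \<bullet> Z w \<partial>unif_sphere) = ?a w \<bullet> Z w"
      using AE_integrable_sliced_dir[OF X] by eventually_elim (simp add: avg_dir_def)
    show "(\<lambda>w. \<integral>\<theta>. ?g \<theta> w \<bullet> Z w \<partial>unif_sphere) \<in> borel_measurable P"
      by (rule borel_measurable_integrable[OF UP.integrable_snd]) (use int in \<open>simp add: split_beta'\<close>)
    show "(\<lambda>w. ?a w \<bullet> Z w) \<in> borel_measurable P"
      using borel_measurable_sliced_dir_rv(4)[OF X] by measurable
  qed
  finally show ?thesis by simp
qed

end

section \<open>Absolute continuity along the scheme\<close>

context sliced_target begin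

text \<open>The levels are kept inside (0, 1) because \<open>quantile\<close> may take a default
  value at the two ends, where monotonicity can fail.\<close>

lemma transport_mono:
  assumes X: "ac_rv X" and st: "s \<le> t"
    and "0 < cdf (proj_law \<theta> (law X)) s" "cdf (proj_law \<theta> (law X)) t < 1"
  shows "transport \<rho>1 (law X) \<theta> s \<le> transport \<rho>1 (law X) \<theta> t"
proof -
  have [measurable]: "X \<in> borel_measurable P" using X by (simp add: ac_rv_def)
  interpret \<mu>: real_distribution "proj_law \<theta> (law X)"
    by (intro real_distribution_proj_law prob_space_distr) auto
  interpret \<nu>: real_distribution "proj_law \<theta> \<rho>1"
    by (rule real_distribution_proj_law[OF target_prob target_sets])
  show ?thesis unfolding transport_def
    by (intro \<nu>.quantile_mono \<mu>.cdf_nondecreasing assms)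
qed

text \<open>Test the difference of the images with \<open>x - y\<close>. The monotone transport
  contributes a nonnegative term, and the contraction along \<theta> costs at most \<open>c\<close>
  times the squared distance.\<close>

lemma sliced_step_expansive:
  fixes c :: real
  assumes X: "ac_rv X" and \<theta>: "norm \<theta> = 1" and c: "0 \<le> c"
    and xy: "\<And>z. z \<in> {x, y} \<Longrightarrow> 0 < cdf (proj_law \<theta> (law X)) (\<theta> \<bullet> z) \<and> cdf (proj_law \<theta> (law X)) (\<theta> \<bullet> z) < 1"
  shows "(1 - c) * norm (x - y)
    \<le> norm ((x - c *\<^sub>R sliced_dir \<rho>1 (law X) \<theta> x) - (y - c *\<^sub>R sliced_dir \<rho>1 (law X) \<theta> y))"
proof -
  define T where "T = transport \<rho>1 (law X) \<theta>"
  define d where "d = x - y"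
  define D where "D = (x - c *\<^sub>R sliced_dir \<rho>1 (law X) \<theta> x) - (y - c *\<^sub>R sliced_dir \<rho>1 (law X) \<theta> y)"
  have "0 \<le> (\<theta> \<bullet> x - \<theta> \<bullet> y) * (T (\<theta> \<bullet> x) - T (\<theta> \<bullet> y))"
    using transport_mono[OF X, of "\<theta> \<bullet> x" "\<theta> \<bullet> y" \<theta>] transport_mono[OF X, of "\<theta> \<bullet> y" "\<theta> \<bullet> x" \<theta>] xy
    unfolding T_def by (cases "\<theta> \<bullet> x \<le> \<theta> \<bullet> y") (auto intro: mult_nonneg_nonneg mult_nonpos_nonpos)
  then have m: "0 \<le> c * ((\<theta> \<bullet> d) * (T (\<theta> \<bullet> x) - T (\<theta> \<bullet> y)))"
    using c by (simp add: d_def inner_diff_right)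
  have "(\<theta> \<bullet> d)\<^sup>2 \<le> (norm d)\<^sup>2"
    using Cauchy_Schwarz_ineq[of \<theta> d] \<theta> by (simp add: power2_norm_eq_inner) (metis mult_1 norm_eq_1)
  then have "c * (\<theta> \<bullet> d)\<^sup>2 \<le> c * (norm d)\<^sup>2" using c by (rule mult_left_mono)
  moreover have "D \<bullet> d = (norm d)\<^sup>2 - c * (\<theta> \<bullet> d)\<^sup>2 + c * ((\<theta> \<bullet> d) * (T (\<theta> \<bullet> x) - T (\<theta> \<bullet> y)))"
  proof -
    have "D = d - (c * (\<theta> \<bullet> d)) *\<^sub>R \<theta> + (c * (T (\<theta> \<bullet> x) - T (\<theta> \<bullet> y))) *\<^sub>R \<theta>"
      unfolding D_def d_def sliced_dir_def T_def by (simp add: algebra_simps inner_diff_right)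
    then show ?thesis
      unfolding power2_norm_eq_inner by (simp add: inner_add_left inner_diff_left power2_eq_square)
  qed
  ultimately have "(1 - c) * (norm d)\<^sup>2 \<le> D \<bullet> d" using m by (simp add: left_diff_distrib)
  also have "\<dots> \<le> norm D * norm d" by (rule norm_cauchy_schwarz)
  finally have "(1 - c) * norm d * norm d \<le> norm D * norm d" by (simp add: power2_eq_square mult.assoc)
  then have "(1 - c) * norm d \<le> norm D" by (cases "norm d = 0") (auto dest: mult_right_le_imp_le)
  then show ?thesis by (simp add: d_def D_def)
qed

text \<open>The step map is injective with Lipschitz inverse on a set of full measure, so preimages of
  Lebesgue null sets are null.\<close>

lemma ac_rv_step:
  assumes X: "ac_rv X" and \<theta>: "norm \<theta> = 1" and c: "0 \<le> c" "c < 1"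
  shows "ac_rv (\<lambda>w. X w - c *\<^sub>R sliced_dir \<rho>1 (law X) \<theta> (X w))"
proof -
  have Xm[measurable]: "X \<in> borel_measurable P" and ac: "law X \<in> P2ac" using X by (auto simp: ac_rv_def)
  note [measurable] = borel_measurable_sliced_dir_rv(2,3)[OF X, of \<theta>]
  let ?F = "cdf (proj_law \<theta> (law X))"
  define G where "G x = x - c *\<^sub>R sliced_dir \<rho>1 (law X) \<theta> x" for x
  have [measurable]: "G \<in> borel_measurable borel" unfolding G_def by measurable
  \<comment> \<open>The points whose projected level avoids 0 and 1, so that the expansion estimate
    applies to any two of them.\<close>
  define A where "A = {x. 0 < ?F (\<theta> \<bullet> x) \<and> ?F (\<theta> \<bullet> x) < 1}"
  have \<mu>: "real_distribution (proj_law \<theta> (law X))"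
    by (intro real_distribution_proj_law prob_space_distr) auto
  have [measurable]: "?F \<in> borel_measurable borel"
    using \<mu> by (intro borel_measurable_mono monoI finite_borel_measure.cdf_nondecreasing)
      (auto simp: real_distribution.finite_borel_measure_M)
  have "AE s in proj_law \<theta> (law X). 0 < ?F s \<and> ?F s < 1"
    using \<theta> by (intro AE_cdf_atomless[OF \<mu> \<mu>] proj_law_atomless ac) auto
  then have AE: "AE x in law X. x \<in> A"
    unfolding A_def mem_Collect_eq 
    by (subst (asm) (3) proj_law_def) (rule AE_distrD[of "\<lambda>x. \<theta> \<bullet> x" "law X" borel], simp)
  have exp: "(1 - c) * norm (x - y) \<le> norm (G x - G y)" if "x \<in> A" "y \<in> A" for x y
    unfolding G_def by (rule sliced_step_expansive[OF X \<theta> c(1)]) (use that in \<open>auto simp: A_def\<close>)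
  have inj: "inj_on G A"
  proof (rule inj_onI)
    fix x y assume "x \<in> A" "y \<in> A" "G x = G y"
    then show "x = y" using exp[of x y] c by (simp add: mult_le_0_iff)
  qed
  have "absolutely_continuous lborel (distr (law X) borel G)"
    unfolding absolutely_continuous_def
  proof
    fix N :: "'a set" assume N: "N \<in> null_sets lborel"
    then have Ns[measurable]: "N \<in> sets borel" by auto
    have "negligible (N \<inter> G ` A)"
      using N by (intro negligible_Int) (auto simp: negligible_iff_null_sets null_sets_completion_iff)
    then have "negligible (inv_into A G ` (N \<inter> G ` A))"
    proof (rule negligible_locally_Lipschitz_image[OF order_refl])
      fix z assume z: "z \<in> N \<inter> G ` A"
      have "norm (inv_into A G y - inv_into A G z) \<le> inverse (1 - c) * norm (y - z)" if y: "y \<in> N \<inter> G ` A" for y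
        using y z exp[of "inv_into A G y" "inv_into A G z"] c
        by (auto simp: inv_into_f_f[OF inj] field_simps)
      then show "\<exists>T B. open T \<and> z \<in> T \<and> (\<forall>y\<in>N \<inter> G ` A \<inter> T. norm (inv_into A G y - inv_into A G z) \<le> B * norm (y - z))"
        by (intro exI[of _ UNIV] exI[of _ "inverse (1 - c)"]) auto
    qed
    moreover have "inv_into A G ` (N \<inter> G ` A) = G -` N \<inter> A"
      by (force simp: inv_into_f_f[OF inj] image_iff)
    moreover have "G -` N \<inter> A \<in> sets borel"
    proof -
      have "G -` N \<in> sets borel" "A \<in> sets borel"
        unfolding A_def by (auto intro: measurable_sets_borel[OF _ Ns])
      then show ?thesis by auto
    qed
    ultimately have "G -` N \<inter> A \<in> null_sets lborel"
      by (simp add: negligible_iff_null_sets null_sets_completion_iff)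
    then have "G -` N \<inter> A \<in> null_sets (law X)"
      using ac by (auto simp: P2ac_def absolutely_continuous_def)
    then have "AE x in law X. x \<notin> G -` N"
      using AE by (auto dest!: AE_not_in elim!: eventually_elim2)
    then have "emeasure (law X) {x \<in> space (law X). \<not> x \<notin> G -` N} = 0"
      by (subst (asm) AE_iff_measurable[OF _ refl]) (auto intro: measurable_sets_borel[OF _ Ns])
    then show "N \<in> null_sets (distr (law X) borel G)"
      by (intro null_setsI) (auto simp: emeasure_distr vimage_def)
  qed
  moreover have "distr (law X) borel G = law (\<lambda>w. G (X w))"
    by (subst distr_distr) (auto simp: comp_def)
  moreover have "integrable P (\<lambda>w. (norm (G (X w)))\<^sup>2)"
    using sqint_diff[OF ac_rv_sqint[OF X] sqint_scaleR[OF sqint_sliced_dir[OF X \<theta>], of c]]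
    by (simp add: G_def sqint_def)
  ultimately have "ac_rv (\<lambda>w. G (X w))"
    by (simp add: ac_rv_def P2ac_def P2_def integrable_distr_eq prob_space_distr)
  then show ?thesis by (simp add: G_def)
qed

end

section \<open>Wasserstein bounds and a maximal inequality\<close>

text \<open>The joint law on the common space is an admissible coupling, in general not an optimal
  one.\<close>

lemma W2sq_distr_le:
  fixes X Y :: "'w \<Rightarrow> 'a::euclidean_space"
  assumes "prob_space P" and X: "sqint P X" and Y: "sqint P Y"
  shows "W2sq (distr P borel X) (distr P borel Y) \<le> ennreal ((L2norm P (\<lambda>w. X w - Y w))\<^sup>2)"
proof -
  interpret prob_space P by fact
  have [measurable]: "X \<in> borel_measurable P" "Y \<in> borel_measurable P" using X Y by (auto simp: sqint_def)
  let ?\<pi> = "distr P (borel \<Otimes>\<^sub>M borel) (\<lambda>w. (X w, Y w))"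
  have "?\<pi> \<in> couplings (distr P borel X) (distr P borel Y)"
    by (auto simp: couplings_def prob_space_distr distr_distr comp_def)
  then have "W2sq (distr P borel X) (distr P borel Y) \<le> (\<integral>\<^sup>+ z. ennreal ((dist (fst z) (snd z))\<^sup>2) \<partial>?\<pi>)"
    unfolding W2sq_def by (rule INF_lower)
  also have "\<dots> = (\<integral>\<^sup>+w. ennreal ((norm (X w - Y w))\<^sup>2) \<partial>P)"
    by (subst nn_integral_distr) (auto simp: dist_norm)
  also have "\<dots> = ennreal ((L2norm P (\<lambda>w. X w - Y w))\<^sup>2)"
    by (rule nn_integral_sqint[OF sqint_diff[OF X Y]])
  finally show ?thesis .
qed

text \<open>Projection to a unit direction is 1-Lipschitz, so pushing a coupling through it does not
  raise its cost.\<close>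

lemma W2sq_proj_law_le:
  fixes \<mu> \<nu> :: "'a::euclidean_space measure"
  assumes \<theta>: "norm \<theta> = 1"
  shows "W2sq (proj_law \<theta> \<mu>) (proj_law \<theta> \<nu>) \<le> W2sq \<mu> \<nu>"
  unfolding W2sq_def[of \<mu> \<nu>]
proof (rule INF_greatest)
  fix \<pi> assume \<pi>: "\<pi> \<in> couplings \<mu> \<nu>"
  then have s: "sets \<pi> = sets (borel \<Otimes>\<^sub>M borel)" and p: "prob_space \<pi>"
    and \<mu>: "\<mu> = distr \<pi> borel fst" and \<nu>: "\<nu> = distr \<pi> borel snd" by (auto simp: couplings_def)
  have [measurable]: "fst \<in> borel_measurable \<pi>" "snd \<in> borel_measurable \<pi>"
    using s by (auto cong: measurable_cong_sets)
  let ?\<tau> = "distr \<pi> (borel \<Otimes>\<^sub>M borel) (\<lambda>z. (\<theta> \<bullet> fst z, \<theta> \<bullet> snd z))"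
  have "?\<tau> \<in> couplings (proj_law \<theta> \<mu>) (proj_law \<theta> \<nu>)"
    unfolding couplings_def proj_law_def \<mu> \<nu>
    by (auto simp: prob_space.prob_space_distr[OF p] distr_distr comp_def)
  then have "W2sq (proj_law \<theta> \<mu>) (proj_law \<theta> \<nu>) \<le> (\<integral>\<^sup>+ z. ennreal ((dist (fst z) (snd z))\<^sup>2) \<partial>?\<tau>)"
    unfolding W2sq_def by (rule INF_lower)
  also have "\<dots> = (\<integral>\<^sup>+ z. ennreal ((dist (\<theta> \<bullet> fst z) (\<theta> \<bullet> snd z))\<^sup>2) \<partial>\<pi>)"
    by (subst nn_integral_distr) auto
  also have "\<dots> \<le> (\<integral>\<^sup>+ z. ennreal ((dist (fst z) (snd z))\<^sup>2) \<partial>\<pi>)"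
  proof (intro nn_integral_mono ennreal_leI power_mono)
    fix z :: "'a \<times> 'a"
    show "dist (\<theta> \<bullet> fst z) (\<theta> \<bullet> snd z) \<le> dist (fst z) (snd z)"
      using Cauchy_Schwarz_ineq2[of \<theta> "fst z - snd z"] \<theta>
      by (simp add: dist_norm inner_diff_right)
  qed simp
  finally show "W2sq (proj_law \<theta> \<mu>) (proj_law \<theta> \<nu>) \<le> (\<integral>\<^sup>+ z. ennreal ((dist (fst z) (snd z))\<^sup>2) \<partial>\<pi>)" .
qed

lemma SW2sq_le_W2sq: "SW2sq \<mu> \<nu> \<le> W2sq \<mu> (\<nu> :: 'a::euclidean_space measure)"
proof -
  interpret U: prob_space "unif_sphere :: 'a measure" by (rule prob_space_unif_sphere)
  have "SW2sq \<mu> \<nu> \<le> (\<integral>\<^sup>+ (\<theta>::'a). W2sq \<mu> \<nu> \<partial>unif_sphere)"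
    unfolding SW2sq_def
    by (rule nn_integral_mono_AE, use AE_unif_sphere in eventually_elim) (simp add: W2sq_proj_law_le)
  then show ?thesis by (simp add: U.emeasure_space_1)
qed

section \<open>Running maxima, Doob's inequality and independence of the next direction\<close>

primrec runmax :: "(nat \<Rightarrow> real) \<Rightarrow> nat \<Rightarrow> real" where
  "runmax s 0 = s 0"
| "runmax s (Suc k) = max (runmax s k) (s (Suc k))"

lemma runmax_ge: "j \<le> k \<Longrightarrow> s j \<le> runmax s k"
  by (induction k) (auto simp: le_Suc_eq)

lemma runmax_cong: "(\<And>j. j \<le> k \<Longrightarrow> s j = s' j) \<Longrightarrow> runmax s k = runmax s' k"
  by (induction k) auto

lemma borel_measurable_runmax:
  "(\<And>j. j \<le> k \<Longrightarrow> s j \<in> borel_measurable M) \<Longrightarrow> (\<lambda>\<omega>. runmax (\<lambda>j. s j \<omega>) k) \<in> borel_measurable M"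
  by (induction k) auto

text \<open>The deterministic inequality behind Doob's. As long as the maximum \<open>m\<close> does
  not move, both sides change equally; when it jumps from \<open>m\<close> to \<open>b\<close>, the
  right side gains an extra \<open>(m - b)^2 / 2\<close>.\<close>

lemma runmax_sum_le:
  "(\<Sum>k<K. runmax s k * (s (Suc k) - s k)) \<le> runmax s K * s K - (runmax s K)\<^sup>2 / 2"
  if "s 0 = 0" for s :: "nat \<Rightarrow> real"
proof (induction K)
  case 0
  then show ?case using that by simp
next
  case (Suc K)
  define m where "m = runmax s K"
  define b where "b = s (Suc K)"
  have "m * b - m\<^sup>2 / 2 \<le> max m b * b - (max m b)\<^sup>2 / 2"
    using zero_le_power2[of "m - b"] by (cases "b \<le> m") (auto simp: max_def power2_eq_square algebra_simps)
  then show ?case using Suc by (simp add: m_def b_def algebra_simps)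
qed

text \<open>Doob's maximal inequality for the norms \<open>s k\<close> of a Hilbert space valued martingale, with
  increments of norm \<open>d k\<close> and \<open>c k\<close> the inner product of the \<open>k\<close>-th increment and the
  \<open>k\<close>-th term. It follows by taking expectations in the pathwise inequality
  \<open>(max s)\<^sup>2 \<le> 4 (s K)\<^sup>2 - 4 (\<Sum>k<K. runmax s k / s k * c k)\<close>.\<close>

lemma Doob_maximal_L2:
  fixes s c d :: "nat \<Rightarrow> 'v \<Rightarrow> real"
  assumes M: "prob_space M"
    and [measurable]: "\<And>k. k \<le> K \<Longrightarrow> s k \<in> borel_measurable M" "\<And>k. k < K \<Longrightarrow> c k \<in> borel_measurable M"
    and s0: "AE \<omega> in M. s 0 \<omega> = 0"
    and step: "AE \<omega> in M. \<forall>k<K. (s (Suc k) \<omega>)\<^sup>2 = (s k \<omega>)\<^sup>2 + 2 * c k \<omega> + (d k \<omega>)\<^sup>2"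
    and inner: "AE \<omega> in M. \<forall>k<K. (s k \<omega>)\<^sup>2 + c k \<omega> \<le> s k \<omega> * s (Suc k) \<omega>"
    and cbound: "AE \<omega> in M. \<forall>k<K. \<bar>c k \<omega>\<bar> \<le> s k \<omega> * d k \<omega>"
    and dbound: "AE \<omega> in M. \<forall>k<K. d k \<omega> \<le> \<delta>"
    and pos: "\<And>k \<omega>. 0 \<le> s k \<omega>" "\<And>k \<omega>. 0 \<le> d k \<omega>"
    and orth: "\<And>k. k < K \<Longrightarrow> (\<integral>\<omega>. c k \<omega> \<partial>M) = 0"
      "\<And>k. k < K \<Longrightarrow> (\<integral>\<omega>. runmax (\<lambda>j. s j \<omega>) k / s k \<omega> * c k \<omega> \<partial>M) = 0"
  shows "(\<integral>\<^sup>+\<omega>. ennreal ((runmax (\<lambda>j. s j \<omega>) K)\<^sup>2) \<partial>M) \<le> ennreal (4 * real K * \<delta>\<^sup>2)"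
proof -
  interpret prob_space M by fact
  let ?m = "\<lambda>k \<omega>. runmax (\<lambda>j. s j \<omega>) k"
  let ?a = "\<lambda>k \<omega>. ?m k \<omega> / s k \<omega> * c k \<omega>"
  have mm[measurable]: "?m k \<in> borel_measurable M" if "k \<le> K" for k
    using that by (intro borel_measurable_runmax) auto
  \<comment> \<open>Crude bounds that serve the integrability of \<open>c k\<close> and
    \<open>?a k\<close>; they do not enter the final constant.\<close>
  have bounds: "AE \<omega> in M. \<forall>k\<le>K. ?m k \<omega> \<le> real k * \<delta> \<and> s k \<omega> \<le> real k * \<delta>"
    using s0 step cbound dbound
  proof eventually_elim
    case (elim \<omega>)
    show ?case
    proof (intro allI impI)
      fix k assume "k \<le> K"
      then show "?m k \<omega> \<le> real k * \<delta> \<and> s k \<omega> \<le> real k * \<delta>"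
      proof (induction k)
        case 0 then show ?case using elim by simp
      next
        case (Suc k)
        then have k: "k < K" by simp
        have "(s (Suc k) \<omega>)\<^sup>2 \<le> (s k \<omega> + d k \<omega>)\<^sup>2"
          using elim k by (auto simp: power2_sum abs_le_iff)
        then have "s (Suc k) \<omega> \<le> s k \<omega> + d k \<omega>"
          by (rule power2_le_imp_le) (simp add: pos)
        also have "\<dots> \<le> real k * \<delta> + \<delta>" using Suc k elim by (intro add_mono) auto
        finally have *: "s (Suc k) \<omega> \<le> real (Suc k) * \<delta>" by (simp add: algebra_simps)
        have "0 \<le> \<delta>" using elim k pos(2)[of k \<omega>] by (meson order_trans)
        then show ?case using * Suc by (auto simp: algebra_simps)
      qed
    qed
  qed
  have \<delta>0: "AE \<omega> in M. K = 0 \<or> 0 \<le> \<delta>"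
    using dbound by eventually_elim (use pos(2) in \<open>meson not_gr_zero order_trans\<close>)
  have mpos: "0 \<le> ?m k \<omega>" for k \<omega> using runmax_ge[of 0 k "\<lambda>j. s j \<omega>"] pos(1)[of 0 \<omega>] by simp
  have ic: "integrable M (c k)" if k: "k < K" for k
  proof (rule integrable_const_bound)
    show "AE \<omega> in M. norm (c k \<omega>) \<le> (real k * \<delta>) * \<delta>"
      using bounds dbound cbound \<delta>0
    proof eventually_elim
      case (elim \<omega>)
      have "norm (c k \<omega>) \<le> s k \<omega> * d k \<omega>" using elim k by simp
      also have "\<dots> \<le> (real k * \<delta>) * \<delta>"
        using elim k pos by (intro mult_mono) auto
      finally show ?case .
    qed
  qed (use k in simp)
  have ia: "integrable M (?a k)" if k: "k < K" for k
  proof (rule integrable_const_bound)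
    have [measurable]: "?m k \<in> borel_measurable M" "s k \<in> borel_measurable M" "c k \<in> borel_measurable M"
      using k by (auto intro!: mm)
    show "?a k \<in> borel_measurable M" by measurable
    show "AE \<omega> in M. norm (?a k \<omega>) \<le> (real k * \<delta>) * \<delta>"
      using bounds dbound cbound \<delta>0
    proof eventually_elim
      case (elim \<omega>)
      have "norm (?a k \<omega>) = ?m k \<omega> / s k \<omega> * \<bar>c k \<omega>\<bar>"
        using mpos[of \<omega> k] pos(1)[of k \<omega>] by (simp add: abs_mult)
      also have "\<dots> \<le> ?m k \<omega> / s k \<omega> * (s k \<omega> * d k \<omega>)"
        using elim k mpos[of \<omega> k] pos(1)[of k \<omega>] by (intro mult_left_mono) auto
      also have "\<dots> \<le> ?m k \<omega> * d k \<omega>"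
        using mpos[of \<omega> k] pos(2)[of k \<omega>] by (cases "s k \<omega> = 0") auto
      also have "\<dots> \<le> (real k * \<delta>) * \<delta>"
        using elim k pos(2)[of k \<omega>] mpos[of \<omega> k] by (intro mult_mono) auto
      finally show ?case .
    qed
  qed
  \<comment> \<open>The majorant joins the pathwise inequality with
    \<open>(s K)^2 \<le> K * \<delta>^2 + 2 * (\<Sum>k<K. c k)\<close>, whence the factors 4 and 8.
    Both sums have mean zero.\<close>
  define R where "R \<omega> = 4 * real K * \<delta>\<^sup>2 + 8 * (\<Sum>k<K. c k \<omega>) - 4 * (\<Sum>k<K. ?a k \<omega>)" for \<omega>
  have le: "AE \<omega> in M. (?m K \<omega>)\<^sup>2 \<le> R \<omega>"
    using s0 step inner dbound
  proof eventually_elim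
    case (elim \<omega>)
    let ?s = "\<lambda>j. s j \<omega>"
    have "(\<Sum>k<K. ?a k \<omega>) \<le> (\<Sum>k<K. runmax ?s k * (?s (Suc k) - ?s k))"
    proof (rule sum_mono)
      fix k assume "k \<in> {..<K}"
      then have k: "k < K" by simp
      show "?a k \<omega> \<le> ?m k \<omega> * (s (Suc k) \<omega> - s k \<omega>)"
      \<comment> \<open>At a zero of \<open>s k\<close> the quotient is 0 by the convention for
        division, while the right side is nonnegative.\<close>
      proof (cases "s k \<omega> = 0")
        case True
        then show ?thesis using mpos[of \<omega> k] pos(1)[of "Suc k" \<omega>] by simp
      next
        case False
        then have sp: "0 < s k \<omega>" using pos(1)[of k \<omega>] by simp
        have "c k \<omega> \<le> s k \<omega> * (s (Suc k) \<omega> - s k \<omega>)"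
          using elim k by (auto simp: power2_eq_square algebra_simps)
        then have "?a k \<omega> \<le> ?m k \<omega> / s k \<omega> * (s k \<omega> * (s (Suc k) \<omega> - s k \<omega>))"
          using sp mpos[of \<omega> k] by (intro mult_left_mono) auto
        then show ?thesis using sp by simp
      qed
    qed
    also have "\<dots> \<le> ?m K \<omega> * ?s K - (?m K \<omega>)\<^sup>2 / 2"
      by (rule runmax_sum_le) (use elim in simp)
    \<comment> \<open>The square of \<open>2 * s K - m K\<close> is nonnegative, which absorbs the
      mixed term and produces Doob's constant 4.\<close>
    finally have "(?m K \<omega>)\<^sup>2 \<le> 4 * (?s K)\<^sup>2 - 4 * (\<Sum>k<K. ?a k \<omega>)"
      using zero_le_power2[of "2 * ?s K - ?m K \<omega>"] by (simp add: power2_diff algebra_simps)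
    moreover have "(?s k)\<^sup>2 \<le> real k * \<delta>\<^sup>2 + 2 * (\<Sum>j<k. c j \<omega>)" if "k \<le> K" for k
      using that
    proof (induction k)
      case 0 then show ?case using elim by simp
    next
      case (Suc k)
      then have "(d k \<omega>)\<^sup>2 \<le> \<delta>\<^sup>2" using elim pos by (intro power_mono) auto
      then show ?case using Suc elim by (simp add: algebra_simps)
    qed
    from this[of K] have "4 * (?s K)\<^sup>2 \<le> 4 * real K * \<delta>\<^sup>2 + 8 * (\<Sum>j<K. c j \<omega>)" by simp
    ultimately show ?case by (simp add: R_def)
  qed
  have iR: "integrable M R" unfolding R_def
    by (intro Bochner_Integration.integrable_diff Bochner_Integration.integrable_add
        Bochner_Integration.integrable_mult_right Bochner_Integration.integrable_sum integrable_const)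
      (auto intro: ic ia[unfolded times_divide_eq_left])
  have "(\<integral>\<^sup>+\<omega>. ennreal ((?m K \<omega>)\<^sup>2) \<partial>M) \<le> (\<integral>\<^sup>+\<omega>. ennreal (R \<omega>) \<partial>M)"
    by (rule nn_integral_mono_AE, use le in eventually_elim) (rule ennreal_leI)
  also have "\<dots> = ennreal (\<integral>\<omega>. R \<omega> \<partial>M)"
    by (rule nn_integral_eq_integral[OF iR], use le in eventually_elim)
      (rule order_trans[OF zero_le_power2])
  also have "(\<integral>\<omega>. R \<omega> \<partial>M) = 4 * real K * \<delta>\<^sup>2"
  proof -
    have "(\<integral>\<omega>. (\<Sum>k<K. c k \<omega>) \<partial>M) = 0"
      by (subst Bochner_Integration.integral_sum) (auto simp: ic orth)
    moreover have "(\<integral>\<omega>. (\<Sum>k<K. ?a k \<omega>) \<partial>M) = (\<Sum>k<K. (\<integral>\<omega>. ?a k \<omega> \<partial>M))"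
      by (rule Bochner_Integration.integral_sum) (rule ia, simp)
    moreover have "\<dots> = 0"
      by (rule sum.neutral) (use orth(2) in blast)
    moreover have "integrable M (\<lambda>\<omega>. \<Sum>k<K. c k \<omega>)" "integrable M (\<lambda>\<omega>. \<Sum>k<K. ?a k \<omega>)"
      by (rule Bochner_Integration.integrable_sum, simp only: lessThan_iff ic ia)+
    ultimately show ?thesis
      unfolding R_def by (simp only: Bochner_Integration.integral_diff Bochner_Integration.integral_add
        Bochner_Integration.integrable_diff Bochner_Integration.integrable_add integral_mult_right_zero
        Bochner_Integration.integrable_mult_right integrable_const) (simp add: prob_space)
  qed
  finally show ?thesis .
qed

text \<open>This replaces conditioning on the past: history and next direction have a product law,
  so the next direction may be integrated first with the history frozen.\<close>

lemma (in prob_space) integral_indep_next_eq_0: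
  fixes \<theta> :: "nat \<Rightarrow> 'a \<Rightarrow> 'b::euclidean_space" and \<phi> :: "(nat \<Rightarrow> 'b) \<times> 'b \<Rightarrow> real"
  assumes ind: "indep_vars (\<lambda>_. borel) \<theta> UNIV" and \<sigma>: "distr M borel (\<theta> k) = \<sigma>"
    and [measurable]: "\<phi> \<in> borel_measurable (PiM {..<k} (\<lambda>_. borel) \<Otimes>\<^sub>M borel)"
    and bd: "AE \<omega> in M. \<bar>\<phi> (restrict (\<lambda>j. \<theta> j \<omega>) {..<k}, \<theta> k \<omega>)\<bar> \<le> B"
    and mean: "AE \<omega> in M. (\<integral>t. \<phi> (restrict (\<lambda>j. \<theta> j \<omega>) {..<k}, t) \<partial>\<sigma>) = 0"
  shows "(\<integral>\<omega>. \<phi> (restrict (\<lambda>j. \<theta> j \<omega>) {..<k}, \<theta> k \<omega>) \<partial>M) = 0"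
proof -
  let ?H = "PiM {..<k} (\<lambda>_. borel :: 'b measure)"
  let ?h = "\<lambda>\<omega>. restrict (\<lambda>j. \<theta> j \<omega>) {..<k}"
  have [measurable]: "\<theta> j \<in> borel_measurable M" for j using ind by (auto simp: indep_vars_def)
  have [measurable]: "?h \<in> measurable M ?H" by measurable
  \<comment> \<open>The next direction is first treated as a family indexed by \<open>{k}\<close>,
    the form in which independence of disjoint blocks is available; evaluation at \<open>k\<close>
    then removes the wrapping.\<close>
  let ?Hk = "PiM {k} (\<lambda>_. borel :: 'b measure)"
  let ?hk = "\<lambda>\<omega>. restrict (\<lambda>j. \<theta> j \<omega>) {k}"
  have [measurable]: "?hk \<in> measurable M ?Hk" by measurable
  have "indep_var ?H ?h ?Hk ?hk"
    by (rule indep_var_restrict[OF ind]) auto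
  then have ind_eq: "distr M ?H ?h \<Otimes>\<^sub>M distr M ?Hk ?hk = distr M (?H \<Otimes>\<^sub>M ?Hk) (\<lambda>\<omega>. (?h \<omega>, ?hk \<omega>))"
    unfolding indep_var_distribution_eq by simp
  have \<sigma>k: "\<sigma> = distr (distr M ?Hk ?hk) borel (\<lambda>f. f k)"
    by (subst distr_distr) (auto simp: comp_def \<sigma>)
  have "distr M ?H ?h \<Otimes>\<^sub>M \<sigma> = distr (distr M ?H ?h) ?H (\<lambda>x. x) \<Otimes>\<^sub>M distr (distr M ?Hk ?hk) borel (\<lambda>f. f k)"
    unfolding \<sigma>k by (simp add: distr_id2)
  also have "\<dots> = distr (distr M ?H ?h \<Otimes>\<^sub>M distr M ?Hk ?hk) (?H \<Otimes>\<^sub>M borel) (\<lambda>(x, f). (x, f k))"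
    by (rule pair_measure_distr)
      (auto intro!: prob_space_imp_sigma_finite prob_space.prob_space_distr prob_space_distr)
  also have "\<dots> = distr M (?H \<Otimes>\<^sub>M borel) (\<lambda>\<omega>. (?h \<omega>, \<theta> k \<omega>))"
    unfolding ind_eq by (subst distr_distr) (auto simp: comp_def)
  finally have eq: "distr M ?H ?h \<Otimes>\<^sub>M \<sigma> = distr M (?H \<Otimes>\<^sub>M borel) (\<lambda>\<omega>. (?h \<omega>, \<theta> k \<omega>))" .
  interpret H: prob_space "distr M ?H ?h" by (rule prob_space_distr) simp
  interpret S: prob_space \<sigma> unfolding \<sigma>[symmetric] by (rule prob_space_distr) simp
  interpret HS: pair_sigma_finite "distr M ?H ?h" \<sigma> ..
  have [measurable_cong]: "sets \<sigma> = sets borel" unfolding \<sigma>[symmetric] by simp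
  have "integrable M (\<lambda>\<omega>. \<phi> (?h \<omega>, \<theta> k \<omega>))"
    by (rule integrable_const_bound[of _ B]) (use bd in auto)
  then have int: "integrable (distr M ?H ?h \<Otimes>\<^sub>M \<sigma>) \<phi>"
    unfolding eq by (subst integrable_distr_eq) auto
  have "(\<integral>\<omega>. \<phi> (?h \<omega>, \<theta> k \<omega>) \<partial>M) = (\<integral>p. \<phi> p \<partial>(distr M ?H ?h \<Otimes>\<^sub>M \<sigma>))"
    unfolding eq by (subst integral_distr) auto
  also have "\<dots> = (\<integral>x. (\<integral>t. \<phi> (x, t) \<partial>\<sigma>) \<partial>distr M ?H ?h)"
    by (rule HS.integral_fst'[OF int, symmetric])
  also have "\<dots> = (\<integral>\<omega>. (\<integral>t. \<phi> (?h \<omega>, t) \<partial>\<sigma>) \<partial>M)"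
    by (subst integral_distr) (auto intro!: S.borel_measurable_lebesgue_integral)
  also have "\<dots> = 0" by (rule integral_eq_zero_AE[OF mean])
  finally show ?thesis .
qed

section \<open>The martingale part of the randomized scheme\<close>

locale sliced_scheme = sliced_target P \<rho>1 + Q: prob_space Q
  for P :: "'w measure" and \<rho>1 :: "'a::euclidean_space measure" and Q :: "'v measure" +
  fixes x0 :: "'w \<Rightarrow> 'a" and lam :: "real \<Rightarrow> real" and h \<Lambda> :: real and K :: nat and \<theta> :: "nat \<Rightarrow> 'v \<Rightarrow> 'a"
  assumes x0: "ac_rv x0" and h: "0 < h" and \<Lambda>_bounds: "0 \<le> \<Lambda>" "h * \<Lambda> < 1"
    and lam_steps: "\<And>k. k < K \<Longrightarrow> 0 \<le> lam (real k * h) \<and> lam (real k * h) \<le> \<Lambda>"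
    and ind: "Q.indep_vars (\<lambda>_. borel) \<theta> UNIV" and dir_law: "\<And>k. distr Q borel (\<theta> k) = unif_sphere"
begin

abbreviation X :: "(nat \<Rightarrow> 'a) \<Rightarrow> nat \<Rightarrow> 'w \<Rightarrow> 'a" where
  "X \<equiv> iterate P x0 \<rho>1 lam h"

definition step :: "nat \<Rightarrow> real" where "step k = h * lam (real k * h)"

text \<open>The sampled direction \<open>t\<close> is separated from the history \<eta> so that it
  can be averaged while the history stays fixed.\<close>

definition noise :: "(nat \<Rightarrow> 'a) \<Rightarrow> nat \<Rightarrow> 'a \<Rightarrow> 'w \<Rightarrow> 'a" where
  "noise \<eta> k t w = - step k *\<^sub>R
     (sliced_dir \<rho>1 (law (X \<eta> k)) t (X \<eta> k w) - avg_dir \<rho>1 (law (X \<eta> k)) (X \<eta> k w))"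

primrec mart :: "(nat \<Rightarrow> 'a) \<Rightarrow> nat \<Rightarrow> 'w \<Rightarrow> 'a" where
  "mart \<eta> 0 = (\<lambda>w. 0)"
| "mart \<eta> (Suc k) = (\<lambda>w. mart \<eta> k w + noise \<eta> k (\<eta> k) w)"

lemma X_Suc: "X \<eta> (Suc k) = (\<lambda>w. X \<eta> k w - step k *\<^sub>R sliced_dir \<rho>1 (law (X \<eta> k)) (\<eta> k) (X \<eta> k w))"
  by (simp add: step_def)

text \<open>Removing the martingale cancels the sampled direction: what remains advances by an Euler
  increment in the averaged direction, still evaluated at the actual iterate.\<close>

lemma X_minus_mart_Suc:
  "X \<eta> (Suc k) w - mart \<eta> (Suc k) w
     = X \<eta> k w - mart \<eta> k w - step k *\<^sub>R avg_dir \<rho>1 (law (X \<eta> k)) (X \<eta> k w)"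
  unfolding X_Suc by (simp add: noise_def algebra_simps)

text \<open>Adaptedness. Together with the next two lemmas it allows a direction sequence to be cut
  down to its first \<open>k\<close> entries, the block that is independent of entry
  \<open>k\<close>.\<close>

lemma X_cong: "(\<And>j. j < k \<Longrightarrow> \<eta> j = \<eta>' j) \<Longrightarrow> X \<eta> k = X \<eta>' k"
proof (induction k)
  case (Suc k)
  then have "X \<eta> k = X \<eta>' k" "\<eta> k = \<eta>' k" by auto
  then show ?case by simp
qed simp

lemma noise_cong: "(\<And>j. j < k \<Longrightarrow> \<eta> j = \<eta>' j) \<Longrightarrow> noise \<eta> k = noise \<eta>' k"
  using X_cong[of k \<eta> \<eta>'] by (intro ext) (simp only: noise_def)

lemma mart_cong: "(\<And>j. j < k \<Longrightarrow> \<eta> j = \<eta>' j) \<Longrightarrow> mart \<eta> k = mart \<eta>' k"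
proof (induction k)
  case (Suc k)
  then have "mart \<eta> k = mart \<eta>' k" "noise \<eta> k = noise \<eta>' k" "\<eta> k = \<eta>' k"
    by (auto intro!: noise_cong)
  then show ?case by simp
qed simp

lemma step_bounds: "k < K \<Longrightarrow> 0 \<le> step k \<and> step k \<le> h * \<Lambda>"
  using lam_steps[of k] h by (simp add: step_def)

lemma h\<Lambda>_nonneg: "0 \<le> h * \<Lambda>" using h \<Lambda>_bounds(1) by simp

text \<open>Both claims are proved in one induction, since the bound on a step needs the absolute
  continuity reached so far. Adding \<open>R1\<close> to the norm makes the recursion homogeneous
  with factor \<open>1 + h * \<Lambda>\<close>.\<close>

lemma
  assumes "\<And>j. j < k \<Longrightarrow> norm (\<eta> j) = 1" "k \<le> K"
  shows ac_rv_X: "ac_rv (X \<eta> k)"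
    and L2norm_X_le: "L2norm P (X \<eta> k) + R1 \<le> (1 + h * \<Lambda>) ^ k * (L2norm P x0 + R1)"
proof -
  have "ac_rv (X \<eta> k) \<and> L2norm P (X \<eta> k) + R1 \<le> (1 + h * \<Lambda>) ^ k * (L2norm P x0 + R1)"
    using assms
  proof (induction k)
    case 0
    then show ?case by (simp add: x0)
  next
    case (Suc k)
    then have ac: "ac_rv (X \<eta> k)" and IH: "L2norm P (X \<eta> k) + R1 \<le> (1 + h * \<Lambda>) ^ k * (L2norm P x0 + R1)"
      and u: "norm (\<eta> k) = 1" and k: "k < K" by auto
    note s = step_bounds[OF k]
    have "ac_rv (X \<eta> (Suc k))"
      unfolding X_Suc by (rule ac_rv_step[OF ac u]) (use s \<Lambda>_bounds in auto)
    moreover have "L2norm P (X \<eta> (Suc k)) \<le> L2norm P (X \<eta> k) + step k * (L2norm P (X \<eta> k) + R1)"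
    proof -
      have "L2norm P (X \<eta> (Suc k)) \<le> L2norm P (X \<eta> k)
          + L2norm P (\<lambda>w. step k *\<^sub>R sliced_dir \<rho>1 (law (X \<eta> k)) (\<eta> k) (X \<eta> k w))"
        unfolding X_Suc by (intro L2norm_triangle_diff ac_rv_sqint ac sqint_scaleR sqint_sliced_dir u)
      also have "\<dots> \<le> L2norm P (X \<eta> k) + step k * (L2norm P (X \<eta> k) + R1)"
        using s L2norm_sliced_dir[OF ac u] by (simp add: L2norm_scaleR mult_left_mono)
      finally show ?thesis .
    qed
    moreover have "step k * (L2norm P (X \<eta> k) + R1) \<le> h * \<Lambda> * (L2norm P (X \<eta> k) + R1)"
      using s L2norm_nonneg[of P "X \<eta> k"] R1_nonneg by (intro mult_right_mono) auto
    moreover have "(1 + h * \<Lambda>) * (L2norm P (X \<eta> k) + R1) \<le> (1 + h * \<Lambda>) * ((1 + h * \<Lambda>) ^ k * (L2norm P x0 + R1))"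
      using IH h\<Lambda>_nonneg by (intro mult_left_mono) auto
    ultimately show ?case by (auto simp: algebra_simps)
  qed
  then show "ac_rv (X \<eta> k)" "L2norm P (X \<eta> k) + R1 \<le> (1 + h * \<Lambda>) ^ k * (L2norm P x0 + R1)" by auto
qed

text \<open>A bound valid at all steps up to \<open>K\<close>. It still contains \<open>h\<close>;
  an exponential in \<open>\<Lambda> * tbar\<close> replaces it once \<open>K * h\<close> is known
  to be at most \<open>tbar\<close>.\<close>

definition B :: real where "B = (1 + h * \<Lambda>) ^ K * (L2norm P x0 + R1)"

lemma B_nonneg: "0 \<le> B"
  unfolding B_def using h\<Lambda>_nonneg L2norm_nonneg[of P x0] R1_nonneg by (intro mult_nonneg_nonneg) auto

lemma L2norm_X_le_B:
  assumes "\<And>j. j < k \<Longrightarrow> norm (\<eta> j) = 1" "k \<le> K"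
  shows "L2norm P (X \<eta> k) + R1 \<le> B"
proof -
  have "(1 + h * \<Lambda>) ^ k \<le> (1 + h * \<Lambda>) ^ K" using assms(2) h\<Lambda>_nonneg by (intro power_increasing) auto
  then have "(1 + h * \<Lambda>) ^ k * (L2norm P x0 + R1) \<le> B"
    unfolding B_def using L2norm_nonneg[of P x0] R1_nonneg by (intro mult_right_mono) auto
  with L2norm_X_le[of k \<eta>, OF assms] show ?thesis by linarith
qed

text \<open>The sampled and the averaged direction are each bounded by \<open>B\<close>, which gives
  the factor 2.\<close>

lemma
  assumes u: "\<And>j. j < k \<Longrightarrow> norm (\<eta> j) = 1" and t: "norm t = 1" and k: "k < K"
  shows sqint_noise: "sqint P (noise \<eta> k t)"
    and L2norm_noise_le: "L2norm P (noise \<eta> k t) \<le> 2 * (h * \<Lambda>) * B"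
proof -
  have ac: "ac_rv (X \<eta> k)" using ac_rv_X u k by simp
  have XB: "L2norm P (X \<eta> k) + R1 \<le> B" by (rule L2norm_X_le_B) (use u k in auto)
  note sq = sqint_sliced_dir[OF ac t] sqint_avg_dir[OF ac]
  have n: "noise \<eta> k t = (\<lambda>w. - step k *\<^sub>R (sliced_dir \<rho>1 (law (X \<eta> k)) t (X \<eta> k w)
      - avg_dir \<rho>1 (law (X \<eta> k)) (X \<eta> k w)))" by (simp add: noise_def fun_eq_iff)
  show "sqint P (noise \<eta> k t)" unfolding n by (intro sqint_scaleR sqint_diff sq)
  have "L2norm P (\<lambda>w. sliced_dir \<rho>1 (law (X \<eta> k)) t (X \<eta> k w) - avg_dir \<rho>1 (law (X \<eta> k)) (X \<eta> k w)) \<le> 2 * B"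
    using L2norm_triangle_diff[OF sq] L2norm_sliced_dir[OF ac t] L2norm_avg_dir[OF ac] XB by linarith
  then have "L2norm P (noise \<eta> k t) \<le> (h * \<Lambda>) * (2 * B)"
    unfolding n L2norm_scaleR using step_bounds[OF k] B_nonneg L2norm_nonneg by (intro mult_mono) auto
  then show "L2norm P (noise \<eta> k t) \<le> 2 * (h * \<Lambda>) * B" by simp
qed

lemma sqint_mart:
  "(\<And>j. j < k \<Longrightarrow> norm (\<eta> j) = 1) \<Longrightarrow> k \<le> K \<Longrightarrow> sqint P (mart \<eta> k)"
  by (induction k) (auto intro!: sqint_add sqint_noise simp: sqint_zero)

text \<open>The sequence is a function \<open>d\<close> of an arbitrary parameter, so that one
  induction covers both the sampled directions on \<open>Q\<close> and the product space of
  histories. Since the law used at each step varies with the parameter, joint measurability is what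
  the induction must carry.\<close>

lemma borel_measurable_X:
  assumes "\<And>j. j < k \<Longrightarrow> (\<lambda>z. d z j) \<in> borel_measurable N"
  shows "(\<lambda>p. X (d (fst p)) k (snd p)) \<in> borel_measurable (N \<Otimes>\<^sub>M P)"
  using assms
proof (induction k)
  case 0
  have [measurable]: "x0 \<in> borel_measurable P" using x0 by (simp add: ac_rv_def)
  show ?case by simp
next
  case (Suc k)
  then have IH[measurable]: "(\<lambda>p. X (d (fst p)) k (snd p)) \<in> borel_measurable (N \<Otimes>\<^sub>M P)"
    and [measurable]: "(\<lambda>z. d z k) \<in> borel_measurable N" by auto
  have [measurable]: "(\<lambda>p. sliced_dir \<rho>1 (law (X (d (fst p)) k)) (d (fst p) k) (X (d (fst p)) k (snd p)))
      \<in> borel_measurable (N \<Otimes>\<^sub>M P)"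
    by (rule borel_measurable_sliced_dir[OF prob_space_axioms _ target_prob target_sets,
          where X="\<lambda>z. X (d z) k" and f=fst and N=N]) (auto simp: split_beta')
  show ?case unfolding X_Suc by measurable
qed

lemma borel_measurable_noise:
  assumes d: "\<And>j. j < k \<Longrightarrow> (\<lambda>z. d z j) \<in> borel_measurable N" and [measurable]: "t \<in> borel_measurable N"
  shows "(\<lambda>p. noise (d (fst p)) k (t (fst p)) (snd p)) \<in> borel_measurable (N \<Otimes>\<^sub>M P)"
proof -
  have X[measurable]: "(\<lambda>p. X (d (fst p)) k (snd p)) \<in> borel_measurable (N \<Otimes>\<^sub>M P)"
    by (rule borel_measurable_X[OF d])
  have [measurable]: "(\<lambda>p. sliced_dir \<rho>1 (law (X (d (fst p)) k)) (t (fst p)) (X (d (fst p)) k (snd p)))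
      \<in> borel_measurable (N \<Otimes>\<^sub>M P)"
    by (rule borel_measurable_sliced_dir[OF prob_space_axioms _ target_prob target_sets,
          where X="\<lambda>z. X (d z) k" and f=fst and N=N]) (auto simp: split_beta')
  have [measurable]: "(\<lambda>p. avg_dir \<rho>1 (law (X (d (fst p)) k)) (X (d (fst p)) k (snd p)))
      \<in> borel_measurable (N \<Otimes>\<^sub>M P)"
    by (rule borel_measurable_avg_dir[OF prob_space_axioms _ target_prob target_sets,
          where X="\<lambda>z. X (d z) k" and f=fst and N=N]) (auto simp: split_beta')
  show ?thesis unfolding noise_def by measurable
qed

lemma borel_measurable_mart:
  assumes "\<And>j. j < k \<Longrightarrow> (\<lambda>z. d z j) \<in> borel_measurable N"
  shows "(\<lambda>p. mart (d (fst p)) k (snd p)) \<in> borel_measurable (N \<Otimes>\<^sub>M P)"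
  using assms
proof (induction k)
  case (Suc k)
  then show ?case by (auto intro!: borel_measurable_add borel_measurable_noise[where t="\<lambda>z. d z k"])
qed simp

lemma borel_measurable_L2norm_mart:
  assumes "\<And>j. j < k \<Longrightarrow> (\<lambda>z. d z j) \<in> borel_measurable N"
  shows "(\<lambda>z. L2norm P (mart (d z) k)) \<in> borel_measurable N"
proof -
  have [measurable]: "(\<lambda>p. mart (d (fst p)) k (snd p)) \<in> borel_measurable (N \<Otimes>\<^sub>M P)"
    by (rule borel_measurable_mart[OF assms])
  have "(\<lambda>z. \<integral>w. (norm (mart (d z) k w))\<^sup>2 \<partial>P) \<in> borel_measurable N"
    by (rule borel_measurable_lebesgue_integral) (simp add: split_beta')
  then show ?thesis unfolding L2norm_def by simp
qed

lemma borel_measurable_noise_inner_mart: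
  assumes d: "\<And>j. j < k \<Longrightarrow> (\<lambda>z. d z j) \<in> borel_measurable N" and t: "t \<in> borel_measurable N"
  shows "(\<lambda>z. \<integral>w. noise (d z) k (t z) w \<bullet> mart (d z) k w \<partial>P) \<in> borel_measurable N"
proof -
  have [measurable]: "(\<lambda>p. mart (d (fst p)) k (snd p)) \<in> borel_measurable (N \<Otimes>\<^sub>M P)"
    "(\<lambda>p. noise (d (fst p)) k (t (fst p)) (snd p)) \<in> borel_measurable (N \<Otimes>\<^sub>M P)"
    by (rule borel_measurable_mart[OF d], assumption) (rule borel_measurable_noise[OF d t])
  show ?thesis
    by (rule borel_measurable_lebesgue_integral) (simp add: split_beta')
qed

abbreviation dir :: "'v \<Rightarrow> nat \<Rightarrow> 'a" where "dir \<omega> \<equiv> \<lambda>j. \<theta> j \<omega>"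

lemma \<theta>_measurable[measurable]: "\<theta> j \<in> borel_measurable Q"
  using ind by (auto simp: Q.indep_vars_def)

lemma AE_dir_unit: "AE \<omega> in Q. \<forall>j. norm (dir \<omega> j) = 1"
proof -
  have "AE \<omega> in Q. norm (\<theta> j \<omega>) = 1" for j
  proof -
    have "AE t in distr Q borel (\<theta> j). t \<in> sphere (0::'a) 1"
      unfolding dir_law by (rule AE_unif_sphere)
    then have "AE \<omega> in Q. \<theta> j \<omega> \<in> sphere (0::'a) 1" by (rule AE_distrD[rotated]) simp
    then show ?thesis by eventually_elim simp
  qed
  then show ?thesis by (simp add: AE_all_countable)
qed

text \<open>Orthogonality of an increment to the past, with a weight \<open>a\<close> that depends
  on the history. Doob's inequality needs the weight 1 and the weight running maximum over current
  norm.\<close>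

lemma expectation_noise_inner_mart:
  assumes k: "k < K"
    and a: "a \<in> borel_measurable (PiM {..<k} (\<lambda>_. borel))"
    and ac: "\<And>\<eta>. a (restrict \<eta> {..<k}) = a \<eta>"
    and bd: "AE \<omega> in Q. \<bar>a (dir \<omega>) * (\<integral>w. noise (dir \<omega>) k (\<theta> k \<omega>) w \<bullet> mart (dir \<omega>) k w \<partial>P)\<bar> \<le> b"
  shows "(\<integral>\<omega>. a (dir \<omega>) * (\<integral>w. noise (dir \<omega>) k (\<theta> k \<omega>) w \<bullet> mart (dir \<omega>) k w \<partial>P) \<partial>Q) = 0"
proof -
  let ?H = "PiM {..<k} (\<lambda>_. borel :: 'a measure)"
  define \<phi> where "\<phi> p = a (fst p) * (\<integral>w. noise (fst p) k (snd p) w \<bullet> mart (fst p) k w \<partial>P)" for p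
  have eq: "noise (restrict \<eta> {..<k}) k = noise \<eta> k" "mart (restrict \<eta> {..<k}) k = mart \<eta> k" for \<eta>
    by (auto intro!: noise_cong mart_cong)
  have \<phi>r: "\<phi> (restrict \<eta> {..<k}, t) = a \<eta> * (\<integral>w. noise \<eta> k t w \<bullet> mart \<eta> k w \<partial>P)" for \<eta> t
    unfolding \<phi>_def by (simp add: ac eq)
  have "(\<lambda>p. \<integral>w. noise (fst p) k (snd p) w \<bullet> mart (fst p) k w \<partial>P) \<in> borel_measurable (?H \<Otimes>\<^sub>M borel)"
    by (rule borel_measurable_noise_inner_mart) measurable
  moreover have "(\<lambda>p. a (fst p)) \<in> borel_measurable (?H \<Otimes>\<^sub>M borel)"
    by (rule measurable_compose[OF measurable_fst a])
  ultimately have \<phi>m: "\<phi> \<in> borel_measurable (?H \<Otimes>\<^sub>M borel)" unfolding \<phi>_def by (intro borel_measurable_times)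
  have "(\<integral>\<omega>. \<phi> (restrict (\<lambda>j. \<theta> j \<omega>) {..<k}, \<theta> k \<omega>) \<partial>Q) = 0"
  proof (rule Q.integral_indep_next_eq_0[OF ind dir_law \<phi>m])
    show "AE \<omega> in Q. \<bar>\<phi> (restrict (\<lambda>j. \<theta> j \<omega>) {..<k}, \<theta> k \<omega>)\<bar> \<le> b"
      using bd by (simp add: \<phi>r)
    show "AE \<omega> in Q. (\<integral>t. \<phi> (restrict (\<lambda>j. \<theta> j \<omega>) {..<k}, t) \<partial>unif_sphere) = 0"
      using AE_dir_unit
    proof eventually_elim
      case (elim \<omega>)
      then have "ac_rv (X (dir \<omega>) k)" "sqint P (mart (dir \<omega>) k)"
        using k by (auto intro!: ac_rv_X sqint_mart)
      from integral_inner_sliced_dir_minus_avg_dir[OF this] show ?case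
        by (simp add: \<phi>r noise_def)
    qed
  qed
  then show ?thesis by (simp add: \<phi>r)
qed

text \<open>There are \<open>K\<close> orthogonal increments of norm at most
  \<open>2 * (h * \<Lambda>) * B\<close>. With \<open>K * h\<close> bounded, the total is of order
  \<open>h\<close>.\<close>

lemma mart_maximal:
  "(\<integral>\<^sup>+\<omega>. ennreal ((runmax (\<lambda>j. L2norm P (mart (dir \<omega>) j)) K)\<^sup>2) \<partial>Q)
     \<le> ennreal (4 * real K * (2 * (h * \<Lambda>) * B)\<^sup>2)"
proof -
  let ?s = "\<lambda>k \<omega>. L2norm P (mart (dir \<omega>) k)"
  let ?d = "\<lambda>k \<omega>. L2norm P (noise (dir \<omega>) k (\<theta> k \<omega>))"
  let ?c = "\<lambda>k \<omega>. \<integral>w. noise (dir \<omega>) k (\<theta> k \<omega>) w \<bullet> mart (dir \<omega>) k w \<partial>P"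
  let ?\<delta> = "2 * (h * \<Lambda>) * B"
  have \<delta>: "0 \<le> ?\<delta>" by (rule mult_nonneg_nonneg[OF mult_nonneg_nonneg[OF _ h\<Lambda>_nonneg] B_nonneg]) simp
  have sq: "AE \<omega> in Q. \<forall>k<K. sqint P (mart (dir \<omega>) k) \<and> sqint P (noise (dir \<omega>) k (\<theta> k \<omega>)) \<and> ?d k \<omega> \<le> ?\<delta>"
    using AE_dir_unit by eventually_elim (auto intro!: sqint_mart sqint_noise L2norm_noise_le)
  have sSuc: "AE \<omega> in Q. \<forall>k<K. ?s (Suc k) \<omega> \<le> ?s k \<omega> + ?d k \<omega>"
    using sq by eventually_elim (auto intro!: L2norm_triangle)
  \<comment> \<open>The two mean zero conditions of Doob's inequality are verified by Fubini, which
    asks for a bound on the weighted inner products beforehand.\<close>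
  have m_bd: "AE \<omega> in Q. \<forall>k\<le>K. runmax (\<lambda>j. ?s j \<omega>) k \<le> real k * ?\<delta>"
    using sq sSuc
  proof eventually_elim
    case (elim \<omega>)
    have "?s k \<omega> \<le> real k * ?\<delta> \<and> runmax (\<lambda>j. ?s j \<omega>) k \<le> real k * ?\<delta>" if "k \<le> K" for k
      using that
    proof (induction k)
      case (Suc k)
      then have "?s (Suc k) \<omega> \<le> ?s k \<omega> + ?d k \<omega>" "?d k \<omega> \<le> ?\<delta>" using elim by auto
      then have "?s (Suc k) \<omega> \<le> real k * ?\<delta> + ?\<delta>" using Suc by linarith
      moreover have "runmax (\<lambda>j. ?s j \<omega>) k \<le> real k * ?\<delta> + ?\<delta>" using Suc \<delta> by linarith
      ultimately show ?case by (simp add: algebra_simps)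
    qed (simp add: L2norm_zero)
    then show ?case by blast
  qed
  have cb: "AE \<omega> in Q. \<forall>k<K. \<bar>?c k \<omega>\<bar> \<le> ?s k \<omega> * ?d k \<omega>"
    using sq
  proof eventually_elim
    case (elim \<omega>)
    show ?case
    proof (intro allI impI)
      fix k assume "k < K"
      then show "\<bar>?c k \<omega>\<bar> \<le> ?s k \<omega> * ?d k \<omega>"
        using L2_Cauchy_Schwarz_abs[of P "noise (dir \<omega>) k (\<theta> k \<omega>)" "mart (dir \<omega>) k"] elim
        by (simp add: mult.commute)
    qed
  qed
  have mpos: "0 \<le> runmax (\<lambda>j. ?s j \<omega>) k" for k \<omega>
    using runmax_ge[of 0 k "\<lambda>j. ?s j \<omega>"] by (simp add: L2norm_zero)
  have s_m: "?s k \<omega> \<le> runmax (\<lambda>j. ?s j \<omega>) k" for k \<omega>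
    using runmax_ge[of k k "\<lambda>j. ?s j \<omega>"] by simp
  have bd: "AE \<omega> in Q. \<forall>k<K. runmax (\<lambda>j. ?s j \<omega>) k * ?d k \<omega> \<le> (real k * ?\<delta>) * ?\<delta>"
    using sq m_bd
  proof eventually_elim
    case (elim \<omega>)
    then show ?case using \<delta> mpos L2norm_nonneg by (intro allI impI mult_mono) auto
  qed
  show ?thesis
  proof (rule Doob_maximal_L2[OF Q.prob_space_axioms])
    show "?s k \<in> borel_measurable Q" for k
      by (rule borel_measurable_L2norm_mart) simp
    show "?c k \<in> borel_measurable Q" for k
      by (rule borel_measurable_noise_inner_mart) auto
    show "AE \<omega> in Q. ?s 0 \<omega> = 0" by (simp add: L2norm_zero)
    show "AE \<omega> in Q. \<forall>k<K. (?s (Suc k) \<omega>)\<^sup>2 = (?s k \<omega>)\<^sup>2 + 2 * ?c k \<omega> + (?d k \<omega>)\<^sup>2"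
      using sq by eventually_elim (simp add: L2norm_add_sq)
    show "AE \<omega> in Q. \<forall>k<K. (?s k \<omega>)\<^sup>2 + ?c k \<omega> \<le> ?s k \<omega> * ?s (Suc k) \<omega>"
      using sq
    proof eventually_elim
      case (elim \<omega>)
      show ?case
      proof (intro allI impI)
        fix k assume "k < K"
        then have s: "sqint P (mart (dir \<omega>) k)" "sqint P (noise (dir \<omega>) k (\<theta> k \<omega>))" using elim by auto
        \<comment> \<open>The left side is the inner product of two consecutive martingale terms, so
          Cauchy-Schwarz bounds it by the product of their norms.\<close>
        have "(?s k \<omega>)\<^sup>2 + ?c k \<omega> = (\<integral>w. mart (dir \<omega>) (Suc k) w \<bullet> mart (dir \<omega>) k w \<partial>P)"
          using integrable_inner_sqint[OF s(1) s(1)] integrable_inner_sqint[OF s(2) s(1)]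
          by (simp add: inner_add_left L2norm_sq power2_norm_eq_inner)
        also have "\<dots> \<le> ?s (Suc k) \<omega> * ?s k \<omega>"
          by (rule L2_Cauchy_Schwarz) (auto intro!: sqint_add s)
        finally show "(?s k \<omega>)\<^sup>2 + ?c k \<omega> \<le> ?s k \<omega> * ?s (Suc k) \<omega>" by (simp add: mult.commute)
      qed
    qed
    show "AE \<omega> in Q. \<forall>k<K. \<bar>?c k \<omega>\<bar> \<le> ?s k \<omega> * ?d k \<omega>" by (rule cb)
    show "AE \<omega> in Q. \<forall>k<K. ?d k \<omega> \<le> ?\<delta>" using sq by eventually_elim auto
    show "0 \<le> ?s k \<omega>" "0 \<le> ?d k \<omega>" for k \<omega> by (rule L2norm_nonneg)+
    show "(\<integral>\<omega>. ?c k \<omega> \<partial>Q) = 0" if k: "k < K" for k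
    proof -
      have "(\<integral>\<omega>. 1 * ?c k \<omega> \<partial>Q) = 0"
      proof (rule expectation_noise_inner_mart[OF k, where a="\<lambda>_. 1"])
        show "AE \<omega> in Q. \<bar>1 * ?c k \<omega>\<bar> \<le> (real k * ?\<delta>) * ?\<delta>"
          using cb bd
        proof eventually_elim
          case (elim \<omega>)
          have "\<bar>?c k \<omega>\<bar> \<le> ?s k \<omega> * ?d k \<omega>" using elim k by simp
          also have "\<dots> \<le> runmax (\<lambda>j. ?s j \<omega>) k * ?d k \<omega>"
            by (intro mult_right_mono s_m L2norm_nonneg)
          also have "\<dots> \<le> (real k * ?\<delta>) * ?\<delta>" using elim k by blast
          finally show ?case by simp
        qed
      qed auto
      then show ?thesis by simp
    qed
    show "(\<integral>\<omega>. runmax (\<lambda>j. ?s j \<omega>) k / ?s k \<omega> * ?c k \<omega> \<partial>Q) = 0" if k: "k < K" for k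
    proof (rule expectation_noise_inner_mart[OF k, where a="\<lambda>\<eta>. runmax (\<lambda>j. L2norm P (mart \<eta> j)) k / L2norm P (mart \<eta> k)"])
      have "(\<lambda>\<eta>. L2norm P (mart \<eta> j)) \<in> borel_measurable (PiM {..<k} (\<lambda>_. borel))" if "j \<le> k" for j
        using that by (intro borel_measurable_L2norm_mart measurable_component_singleton) auto
      then show "(\<lambda>\<eta>. runmax (\<lambda>j. L2norm P (mart \<eta> j)) k / L2norm P (mart \<eta> k)) \<in> borel_measurable (PiM {..<k} (\<lambda>_. borel))"
        by (intro borel_measurable_divide borel_measurable_runmax) auto
      have "mart (restrict \<eta> {..<k}) j = mart \<eta> j" if "j \<le> k" for j and \<eta> :: "nat \<Rightarrow> 'a"
        using that by (intro mart_cong) auto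
      then show "runmax (\<lambda>j. L2norm P (mart (restrict \<eta> {..<k}) j)) k / L2norm P (mart (restrict \<eta> {..<k}) k)
        = runmax (\<lambda>j. L2norm P (mart \<eta> j)) k / L2norm P (mart \<eta> k)" for \<eta> :: "nat \<Rightarrow> 'a"
        by (simp cong: runmax_cong)
      show "AE \<omega> in Q. \<bar>runmax (\<lambda>j. ?s j \<omega>) k / ?s k \<omega> * ?c k \<omega>\<bar> \<le> (real k * ?\<delta>) * ?\<delta>"
        using cb bd
      proof eventually_elim
        case (elim \<omega>)
        have "\<bar>runmax (\<lambda>j. ?s j \<omega>) k / ?s k \<omega> * ?c k \<omega>\<bar> = runmax (\<lambda>j. ?s j \<omega>) k / ?s k \<omega> * \<bar>?c k \<omega>\<bar>"
          using mpos[of \<omega> k] L2norm_nonneg[of P "mart (dir \<omega>) k"] by (simp add: abs_mult)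
        also have "\<dots> \<le> runmax (\<lambda>j. ?s j \<omega>) k / ?s k \<omega> * (?s k \<omega> * ?d k \<omega>)"
          using elim(1) k by (intro mult_left_mono divide_nonneg_nonneg mpos L2norm_nonneg) auto
        also have "\<dots> \<le> runmax (\<lambda>j. ?s j \<omega>) k * ?d k \<omega>"
          by (cases "?s k \<omega> = 0") (auto intro!: mult_nonneg_nonneg mpos L2norm_nonneg)
        also have "\<dots> \<le> (real k * ?\<delta>) * ?\<delta>" using elim k by blast
        finally show ?case .
      qed
    qed
  qed
qed

end

section \<open>The fundamental theorem of calculus for absolutely continuous curves\<close>

text \<open>The gauge at a point of the exceptional null set is an open set of small measure containing
  the null set: absolute continuity then bounds the contribution of all intervals tagged there.\<close>

lemma has_integral_abs_cont:
  fixes f f' :: "real \<Rightarrow> 'a::euclidean_space"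
  assumes ab: "a \<le> b" and ac: "abs_cont_on_interval f a b" and N: "negligible N"
    and deriv: "\<And>t. t \<in> {a<..<b} - N \<Longrightarrow> (f has_vector_derivative f' t) (at t)"
  shows "(f' has_integral (f b - f a)) {a..b}"
proof -
  \<comment> \<open>The end points are added because derivatives are given in the open interval. On
    the enlarged null set the integrand is replaced by 0, so an interval tagged there contributes
    just an increment of \<open>f\<close>.\<close>
  define N' where "N' = insert a (insert b N)"
  have N': "negligible N'" using N by (simp add: N'_def)
  define g where "g t = (if t \<in> N' then 0 else f' t)" for t
  have "(g has_integral (f b - f a)) {a..b}"
    unfolding has_integral_real
  proof (intro allI impI)
    fix e :: real assume e: "0 < e"
    \<comment> \<open>One half of \<open>e\<close> is spent on intervals tagged outside
      \<open>N'\<close>, the other half is left to absolute continuity. The \<open>+ 1\<close> keeps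
      the denominator positive when \<open>a = b\<close>.\<close>
    define e' where "e' = e / (2 * (b - a + 1))"
    have e': "0 < e'" "e' * (b - a) < e / 2" using e ab by (auto simp: e'_def field_simps)
    obtain \<delta> where \<delta>: "0 < \<delta>" and
      acD: "\<And>I. finite I \<Longrightarrow> (\<forall>(u, v)\<in>I. a \<le> u \<and> u \<le> v \<and> v \<le> b) \<Longrightarrow>
        disjoint_family_on (\<lambda>(u, v). {u<..<v}) I \<Longrightarrow> (\<Sum>(u, v)\<in>I. v - u) < \<delta> \<Longrightarrow>
        (\<Sum>(u, v)\<in>I. norm (f v - f u)) < e / 2"
    proof -
      have "\<exists>\<delta>>0. \<forall>I. finite I \<and> (\<forall>(u, v)\<in>I. a \<le> u \<and> u \<le> v \<and> v \<le> b) \<and>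
         disjoint_family_on (\<lambda>(u, v). {u<..<v}) I \<and> (\<Sum>(u, v)\<in>I. v - u) < \<delta>
         \<longrightarrow> (\<Sum>(u, v)\<in>I. norm (f v - f u)) < e / 2"
        using ac half_gt_zero[OF e] unfolding abs_cont_on_interval_def by blast
      then show thesis using that by blast
    qed
    have "N' \<in> sets lebesgue" using N' by (auto simp: negligible_iff_null_sets)
    then obtain U where U: "open U" "N' \<subseteq> U" and Um: "U - N' \<in> lmeasurable" "emeasure lebesgue (U - N') < ennreal \<delta>"
      using \<delta> by (rule sets_lebesgue_outer_open)
    have UU: "U = (U - N') \<union> N'" using U by blast
    have Ul: "U \<in> lmeasurable"
      by (subst UU) (intro fmeasurable.Un Um negligible_imp_measurable N')
    have "measure lebesgue U = measure lebesgue (U - N')"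
      by (subst UU) (rule measure_Un_null_set, use Um N' in \<open>auto simp: negligible_iff_null_sets\<close>)
    also have "\<dots> < \<delta>"
      using Um \<delta> by (simp add: emeasure_eq_measure2 ennreal_less_iff)
    finally have Usmall: "measure lebesgue U < \<delta>" .
    have "\<exists>d>0. t \<in> {a..b} - N' \<longrightarrow> (\<forall>y. \<bar>y - t\<bar> < d \<longrightarrow> norm (f y - f t - (y - t) *\<^sub>R f' t) \<le> e' * \<bar>y - t\<bar>)" for t
    proof (cases "t \<in> {a..b} - N'")
      case True
      then have "(f has_vector_derivative f' t) (at t)" by (intro deriv) (auto simp: N'_def)
      then show ?thesis
        using e'(1) unfolding has_vector_derivative_def has_derivative_at_alt real_norm_def by blast
    qed (auto intro: exI[of _ 1])
    then obtain d where d: "\<And>t. 0 < d t"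
      and dD: "\<And>t y. t \<in> {a..b} - N' \<Longrightarrow> \<bar>y - t\<bar> < d t \<Longrightarrow> norm (f y - f t - (y - t) *\<^sub>R f' t) \<le> e' * \<bar>y - t\<bar>"
      by metis
    define \<gamma> where "\<gamma> t = (if t \<in> N' then U else ball t (d t))" for t
    have gauge: "gauge \<gamma>" using U d by (auto simp: gauge_def \<gamma>_def)
    have small: "norm ((\<Sum>(x, k)\<in>p. measure lborel k *\<^sub>R g x) - (f b - f a)) < e"
      if p: "p tagged_division_of {a..b}" and fine: "\<gamma> fine p" for p
    proof -
      note pD = tagged_division_ofD[OF p]
      define q where "q = {z \<in> p. fst z \<in> N'}"
      have qp: "q \<subseteq> p" "finite q" using pD(1) by (auto simp: q_def)
      have iv: "\<exists>u v. k = {u..v} \<and> u \<le> v \<and> a \<le> u \<and> v \<le> b \<and> x \<in> {u..v} \<and> Inf k = u \<and> Sup k = v \<and> measure lborel k = v - u"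
        if xk: "(x, k) \<in> p" for x k
      proof -
        obtain u v where k: "k = {u..v}" using pD(4)[OF xk] by auto
        then have "u \<le> v" "x \<in> {u..v}" using pD(2)[OF xk] by auto
        then show ?thesis using pD(3)[OF xk] k by (intro exI[of _ u] exI[of _ v]) auto
      qed
      let ?G = "\<lambda>(x, k). norm (measure lborel k *\<^sub>R g x - (f (Sup k) - f (Inf k)))"
      have "norm ((\<Sum>(x, k)\<in>p. measure lborel k *\<^sub>R g x) - (f b - f a))
          = norm (\<Sum>(x, k)\<in>p. measure lborel k *\<^sub>R g x - (f (Sup k) - f (Inf k)))"
        using additive_tagged_division_1[OF ab p, of f]
        by (simp add: split_beta' sum_subtractf)
      also have "\<dots> \<le> sum ?G p"
        by (rule order_trans[OF norm_sum]) (simp add: split_beta')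
      also have "\<dots> = sum ?G (p - q) + sum ?G q"
        using pD(1) qp by (intro sum.subset_diff) auto
      also have "sum ?G (p - q) \<le> (\<Sum>(x, k)\<in>p - q. e' * measure lborel k)"
      proof (rule sum_mono, clarify)
        fix x k assume xk: "(x, k) \<in> p" "(x, k) \<notin> q"
        then have x: "x \<notin> N'" by (auto simp: q_def)
        obtain u v where k: "k = {u..v}" "u \<le> v" "a \<le> u" "v \<le> b" "x \<in> {u..v}" "Inf k = u" "Sup k = v" "measure lborel k = v - u"
          using iv[OF xk(1)] by blast
        have "k \<subseteq> ball x (d x)" using fineD[OF fine xk(1)] x by (simp add: \<gamma>_def)
        moreover have "u \<in> k" "v \<in> k" using k(1,2) by auto
        ultimately have uv: "\<bar>u - x\<bar> < d x" "\<bar>v - x\<bar> < d x" by (auto simp: dist_real_def abs_minus_commute)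
        have xab: "x \<in> {a..b} - N'" using x k by auto
        have "measure lborel k *\<^sub>R g x - (f (Sup k) - f (Inf k))
            = (f u - f x - (u - x) *\<^sub>R f' x) - (f v - f x - (v - x) *\<^sub>R f' x)"
          using x by (simp add: k(6-8) g_def algebra_simps)
        also have "norm \<dots> \<le> e' * \<bar>u - x\<bar> + e' * \<bar>v - x\<bar>"
          by (rule order_trans[OF norm_triangle_ineq4]) (intro add_mono dD xab uv)
        also have "\<dots> = e' * measure lborel k" using k(5) by (simp add: k(8) algebra_simps)
        finally show "norm (measure lborel k *\<^sub>R g x - (f (Sup k) - f (Inf k))) \<le> e' * measure lborel k" .
      qed
      also have "\<dots> \<le> (\<Sum>(x, k)\<in>p. e' * measure lborel k)"
        using e' pD(1) by (intro sum_mono2) (auto simp: split_beta')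
      also have "\<dots> = e' * (b - a)"
        using additive_content_tagged_division[of p a b] p ab
        by (simp add: split_beta' sum_distrib_left[symmetric])
      also have "sum ?G q < e / 2"
      proof -
        let ?j = "\<lambda>(x, k). (Inf k, Sup k)"
        \<comment> \<open>Absolute continuity speaks of a set of end point pairs, whereas a tagged
          division may list one interval under several tags. Such repetitions have disjoint
          interiors, hence are degenerate and add 0 to the sums below.\<close>
        have same: "Inf k = Sup k" if kk: "(x, k) \<in> q" "(x', k') \<in> q" "(x, k) \<noteq> (x', k')" "Inf k = Inf k'" "Sup k = Sup k'"
          for x k x' k'
        proof -
          have m: "(x, k) \<in> p" "(x', k') \<in> p" using kk qp by auto
          obtain u v where "k = {u..v}" "u \<le> v" "Inf k = u" "Sup k = v" using iv[OF m(1)] by blast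
          moreover obtain u' v' where "k' = {u'..v'}" "Inf k' = u'" "Sup k' = v'" using iv[OF m(2)] by blast
          ultimately show ?thesis using pD(5)[OF m kk(3)] kk(4,5) by (auto simp: not_less[symmetric])
        qed
        have reidx: "(\<Sum>(u, v)\<in>?j ` q. F u v) = (\<Sum>(x, k)\<in>q. F (Inf k) (Sup k))"
          if F: "\<And>u. F u u = 0" for F :: "real \<Rightarrow> real \<Rightarrow> real"
        proof -
          have "(\<Sum>(u, v)\<in>?j ` q. F u v) = sum ((\<lambda>(u, v). F u v) \<circ> ?j) q"
          proof (rule sum.reindex_nontrivial[OF qp(2)])
            fix z z' assume z: "z \<in> q" "z' \<in> q" "z \<noteq> z'" "?j z = ?j z'"
            then have "Inf (snd z) = Sup (snd z)"
              by (intro same[of "fst z" "snd z" "fst z'" "snd z'"]) (simp_all add: split_beta' prod_eq_iff)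
            then show "(case ?j z of (u, v) \<Rightarrow> F u v) = 0" using F by (simp add: split_beta')
          qed
          then show ?thesis by (simp add: split_beta' comp_def)
        qed
        have "q tagged_partial_division_of {a..b}"
          using p qp by (meson tagged_division_of_def tagged_partial_division_subset)
        then have div: "snd ` q division_of \<Union>(snd ` q)" by (rule partial_division_of_tagged_division)
        have "(\<Sum>(x, k)\<in>q. Sup k - Inf k) = (\<Sum>(x, k)\<in>q. measure lborel k)"
          using iv qp by (intro sum.cong refl) fastforce
        also have "\<dots> = sum (measure lborel) (snd ` q)"
        proof -
          have "sum (measure lborel) (snd ` q) = sum (measure lborel \<circ> snd) q"
          proof (rule sum.reindex_nontrivial[OF qp(2)])
            fix z z' assume z: "z \<in> q" "z' \<in> q" "z \<noteq> z'" "snd z = snd z'"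
            obtain x k x' where zz: "z = (x, k)" "z' = (x', k)" using z(4) by (metis prod.collapse)
            have "(x, k) \<in> q" "(x', k) \<in> q" "(x, k) \<noteq> (x', k)" using z zz by auto
            then have "Inf k = Sup k" by (rule same) simp_all
            moreover have "(x, k) \<in> p" using z qp zz by auto
            ultimately show "measure lborel (snd z) = 0" using iv[of x k] zz by force
          qed
          then show ?thesis by (simp add: split_beta' comp_def)
        qed
        also have "\<dots> = sum (measure lebesgue) (snd ` q)"
        proof (intro sum.cong refl)
          fix k assume "k \<in> snd ` q"
          then obtain x where "(x, k) \<in> p" using qp by auto
          then obtain u v where "k = {u..v}" using iv by blast
          then show "measure lborel k = measure lebesgue k" by simp
        qed
        also have "\<dots> = measure lebesgue (\<Union>(snd ` q))"
          by (rule content_division[OF div])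
        also have "\<dots> \<le> measure lebesgue U"
        proof (rule measure_mono_fmeasurable)
          show "\<Union>(snd ` q) \<subseteq> U"
            using fineD[OF fine] qp by (fastforce simp: q_def \<gamma>_def)
          show "\<Union>(snd ` q) \<in> sets lebesgue" using div lmeasurable_division by blast
        qed (rule Ul)
        finally have small: "(\<Sum>(u, v)\<in>?j ` q. v - u) < \<delta>"
          using Usmall by (subst reidx) auto
        have "(\<Sum>(u, v)\<in>?j ` q. norm (f v - f u)) < e / 2"
        proof (rule acD)
          show "finite (?j ` q)" using qp by simp
          show "\<forall>(u, v)\<in>?j ` q. a \<le> u \<and> u \<le> v \<and> v \<le> b" using iv qp(1) by fastforce
          show "disjoint_family_on (\<lambda>(u, v). {u<..<v}) (?j ` q)"
            unfolding disjoint_family_on_def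
          proof (intro ballI impI)
            fix m n assume mn: "m \<in> ?j ` q" "n \<in> ?j ` q" "m \<noteq> n"
            then obtain x k x' k' where z: "(x, k) \<in> q" "(x', k') \<in> q" "m = (Inf k, Sup k)" "n = (Inf k', Sup k')"
              by auto
            then have zp: "(x, k) \<in> p" "(x', k') \<in> p" using qp by auto
            have "k = {fst m..snd m}" "k' = {fst n..snd n}" using iv[OF zp(1)] iv[OF zp(2)] z by auto
            moreover have "interior k \<inter> interior k' = {}" using pD(5)[OF zp] mn z by auto
            ultimately show "(case m of (u, v) \<Rightarrow> {u<..<v}) \<inter> (case n of (u, v) \<Rightarrow> {u<..<v}) = {}"
              by (simp add: split_beta')
          qed
        qed (rule small)
        then have "(\<Sum>(x, k)\<in>q. norm (f (Sup k) - f (Inf k))) < e / 2"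
          by (subst (asm) reidx) auto
        moreover have "sum ?G q = (\<Sum>(x, k)\<in>q. norm (f (Sup k) - f (Inf k)))"
          by (intro sum.cong refl) (auto simp: q_def g_def norm_minus_commute)
        ultimately show ?thesis by simp
      qed
      finally show ?thesis using e' by linarith
    qed
    show "\<exists>\<gamma>. gauge \<gamma> \<and> (\<forall>p. p tagged_division_of {a..b} \<and> \<gamma> fine p \<longrightarrow>
        norm ((\<Sum>(x, k)\<in>p. measure lborel k *\<^sub>R g x) - (f b - f a)) < e)"
    proof (intro exI conjI allI impI, rule gauge, elim conjE)
      fix p assume "p tagged_division_of {a..b}" "\<gamma> fine p"
      then show "norm ((\<Sum>(x, k)\<in>p. measure lborel k *\<^sub>R g x) - (f b - f a)) < e"
        by (rule small)
    qed
  qed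
  then show ?thesis
    by (rule has_integral_spike[OF N', rotated]) (simp add: g_def)
qed

lemma abs_cont_on_interval_continuous_on:
  assumes "abs_cont_on_interval f a b"
  shows "continuous_on {a..b} f"
  unfolding continuous_on_iff
proof (intro ballI allI impI)
  fix t e :: real assume t: "t \<in> {a..b}" and e: "0 < e"
  obtain \<delta> where \<delta>: "0 < \<delta>" and D: "\<And>I. finite I \<and> (\<forall>(u, v)\<in>I. a \<le> u \<and> u \<le> v \<and> v \<le> b) \<and>
     disjoint_family_on (\<lambda>(u, v). {u<..<v}) I \<and> (\<Sum>(u, v)\<in>I. v - u) < \<delta>
     \<longrightarrow> (\<Sum>(u, v)\<in>I. norm (f v - f u)) < e"
    using assms e unfolding abs_cont_on_interval_def by blast
  have "dist (f s) (f t) < e" if s: "s \<in> {a..b}" "dist s t < \<delta>" for s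
    using D[of "{(min s t, max s t)}"] s t
    by (cases "s \<le> t") (auto simp: disjoint_family_on_def dist_real_def dist_norm norm_minus_commute)
  then show "\<exists>d>0. \<forall>s\<in>{a..b}. dist s t < d \<longrightarrow> dist (f s) (f t) < e" using \<delta> by blast
qed

lemma abs_cont_on_interval_subset:
  assumes "abs_cont_on_interval f a b" "a \<le> a'" "b' \<le> b"
  shows "abs_cont_on_interval f a' b'"
  unfolding abs_cont_on_interval_def
proof (intro allI impI)
  fix e :: real assume "0 < e"
  then obtain \<delta> where \<delta>: "0 < \<delta>" and D: "\<And>I. finite I \<and> (\<forall>(u, v)\<in>I. a \<le> u \<and> u \<le> v \<and> v \<le> b) \<and>
     disjoint_family_on (\<lambda>(u, v). {u<..<v}) I \<and> (\<Sum>(u, v)\<in>I. v - u) < \<delta>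
     \<longrightarrow> (\<Sum>(u, v)\<in>I. norm (f v - f u)) < e"
    using assms(1) unfolding abs_cont_on_interval_def by blast
  show "\<exists>\<delta>>0. \<forall>I. finite I \<and> (\<forall>(u, v)\<in>I. a' \<le> u \<and> u \<le> v \<and> v \<le> b') \<and>
     disjoint_family_on (\<lambda>(u, v). {u<..<v}) I \<and> (\<Sum>(u, v)\<in>I. v - u) < \<delta>
     \<longrightarrow> (\<Sum>(u, v)\<in>I. norm (f v - f u)) < e"
  proof (intro exI[of _ \<delta>] conjI \<delta> allI impI, elim conjE)
    fix I assume I: "finite I" "\<forall>(u, v)\<in>I. a' \<le> u \<and> u \<le> v \<and> v \<le> b'"
      "disjoint_family_on (\<lambda>(u, v). {u<..<v}) I" "(\<Sum>(u, v)\<in>I. v - u) < \<delta>"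
    have "\<forall>(u, v)\<in>I. a \<le> u \<and> u \<le> v \<and> v \<le> b" using I(2) assms(2,3) by fastforce
    then show "(\<Sum>(u, v)\<in>I. norm (f v - f u)) < e" using D[of I] I by blast
  qed
qed

section \<open>Measurability of parametrized curves, integrals in time and second moments\<close>

text \<open>Rounding time down to a grid of mesh \<open>1 / n\<close> leaves countably many
  measurable pieces; continuity in time gives convergence as the grid is refined.\<close>

lemma borel_measurable_Caratheodory:
  fixes Z :: "real \<Rightarrow> 'w \<Rightarrow> 'a::euclidean_space"
  assumes [measurable]: "\<And>t. Z t \<in> borel_measurable M"
    and cont: "\<And>w. w \<in> space M \<Longrightarrow> continuous_on UNIV (\<lambda>t. Z t w)"
  shows "(\<lambda>p. Z (fst p) (snd p)) \<in> borel_measurable (borel \<Otimes>\<^sub>M M)"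
proof (rule borel_measurable_LIMSEQ_metric)
  fix i :: nat
  let ?n = "real (Suc i)"
  show "(\<lambda>p. Z (of_int \<lfloor>?n * fst p\<rfloor> / ?n) (snd p)) \<in> borel_measurable (borel \<Otimes>\<^sub>M M)"
    by (rule measurable_compose_countable[where f="\<lambda>j p. Z (of_int j / ?n) (snd p)"]) measurable
next
  fix p :: "real \<times> 'w" assume "p \<in> space (borel \<Otimes>\<^sub>M M)"
  then have w: "snd p \<in> space M" by (auto simp: space_pair_measure)
  have "(\<lambda>i. of_int \<lfloor>real (Suc i) * fst p\<rfloor> / real (Suc i)) \<longlonglongrightarrow> fst p"
  proof (rule tendsto_sandwich)
    show "\<forall>\<^sub>F i in sequentially. fst p - 1 / real (Suc i) \<le> of_int \<lfloor>real (Suc i) * fst p\<rfloor> / real (Suc i)"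
    proof (rule always_eventually, rule allI)
      fix i
      have "real (Suc i) * fst p - 1 \<le> of_int \<lfloor>real (Suc i) * fst p\<rfloor>" by linarith
      then have "(real (Suc i) * fst p - 1) / real (Suc i) \<le> of_int \<lfloor>real (Suc i) * fst p\<rfloor> / real (Suc i)"
        by (rule divide_right_mono) simp
      then show "fst p - 1 / real (Suc i) \<le> of_int \<lfloor>real (Suc i) * fst p\<rfloor> / real (Suc i)"
        by (simp add: diff_divide_distrib)
    qed
    show "\<forall>\<^sub>F i in sequentially. of_int \<lfloor>real (Suc i) * fst p\<rfloor> / real (Suc i) \<le> fst p"
    proof (rule always_eventually, rule allI)
      fix i
      have "of_int \<lfloor>real (Suc i) * fst p\<rfloor> \<le> real (Suc i) * fst p" by (rule of_int_floor_le)
      then show "of_int \<lfloor>real (Suc i) * fst p\<rfloor> / real (Suc i) \<le> fst p"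
        by (simp add: divide_le_eq mult.commute)
    qed
    show "(\<lambda>i. fst p - 1 / real (Suc i)) \<longlonglongrightarrow> fst p"
      using tendsto_diff[OF tendsto_const[of "fst p"] LIMSEQ_inverse_real_of_nat] by (simp add: inverse_eq_divide)
  qed simp
  moreover have "isCont (\<lambda>t. Z t (snd p)) (fst p)"
    using cont[OF w] by (simp add: continuous_on_eq_continuous_at)
  ultimately show "(\<lambda>i. Z (of_int \<lfloor>real (Suc i) * fst p\<rfloor> / real (Suc i)) (snd p)) \<longlonglongrightarrow> Z (fst p) (snd p)"
    by (rule isCont_tendsto_compose[rotated])
qed

text \<open>A countable description of differentiability of a continuous curve, which is measurable in
  parameters.\<close>

lemma has_vector_derivative_iff_rat:
  fixes f :: "real \<Rightarrow> 'a::real_normed_vector"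
  assumes cont: "continuous_on UNIV f"
  shows "(f has_vector_derivative v) (at t) \<longleftrightarrow>
    (\<forall>n::nat. \<exists>m::nat. \<forall>q::rat. \<bar>real_of_rat q\<bar> < 1 / real (Suc m) \<longrightarrow>
      norm (f (t + real_of_rat q) - f t - real_of_rat q *\<^sub>R v) \<le> 1 / real (Suc n) * \<bar>real_of_rat q\<bar>)"
    (is "_ \<longleftrightarrow> ?R")
proof
  assume "(f has_vector_derivative v) (at t)"
  then have D: "\<forall>e>0. \<exists>d>0. \<forall>y. \<bar>y - t\<bar> < d \<longrightarrow> norm (f y - f t - (y - t) *\<^sub>R v) \<le> e * \<bar>y - t\<bar>"
    unfolding has_vector_derivative_def has_derivative_at_alt real_norm_def by blast
  show ?R
  proof
    fix n
    obtain d where d: "0 < d" "\<And>y. \<bar>y - t\<bar> < d \<Longrightarrow> norm (f y - f t - (y - t) *\<^sub>R v) \<le> 1 / real (Suc n) * \<bar>y - t\<bar>"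
      using D[rule_format, of "1 / real (Suc n)"] by auto
    obtain m where m: "1 / real (Suc m) < d" using nat_approx_posE[OF d(1)] .
    show "\<exists>m. \<forall>q. \<bar>real_of_rat q\<bar> < 1 / real (Suc m) \<longrightarrow>
      norm (f (t + real_of_rat q) - f t - real_of_rat q *\<^sub>R v) \<le> 1 / real (Suc n) * \<bar>real_of_rat q\<bar>"
      by (rule exI[of _ m]) (use d(2)[of "t + real_of_rat _"] m in fastforce)
  qed
next
  assume R: ?R
  have "\<exists>d>0. \<forall>y. \<bar>y - t\<bar> < d \<longrightarrow> norm (f y - f t - (y - t) *\<^sub>R v) \<le> e * \<bar>y - t\<bar>" if "e > 0" for e
  proof -
    obtain n where n: "1 / real (Suc n) < e" using nat_approx_posE[OF \<open>e > 0\<close>] .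
    obtain m where m: "\<And>q. \<bar>real_of_rat q\<bar> < 1 / real (Suc m) \<Longrightarrow>
      norm (f (t + real_of_rat q) - f t - real_of_rat q *\<^sub>R v) \<le> 1 / real (Suc n) * \<bar>real_of_rat q\<bar>"
      using R by meson
    \<comment> \<open>The increments that satisfy the estimate form a closed set, so density of the
      rationals extends it to all small real increments.\<close>
    define S where "S = {r. norm (f (t + r) - f t - r *\<^sub>R v) \<le> 1 / real (Suc n) * \<bar>r\<bar>}"
    have "continuous_on UNIV (\<lambda>r. f (t + r))"
      by (rule continuous_on_compose2[OF cont]) (auto intro!: continuous_intros)
    then have "closed S"
      unfolding S_def by (intro closed_Collect_le continuous_intros)
    have S: "r \<in> S" if r: "\<bar>r\<bar> < 1 / real (Suc m)" for r
    proof (rule ccontr)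
      assume "r \<notin> S"
      then have "open (- S \<inter> {-(1 / real (Suc m))<..<1 / real (Suc m)})" "r \<in> - S \<inter> {-(1 / real (Suc m))<..<1 / real (Suc m)}"
        using \<open>closed S\<close> r by auto
      then obtain \<epsilon> where \<epsilon>: "0 < \<epsilon>" "ball r \<epsilon> \<subseteq> - S \<inter> {-(1 / real (Suc m))<..<1 / real (Suc m)}"
        by (meson open_contains_ball)
      obtain q where q: "r < real_of_rat q" "real_of_rat q < r + \<epsilon>"
        using of_rat_dense[of r "r + \<epsilon>"] \<epsilon>(1) by auto
      then have "real_of_rat q \<in> ball r \<epsilon>" by (auto simp: dist_real_def)
      then have "real_of_rat q \<in> - S \<inter> {-(1 / real (Suc m))<..<1 / real (Suc m)}" using \<epsilon>(2) by blast
      then have "real_of_rat q \<notin> S" "- (1 / real (Suc m)) < real_of_rat q" "real_of_rat q < 1 / real (Suc m)"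
        by (simp_all del: of_nat_Suc)
      then have "real_of_rat q \<notin> S" "\<bar>real_of_rat q\<bar> < 1 / real (Suc m)" by linarith+
      then show False using m[of q] by (simp add: S_def)
    qed
    have "norm (f y - f t - (y - t) *\<^sub>R v) \<le> e * \<bar>y - t\<bar>" if "\<bar>y - t\<bar> < 1 / real (Suc m)" for y
    proof -
      have "norm (f y - f t - (y - t) *\<^sub>R v) \<le> 1 / real (Suc n) * \<bar>y - t\<bar>"
        using S[OF that] by (simp add: S_def)
      also have "\<dots> \<le> e * \<bar>y - t\<bar>" using n by (intro mult_right_mono) auto
      finally show ?thesis .
    qed
    then show ?thesis by (intro exI[of _ "1 / real (Suc m)"]) auto
  qed
  then show "(f has_vector_derivative v) (at t)"
    unfolding has_vector_derivative_def has_derivative_at_alt real_norm_def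
    by (intro conjI bounded_linear_scaleR_left allI impI)
qed

text \<open>Cauchy-Schwarz in time. The \<open>ennreal\<close> form allows the right side to be
  infinite; the case \<open>u = v\<close> is separated because the product of 0 and infinity is
  0.\<close>

lemma has_integral_norm_sq_le:
  fixes f :: "real \<Rightarrow> 'a::euclidean_space"
  assumes f[measurable]: "f \<in> borel_measurable borel" and I: "(f has_integral I) {u..v}" and uv: "u \<le> v"
  shows "ennreal ((norm I)\<^sup>2) \<le> ennreal (v - u) * (\<integral>\<^sup>+s. indicator {u..v} s * ennreal ((norm (f s))\<^sup>2) \<partial>lborel)"
proof (cases "u = v \<or> (\<integral>\<^sup>+s. indicator {u..v} s * ennreal ((norm (f s))\<^sup>2) \<partial>lborel) = \<infinity>")
  case True
  moreover have "I = 0" if "u = v"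
    using has_integral_unique[OF I, of 0] has_integral_refl(2)[of f u] that by simp
  ultimately show ?thesis using uv by (auto simp: ennreal_mult_top ennreal_mult_eq_top_iff)
next
  case False
  let ?M = "restrict_space lborel {u..v}"
  interpret finite_measure ?M
    by standard (use uv in \<open>simp add: emeasure_restrict_space space_restrict_space\<close>)
  have fm: "f \<in> borel_measurable ?M" by (intro measurable_restrict_space1) simp
  have nn: "(\<integral>\<^sup>+s. ennreal ((norm (f s))\<^sup>2) \<partial>?M) = (\<integral>\<^sup>+s. indicator {u..v} s * ennreal ((norm (f s))\<^sup>2) \<partial>lborel)"
    by (subst nn_integral_restrict_space) (auto simp: mult.commute)
  have sq: "sqint ?M f"
    unfolding sqint_def using False by (intro conjI fm integrableI_bounded) (use fm nn in \<open>auto simp: less_top\<close>)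
  note ns = norm_integral_sq_le[OF finite_measure_axioms sq]
  have "set_integrable lborel {u..v} f"
    using ns(1) by (simp add: integrable_restrict_space set_integrable_def)
  from set_borel_integral_eq_integral(2)[OF this] have "(\<integral>s. f s \<partial>?M) = I"
    using I by (simp add: integral_restrict_space set_lebesgue_integral_def integral_unique)
  moreover have "measure ?M (space ?M) = v - u"
    using uv by (simp add: measure_restrict_space space_restrict_space)
  ultimately have "(norm I)\<^sup>2 \<le> (v - u) * (L2norm ?M f)\<^sup>2" using ns(2) by (simp add: L2norm_sq)
  then have "ennreal ((norm I)\<^sup>2) \<le> ennreal (v - u) * ennreal ((L2norm ?M f)\<^sup>2)"
    using uv by (simp add: ennreal_leI flip: ennreal_mult)
  also have "ennreal ((L2norm ?M f)\<^sup>2) = (\<integral>\<^sup>+s. indicator {u..v} s * ennreal ((norm (f s))\<^sup>2) \<partial>lborel)"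
    using nn_integral_sqint[OF sq] nn by simp
  finally show ?thesis .
qed

text \<open>Some coupling has cost below 1, and \<open>|x|^2 \<le> 2 * |y|^2 + 2 * |x - y|^2\<close>
  integrates along it.\<close>

lemma second_moment_near:
  fixes \<mu> \<nu> :: "'a::euclidean_space measure"
  assumes "W2sq \<mu> \<nu> < 1"
  shows "(\<integral>\<^sup>+x. ennreal ((norm x)\<^sup>2) \<partial>\<mu>) \<le> 2 * (\<integral>\<^sup>+x. ennreal ((norm x)\<^sup>2) \<partial>\<nu>) + 2"
proof -
  obtain \<pi> where \<pi>: "\<pi> \<in> couplings \<mu> \<nu>" and c: "(\<integral>\<^sup>+ z. ennreal ((dist (fst z) (snd z))\<^sup>2) \<partial>\<pi>) < 1"
    using assms unfolding W2sq_def INF_less_iff by blast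
  then have s: "sets \<pi> = sets (borel \<Otimes>\<^sub>M borel)"
    and \<mu>: "\<mu> = distr \<pi> borel fst" and \<nu>: "\<nu> = distr \<pi> borel snd" by (auto simp: couplings_def)
  have [measurable]: "fst \<in> borel_measurable \<pi>" "snd \<in> borel_measurable \<pi>"
    using s by (auto cong: measurable_cong_sets)
  have "(\<integral>\<^sup>+x. ennreal ((norm x)\<^sup>2) \<partial>\<mu>) = (\<integral>\<^sup>+z. ennreal ((norm (fst z))\<^sup>2) \<partial>\<pi>)"
    unfolding \<mu> by (subst nn_integral_distr) auto
  also have "\<dots> \<le> (\<integral>\<^sup>+z. 2 * ennreal ((norm (snd z))\<^sup>2) + 2 * ennreal ((dist (fst z) (snd z))\<^sup>2) \<partial>\<pi>)"
  proof (rule nn_integral_mono)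
    fix z :: "'a \<times> 'a"
    have "ennreal ((norm (fst z))\<^sup>2) \<le> ennreal (2 * (norm (snd z))\<^sup>2 + 2 * (dist (fst z) (snd z))\<^sup>2)"
      using norm_add_sq_le[of "snd z" "fst z - snd z"] by (intro ennreal_leI) (simp add: dist_norm)
    also have "\<dots> = 2 * ennreal ((norm (snd z))\<^sup>2) + 2 * ennreal ((dist (fst z) (snd z))\<^sup>2)"
      by (simp add: ennreal_mult)
    finally show "ennreal ((norm (fst z))\<^sup>2) \<le> 2 * ennreal ((norm (snd z))\<^sup>2) + 2 * ennreal ((dist (fst z) (snd z))\<^sup>2)" .
  qed
  also have "\<dots> = 2 * (\<integral>\<^sup>+z. ennreal ((norm (snd z))\<^sup>2) \<partial>\<pi>) + 2 * (\<integral>\<^sup>+ z. ennreal ((dist (fst z) (snd z))\<^sup>2) \<partial>\<pi>)"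
    by (subst nn_integral_add) (auto simp: nn_integral_cmult)
  also have "\<dots> \<le> 2 * (\<integral>\<^sup>+z. ennreal ((norm (snd z))\<^sup>2) \<partial>\<pi>) + 2 * 1"
    using c by (intro add_left_mono mult_left_mono) auto
  also have "(\<integral>\<^sup>+z. ennreal ((norm (snd z))\<^sup>2) \<partial>\<pi>) = (\<integral>\<^sup>+x. ennreal ((norm x)\<^sup>2) \<partial>\<nu>)"
    unfolding \<nu> by (subst nn_integral_distr) auto
  finally show ?thesis by simp
qed

section \<open>The averaged flow\<close>

locale sliced_flow = sliced_target P \<rho>1
  for P :: "'w measure" and \<rho>1 :: "'a::euclidean_space measure" +
  fixes x0 :: "'w \<Rightarrow> 'a" and lam :: "real \<Rightarrow> real" and tbar \<Lambda> \<Lambda>' L :: real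
    and \<rho> :: "real \<Rightarrow> 'a measure" and \<Phi> :: "real \<Rightarrow> 'a \<Rightarrow> 'a"
  assumes x0_measurable[measurable]: "x0 \<in> borel_measurable P"
    and flow: "averaged_flow tbar lam (law x0) \<rho>1 \<rho> \<Phi>"
    and tbar: "0 < tbar"
    and lam: "\<And>t. t \<in> {0..tbar} \<Longrightarrow> 0 \<le> lam t \<and> lam t \<le> \<Lambda>"
    and lam_Lipschitz: "\<And>s t. s \<in> {0..tbar} \<Longrightarrow> t \<in> {0..tbar} \<Longrightarrow> \<bar>lam s - lam t\<bar> \<le> \<Lambda>' * \<bar>s - t\<bar>"
    and L: "0 \<le> L" and \<Lambda>': "0 \<le> \<Lambda>'"
    and stab: "\<And>s t. s \<in> {0..tbar} \<Longrightarrow> t \<in> {0..tbar} \<Longrightarrow>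
        L2norm P (\<lambda>w. avg_dir \<rho>1 (\<rho> s) (\<Phi> s (x0 w)) - avg_dir \<rho>1 (\<rho> t) (\<Phi> t (x0 w)))
        \<le> L * L2norm P (\<lambda>w. \<Phi> s (x0 w) - \<Phi> t (x0 w))"
begin

definition Y :: "real \<Rightarrow> 'w \<Rightarrow> 'a" where "Y t w = \<Phi> t (x0 w)"

definition A :: "real \<Rightarrow> 'w \<Rightarrow> 'a" where "A t w = avg_dir \<rho>1 (\<rho> t) (Y t w)"

lemma \<Phi>_measurable: "t \<in> {0..tbar} \<Longrightarrow> \<Phi> t \<in> borel_measurable borel"
  using flow by (simp add: averaged_flow_def)

lemma Y_measurable: "t \<in> {0..tbar} \<Longrightarrow> Y t \<in> borel_measurable P"
  using measurable_compose[OF x0_measurable \<Phi>_measurable, of t] by (simp add: Y_def[abs_def])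

lemma law_Y: "t \<in> {0..tbar} \<Longrightarrow> law (Y t) = \<rho> t"
proof -
  assume t: "t \<in> {0..tbar}"
  then have "\<rho> t = distr (law x0) borel (\<Phi> t)" using flow unfolding averaged_flow_def by blast
  also have "\<dots> = law (\<Phi> t \<circ> x0)" by (rule distr_distr[OF \<Phi>_measurable[OF t] x0_measurable])
  finally show ?thesis by (simp add: Y_def[abs_def] comp_def)
qed

lemma ac_rv_Y: "t \<in> {0..tbar} \<Longrightarrow> ac_rv (Y t)"
  using flow Y_measurable[of t] law_Y[of t] unfolding ac_rv_def averaged_flow_def by metis

lemma A_eq: "t \<in> {0..tbar} \<Longrightarrow> A t = (\<lambda>w. avg_dir \<rho>1 (law (Y t)) (Y t w))"
  by (simp add: A_def law_Y fun_eq_iff)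

lemma sqint_Y: "t \<in> {0..tbar} \<Longrightarrow> sqint P (Y t)"
  by (rule ac_rv_sqint[OF ac_rv_Y])

lemma sqint_A: "t \<in> {0..tbar} \<Longrightarrow> sqint P (A t)"
  by (simp add: A_eq sqint_avg_dir ac_rv_Y)

text \<open>Continuity in \<open>W2sq\<close> bounds the second moment near each time by twice its
  value there plus 2; compactness of the time interval reduces this to finitely many times.\<close>

lemma Y_bounded: obtains M where "0 \<le> M" "\<And>t. t \<in> {0..tbar} \<Longrightarrow> L2norm P (Y t) \<le> M"
proof -
  define m where "m t = (L2norm P (Y t))\<^sup>2" for t
  have m0: "0 \<le> m t" for t by (simp add: m_def)
  have mm: "(\<integral>\<^sup>+x. ennreal ((norm x)\<^sup>2) \<partial>\<rho> t) = ennreal (m t)" if "t \<in> {0..tbar}" for t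
    unfolding m_def nn_integral_sqint[OF sqint_Y[OF that], symmetric] law_Y[OF that, symmetric]
    using Y_measurable[OF that] by (subst nn_integral_distr) auto
  have "\<exists>d>0. \<forall>s\<in>{0..tbar}. dist s t < d \<longrightarrow> m s \<le> 2 * m t + 2" if t: "t \<in> {0..tbar}" for t
  proof -
    have "((\<lambda>s. W2sq (\<rho> s) (\<rho> t)) \<longlongrightarrow> 0) (at t within {0..tbar})"
      using flow t unfolding averaged_flow_def by blast
    then have "\<forall>\<^sub>F s in at t within {0..tbar}. W2sq (\<rho> s) (\<rho> t) < 1"
      by (rule order_tendstoD) simp
    then obtain d where d: "d > 0" "\<And>s. s \<in> {0..tbar} \<Longrightarrow> s \<noteq> t \<Longrightarrow> dist s t < d \<Longrightarrow> W2sq (\<rho> s) (\<rho> t) < 1"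
      by (auto simp: eventually_at)
    have "m s \<le> 2 * m t + 2" if s: "s \<in> {0..tbar}" "dist s t < d" for s
    proof (cases "s = t")
      case True
      then show ?thesis by (simp add: m_def)
    next
      case False
      have "ennreal (m s) \<le> 2 * ennreal (m t) + 2"
        using second_moment_near[OF d(2)[OF s(1) False s(2)]] by (simp only: mm[OF s(1)] mm[OF t])
      also have "\<dots> = ennreal (2 * m t + 2)" using m0[of t] by (simp add: ennreal_mult)
      finally show ?thesis using m0[of t] by (subst (asm) ennreal_le_iff) auto
    qed
    with d show ?thesis by blast
  qed
  then obtain d where d: "\<And>t. t \<in> {0..tbar} \<Longrightarrow> 0 < d t"
    "\<And>s t. t \<in> {0..tbar} \<Longrightarrow> s \<in> {0..tbar} \<Longrightarrow> dist s t < d t \<Longrightarrow> m s \<le> 2 * m t + 2"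
    by metis
  obtain T where T: "T \<subseteq> {0..tbar}" "finite T" "{0..tbar} \<subseteq> (\<Union>t\<in>T. ball t (d t))"
  proof (rule compactE_image[of "{0..tbar}" "{0..tbar}" "\<lambda>t. ball t (d t)"])
    show "{0..tbar} \<subseteq> (\<Union>t\<in>{0..tbar}. ball t (d t))" using d(1) by force
  qed auto
  \<comment> \<open>All summands are nonnegative, so the sum dominates each local bound.\<close>
  define M where "M = (\<Sum>t\<in>T. 2 * m t + 2)"
  have nn: "0 \<le> 2 * m t + 2" for t by (simp add: m_def)
  have M0: "0 \<le> M" unfolding M_def by (intro sum_nonneg nn)
  have "L2norm P (Y s) \<le> sqrt M" if s: "s \<in> {0..tbar}" for s
  proof -
    obtain t where t: "t \<in> T" "dist s t < d t" using T(3) s by (auto simp: dist_commute)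
    then have "m s \<le> 2 * m t + 2" using d(2)[of t s] T(1) s by auto
    also have "\<dots> \<le> M" unfolding M_def using t T(2) nn by (intro member_le_sum) auto
    finally show ?thesis unfolding m_def by (rule real_le_rsqrt)
  qed
  then show thesis using that[of "sqrt M"] M0 by simp
qed

text \<open>The flow is given on \<open>{0..tbar}\<close> only. Clamping the time extends it to the
  whole line, where the measurability lemmas live; \<open>Z\<close> and \<open>G\<close> below are
  the extended position and the extended negative velocity.\<close>

definition clamp_t :: "real \<Rightarrow> real" where "clamp_t t = max 0 (min tbar t)"

lemma clamp_t: "clamp_t t \<in> {0..tbar}" "t \<in> {0..tbar} \<Longrightarrow> clamp_t t = t"
  using tbar by (auto simp: clamp_t_def)

lemma continuous_clamp_t: "continuous_on S clamp_t"
  unfolding clamp_t_def by (intro continuous_intros)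

definition Z :: "real \<Rightarrow> 'w \<Rightarrow> 'a" where "Z t = Y (clamp_t t)"

definition G :: "real \<Rightarrow> 'w \<Rightarrow> 'a" where "G t w = lam (clamp_t t) *\<^sub>R A (clamp_t t) w"

lemma abs_cont_\<Phi>: "abs_cont_on_interval (\<lambda>t. \<Phi> t x) 0 tbar"
  using flow by (simp add: averaged_flow_def)

lemma continuous_Z: "continuous_on UNIV (\<lambda>t. Z t w)"
  unfolding Z_def Y_def
  using abs_cont_on_interval_continuous_on[OF abs_cont_\<Phi>] continuous_clamp_t
  by (rule continuous_on_compose2) (use clamp_t in auto)

lemma Z_measurable: "(\<lambda>p. Z (fst p) (snd p)) \<in> borel_measurable (borel \<Otimes>\<^sub>M P)"
  by (rule borel_measurable_Caratheodory[OF _ continuous_Z]) (simp only: Z_def Y_measurable clamp_t(1))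

lemma G_measurable[measurable]: "(\<lambda>p. G (fst p) (snd p)) \<in> borel_measurable (borel \<Otimes>\<^sub>M P)"
proof -
  have "continuous_on {0..tbar} lam"
  proof (rule continuous_onI)
    fix t e :: real assume t: "t \<in> {0..tbar}" and e: "0 < e"
    have "dist (lam s) (lam t) \<le> e" if "s \<in> {0..tbar}" "dist s t < e / (\<Lambda>' + 1)" for s
    proof -
      have "\<bar>lam s - lam t\<bar> \<le> \<Lambda>' * \<bar>s - t\<bar>" by (rule lam_Lipschitz[OF that(1) t])
      also have "\<dots> \<le> (\<Lambda>' + 1) * (e / (\<Lambda>' + 1))"
        using that(2) \<Lambda>' e by (intro mult_mono) (auto simp: dist_real_def)
      also have "\<dots> = e" using \<Lambda>' by simp
      finally show ?thesis by (simp add: dist_real_def)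
    qed
    then show "\<exists>d>0. \<forall>s\<in>{0..tbar}. dist s t < d \<longrightarrow> dist (lam s) (lam t) \<le> e"
      using e \<Lambda>' by (intro exI[of _ "e / (\<Lambda>' + 1)"]) (auto intro!: divide_pos_pos)
  qed
  then have "continuous_on UNIV (\<lambda>t. lam (clamp_t t))"
    using continuous_clamp_t by (rule continuous_on_compose2) (use clamp_t in auto)
  then have [measurable]: "(\<lambda>t. lam (clamp_t t)) \<in> borel_measurable borel"
    by (rule borel_measurable_continuous_onI)
  have "(\<lambda>p. avg_dir \<rho>1 (law (Z (fst p))) (Z (fst p) (snd p))) \<in> borel_measurable (borel \<Otimes>\<^sub>M P)"
    by (rule borel_measurable_avg_dir[OF prob_space_axioms _ target_prob target_sets, where N=borel])
      (use Z_measurable in \<open>auto simp: split_beta'\<close>)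
  then have "(\<lambda>p. A (clamp_t (fst p)) (snd p)) \<in> borel_measurable (borel \<Otimes>\<^sub>M P)"
    by (simp add: A_eq[OF clamp_t(1)] Z_def)
  then show ?thesis unfolding G_def by measurable
qed

text \<open>The flow equation holds for almost every time and then almost every point; integrating
  along one curve needs the reverse order. Exchanging the two requires a measurable set of good
  pairs, which the rational description of the derivative supplies.\<close>

lemma AE_deriv:
  "AE w in P. AE t in lborel. t \<in> {0<..<tbar} \<longrightarrow> ((\<lambda>s. Z s w) has_vector_derivative - G t w) (at t)"
proof -
  interpret LP: pair_sigma_finite "lborel :: real measure" P ..
  let ?D = "\<lambda>t w. t \<in> {0<..<tbar} \<longrightarrow> (\<forall>n::nat. \<exists>m::nat. \<forall>q::rat. \<bar>real_of_rat q\<bar> < 1 / real (Suc m) \<longrightarrow>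
      norm (Z (t + real_of_rat q) w - Z t w - real_of_rat q *\<^sub>R (- G t w)) \<le> 1 / real (Suc n) * \<bar>real_of_rat q\<bar>)"
  have D: "?D t w \<longleftrightarrow> (t \<in> {0<..<tbar} \<longrightarrow> ((\<lambda>s. Z s w) has_vector_derivative - G t w) (at t))" for t w
    using has_vector_derivative_iff_rat[OF continuous_Z, of w "- G t w" t] by simp
  have Zq[measurable]: "(\<lambda>p. Z (fst p + c) (snd p)) \<in> borel_measurable (lborel \<Otimes>\<^sub>M P)" for c
    using measurable_compose[OF _ Z_measurable, of "\<lambda>p. (fst p + c, snd p)" "lborel \<Otimes>\<^sub>M P"] by simp
  have [measurable]: "(\<lambda>p. Z (fst p) (snd p)) \<in> borel_measurable (lborel \<Otimes>\<^sub>M P)" using Zq[of 0] by simp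
  have [measurable]: "(\<lambda>p. G (fst p) (snd p)) \<in> borel_measurable (lborel \<Otimes>\<^sub>M P)"
    using G_measurable by (simp cong: measurable_cong_sets)
  have sets: "{p \<in> space (lborel \<Otimes>\<^sub>M P). ?D (fst p) (snd p)} \<in> sets (lborel \<Otimes>\<^sub>M P)" by measurable
  have "AE t in lborel. t \<in> {0<..<tbar} \<longrightarrow>
        (AE x in law x0. ((\<lambda>s. \<Phi> s x) has_vector_derivative - (lam t *\<^sub>R avg_dir \<rho>1 (\<rho> t) (\<Phi> t x))) (at t))"
    using flow unfolding averaged_flow_def by blast
  then have "AE t in lborel. AE w in P. ?D t w"
  proof eventually_elim
    case (elim t)
    show ?case
    proof (cases "t \<in> {0<..<tbar}")
      case True
      have "AE w in P. ((\<lambda>s. \<Phi> s (x0 w)) has_vector_derivative - (lam t *\<^sub>R avg_dir \<rho>1 (\<rho> t) (\<Phi> t (x0 w)))) (at t)"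
        using elim True by (auto intro: AE_distrD[OF x0_measurable])
      then show ?thesis unfolding D
      proof eventually_elim
        case (elim w)
        have "((\<lambda>s. Z s w) has_vector_derivative - G t w) (at t)"
        proof (rule has_vector_derivative_transform_within_open[where S="{0<..<tbar}"])
          show "((\<lambda>s. \<Phi> s (x0 w)) has_vector_derivative - G t w) (at t)"
            using elim True by (simp add: G_def A_def Y_def clamp_t(2))
          show "\<Phi> s (x0 w) = Z s w" if "s \<in> {0<..<tbar}" for s
            using that by (simp add: Z_def Y_def clamp_t(2))
        qed (use True in auto)
        then show ?case by simp
      qed
    next
      case False
      show ?thesis by (rule AE_I2) (use False in blast)
    qed
  qed
  then have "AE w in P. AE t in lborel. ?D t w"
    by (rule iffD1[OF LP.AE_commute[where P="?D", OF sets]])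
  then show ?thesis unfolding D .
qed

lemma AE_flow_integral:
  assumes uv: "0 \<le> u" "u \<le> v" "v \<le> tbar"
  shows "AE w in P. ((\<lambda>s. - G s w) has_integral (Y v w - Y u w)) {u..v}"
  using AE_deriv
proof eventually_elim
  case (elim w)
  then obtain N where N: "{t. \<not> (t \<in> {0<..<tbar} \<longrightarrow> ((\<lambda>s. Z s w) has_vector_derivative - G t w) (at t))} \<subseteq> N"
    "N \<in> null_sets lborel"
    by (auto elim!: AE_E simp: null_sets_def)
  have "negligible N" using N(2) by (auto simp: negligible_iff_null_sets null_sets_completionI)
  have "abs_cont_on_interval (\<lambda>t. Y t w) u v"
    unfolding Y_def by (rule abs_cont_on_interval_subset[OF abs_cont_\<Phi>]) (use uv in auto)
  then show ?case
  proof (rule has_integral_abs_cont[OF uv(2) _ \<open>negligible N\<close>])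
    fix t assume t: "t \<in> {u<..<v} - N"
    then have "t \<in> {0<..<tbar}" "t \<notin> N" using uv by auto
    then have D: "((\<lambda>s. Z s w) has_vector_derivative - G t w) (at t)" using N(1) by blast
    show "((\<lambda>s. Y s w) has_vector_derivative - G t w) (at t)"
      by (rule has_vector_derivative_transform_within_open[OF D, where S="{u<..<v}"])
        (use t uv in \<open>auto simp: Z_def clamp_t\<close>)
  qed
qed

text \<open>Minkowski's inequality for the time integral, in the form Cauchy-Schwarz plus Tonelli.
  With \<open>G0 = 0\<close> it yields the Lipschitz bound of the flow, with \<open>G0\<close> the
  velocity at time \<open>u\<close> (up to sign) the truncation error.\<close>

lemma L2norm_flow_increment:
  assumes uv: "0 \<le> u" "u \<le> v" "v \<le> tbar" and G0: "sqint P G0" and c: "0 \<le> c"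
    and le: "\<And>s. s \<in> {u..v} \<Longrightarrow> L2norm P (\<lambda>w. G s w - G0 w) \<le> c"
  shows "L2norm P (\<lambda>w. Y v w - Y u w + (v - u) *\<^sub>R G0 w) \<le> (v - u) * c"
proof (rule sqint_if_nn_integral_le(2))
  interpret LP: pair_sigma_finite "lborel :: real measure" P ..
  have [measurable]: "G0 \<in> borel_measurable P" "Y u \<in> borel_measurable P" "Y v \<in> borel_measurable P"
    using G0 Y_measurable uv by (auto simp: sqint_def)
  show "(\<lambda>w. Y v w - Y u w + (v - u) *\<^sub>R G0 w) \<in> borel_measurable P" by measurable
  show "0 \<le> (v - u) * c" using uv c by simp
  let ?F = "\<lambda>s w. indicator {u..v} s * ennreal ((norm (G s w - G0 w))\<^sup>2)"
  have [measurable]: "(\<lambda>p. G (fst p) (snd p)) \<in> borel_measurable (lborel \<Otimes>\<^sub>M P)"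
    using G_measurable by (simp cong: measurable_cong_sets)
  have [measurable]: "(\<lambda>s. G s w) \<in> borel_measurable borel" if "w \<in> space P" for w
    using measurable_compose[OF _ G_measurable, of "\<lambda>s. (s, w)" borel] that by simp
  have Gs: "sqint P (G s)" for s
    using sqint_scaleR[OF sqint_A[OF clamp_t(1)]] by (simp add: G_def[abs_def])
  have "(\<integral>\<^sup>+w. ennreal ((norm (Y v w - Y u w + (v - u) *\<^sub>R G0 w))\<^sup>2) \<partial>P)
      \<le> (\<integral>\<^sup>+w. ennreal (v - u) * (\<integral>\<^sup>+s. ?F s w \<partial>lborel) \<partial>P)"
  proof (rule nn_integral_mono_AE, use AE_flow_integral[OF uv] AE_space in eventually_elim)
    case (elim w)
    have "((\<lambda>s. - G s w + G0 w) has_integral (Y v w - Y u w + (v - u) *\<^sub>R G0 w)) {u..v}"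
      by (rule has_integral_add[OF elim(1)]) (use has_integral_const_real[of "G0 w" u v] uv in simp)
    from has_integral_norm_sq_le[OF _ this uv(2)] elim(2) show ?case
      by (simp add: norm_minus_commute)
  qed
  also have "\<dots> = ennreal (v - u) * (\<integral>\<^sup>+w. \<integral>\<^sup>+s. ?F s w \<partial>lborel \<partial>P)"
  proof (rule nn_integral_cmult)
    have [measurable]: "(\<lambda>p. G (snd p) (fst p)) \<in> borel_measurable (P \<Otimes>\<^sub>M borel)"
      using measurable_compose[OF _ G_measurable, of "\<lambda>p. (snd p, fst p)" "P \<Otimes>\<^sub>M borel"] by simp
    have "(\<lambda>p. ?F (snd p) (fst p)) \<in> borel_measurable (P \<Otimes>\<^sub>M borel)" by measurable
    then have "(\<lambda>p. ?F (snd p) (fst p)) \<in> borel_measurable (P \<Otimes>\<^sub>M lborel)"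
      by (simp cong: measurable_cong_sets)
    then show "(\<lambda>w. \<integral>\<^sup>+s. ?F s w \<partial>lborel) \<in> borel_measurable P"
      by (intro lborel.borel_measurable_nn_integral) (simp add: split_beta')
  qed
  also have "(\<integral>\<^sup>+w. \<integral>\<^sup>+s. ?F s w \<partial>lborel \<partial>P) = (\<integral>\<^sup>+s. \<integral>\<^sup>+w. ?F s w \<partial>P \<partial>lborel)"
    by (rule LP.Fubini') measurable
  also have "\<dots> \<le> (\<integral>\<^sup>+s. ennreal (c\<^sup>2) * indicator {u..v} s \<partial>lborel)"
  proof (rule nn_integral_mono)
    fix s :: real
    have "(\<integral>\<^sup>+w. ennreal ((norm (G s w - G0 w))\<^sup>2) \<partial>P) \<le> ennreal (c\<^sup>2)" if "s \<in> {u..v}"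
      unfolding nn_integral_sqint[OF sqint_diff[OF Gs G0]]
      by (intro ennreal_leI power_mono le that L2norm_nonneg)
    then show "(\<integral>\<^sup>+w. ?F s w \<partial>P) \<le> ennreal (c\<^sup>2) * indicator {u..v} s"
      by (auto simp: indicator_def)
  qed
  also have "\<dots> = ennreal (c\<^sup>2) * ennreal (v - u)" using uv by (simp add: nn_integral_cmult_indicator)
  also have "ennreal (v - u) * (ennreal (c\<^sup>2) * ennreal (v - u)) = ennreal (((v - u) * c)\<^sup>2)"
  proof -
    have "ennreal (v - u) * (ennreal (c\<^sup>2) * ennreal (v - u)) = ennreal ((v - u) * (c\<^sup>2 * (v - u)))"
      using uv by (simp add: ennreal_mult)
    also have "(v - u) * (c\<^sup>2 * (v - u)) = ((v - u) * c)\<^sup>2" by (simp add: power2_eq_square)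
    finally show ?thesis .
  qed
  finally show "(\<integral>\<^sup>+w. ennreal ((norm (Y v w - Y u w + (v - u) *\<^sub>R G0 w))\<^sup>2) \<partial>P) \<le> ennreal (((v - u) * c)\<^sup>2)"
    by (simp add: mult_left_mono)
qed

text \<open>A bootstrap: bounded directions make the flow Lipschitz in time, stability then makes
  the direction Lipschitz in time, and freezing the velocity at \<open>u\<close> becomes a second
  order error.\<close>

lemma flow_estimates:
  obtains C1 C2 where "0 \<le> C1" "0 \<le> C2"
    "\<And>u v. 0 \<le> u \<Longrightarrow> u \<le> v \<Longrightarrow> v \<le> tbar \<Longrightarrow> L2norm P (\<lambda>w. Y v w - Y u w) \<le> C1 * (v - u)"
    "\<And>u v. 0 \<le> u \<Longrightarrow> u \<le> v \<Longrightarrow> v \<le> tbar \<Longrightarrow>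
       L2norm P (\<lambda>w. Y v w - Y u w + ((v - u) * lam u) *\<^sub>R A u w) \<le> C2 * (v - u)\<^sup>2"
proof -
  obtain M where M: "0 \<le> M" "\<And>t. t \<in> {0..tbar} \<Longrightarrow> L2norm P (Y t) \<le> M" using Y_bounded by blast
  define B where "B = M + R1"
  have B: "0 \<le> B" using M R1_nonneg by (simp add: B_def)
  have \<Lambda>: "0 \<le> \<Lambda>" using lam[of 0] tbar by auto
  have A_le: "L2norm P (A t) \<le> B" if t: "t \<in> {0..tbar}" for t
    using L2norm_avg_dir[OF ac_rv_Y[OF t]] M(2)[OF t] by (simp add: A_eq[OF t] B_def)
  have Gt: "G t w = lam t *\<^sub>R A t w" if "t \<in> {0..tbar}" for t w
    using that by (simp add: G_def clamp_t)
  have lip: "L2norm P (\<lambda>w. Y v w - Y u w) \<le> (\<Lambda> * B) * (v - u)" if uv: "0 \<le> u" "u \<le> v" "v \<le> tbar" for u v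
  proof -
    have "L2norm P (\<lambda>w. G s w - 0) \<le> \<Lambda> * B" if s: "s \<in> {u..v}" for s
    proof -
      have s': "s \<in> {0..tbar}" using s uv by auto
      then show ?thesis
        using lam[OF s'] A_le[OF s'] \<Lambda> by (simp add: Gt L2norm_scaleR mult_mono L2norm_nonneg)
    qed
    from L2norm_flow_increment[OF uv sqint_zero _ this] show ?thesis using \<Lambda> B by (simp add: mult.commute)
  qed
  \<comment> \<open>A Lipschitz constant for the velocity: the change of \<open>lam\<close> times
    the size \<open>B\<close> of the direction, plus the size of \<open>lam\<close> times
    \<open>L\<close> times the speed \<open>\<Lambda> * B\<close>.\<close>
  define c where "c = \<Lambda>' * B + \<Lambda> * (L * (\<Lambda> * B))"
  have c: "0 \<le> c" using \<Lambda> \<Lambda>' B L by (simp add: c_def)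
  have trunc: "L2norm P (\<lambda>w. Y v w - Y u w + ((v - u) * lam u) *\<^sub>R A u w) \<le> c * (v - u)\<^sup>2"
    if uv: "0 \<le> u" "u \<le> v" "v \<le> tbar" for u v
  proof -
    have u': "u \<in> {0..tbar}" using uv by auto
    have "L2norm P (\<lambda>w. G s w - lam u *\<^sub>R A u w) \<le> c * (v - u)" if s: "s \<in> {u..v}" for s
    proof -
      have s': "s \<in> {0..tbar}" using s uv by auto
      have "(\<lambda>w. G s w - lam u *\<^sub>R A u w) = (\<lambda>w. (lam s - lam u) *\<^sub>R A s w + lam u *\<^sub>R (A s w - A u w))"
        by (simp add: Gt[OF s'] algebra_simps)
      then have "L2norm P (\<lambda>w. G s w - lam u *\<^sub>R A u w)
        \<le> \<bar>lam s - lam u\<bar> * L2norm P (A s) + \<bar>lam u\<bar> * L2norm P (\<lambda>w. A s w - A u w)"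
        using L2norm_triangle[OF sqint_scaleR[OF sqint_A[OF s'], of "lam s - lam u"]
            sqint_scaleR[OF sqint_diff[OF sqint_A[OF s'] sqint_A[OF u']], of "lam u"]]
        by (simp add: L2norm_scaleR)
      also have "\<dots> \<le> (\<Lambda>' * (v - u)) * B + \<Lambda> * (L * ((\<Lambda> * B) * (v - u)))"
      proof (intro add_mono mult_mono A_le s' L2norm_nonneg)
        have "\<bar>lam s - lam u\<bar> \<le> \<Lambda>' * \<bar>s - u\<bar>" by (rule lam_Lipschitz[OF s' u'])
        also have "\<dots> \<le> \<Lambda>' * (v - u)" using s \<Lambda>' by (intro mult_left_mono) auto
        finally show "\<bar>lam s - lam u\<bar> \<le> \<Lambda>' * (v - u)" .
        have "L2norm P (\<lambda>w. A s w - A u w) \<le> L * L2norm P (\<lambda>w. Y s w - Y u w)"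
          using stab[OF s' u'] by (simp add: A_def Y_def)
        also have "\<dots> \<le> L * ((\<Lambda> * B) * (s - u))"
          using s uv by (intro mult_left_mono lip L) auto
        also have "\<dots> \<le> L * ((\<Lambda> * B) * (v - u))"
          using s \<Lambda> B L by (intro mult_left_mono) auto
        finally show "L2norm P (\<lambda>w. A s w - A u w) \<le> L * ((\<Lambda> * B) * (v - u))" .
      qed (use lam[OF u'] \<Lambda> \<Lambda>' uv in auto)
      also have "\<dots> = c * (v - u)" by (simp add: c_def algebra_simps)
      finally show ?thesis .
    qed
    from L2norm_flow_increment[OF uv sqint_scaleR[OF sqint_A[OF u']] _ this] show ?thesis
      using c uv by (simp add: power2_eq_square ac_simps)
  qed
  show thesis by (rule that[OF _ c lip trunc]) (use \<Lambda> B in auto)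
qed

end

section \<open>Error estimate\<close>

text \<open>\<open>C1\<close> and \<open>C2\<close> are parameters rather than obtained inside, so
  that they can be chosen before \<open>h\<close> and the final constant is uniform.\<close>

locale sliced_coupling = sliced_flow P \<rho>1 x0 lam tbar \<Lambda> \<Lambda>' L \<rho> \<Phi> + sliced_scheme P \<rho>1 Q x0 lam h \<Lambda> K \<theta>
  for P :: "'w measure" and \<rho>1 :: "'a::euclidean_space measure" and x0 :: "'w \<Rightarrow> 'a"
    and lam :: "real \<Rightarrow> real" and tbar \<Lambda> \<Lambda>' L :: real and \<rho> :: "real \<Rightarrow> 'a measure"
    and \<Phi> :: "real \<Rightarrow> 'a \<Rightarrow> 'a" and Q :: "'v measure" and h :: real and K :: nat and \<theta> :: "nat \<Rightarrow> 'v \<Rightarrow> 'a" +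
  fixes C1 C2 :: real
  assumes Kh: "real K * h \<le> tbar" and h1: "h \<le> 1" and C: "0 \<le> C1" "0 \<le> C2"
    and increment: "\<And>u v. 0 \<le> u \<Longrightarrow> u \<le> v \<Longrightarrow> v \<le> tbar \<Longrightarrow> L2norm P (\<lambda>w. Y v w - Y u w) \<le> C1 * (v - u)"
    and truncation: "\<And>u v. 0 \<le> u \<Longrightarrow> u \<le> v \<Longrightarrow> v \<le> tbar \<Longrightarrow>
       L2norm P (\<lambda>w. Y v w - Y u w + ((v - u) * lam u) *\<^sub>R A u w) \<le> C2 * (v - u)\<^sup>2"
    and stab_scheme: "\<And>k. k \<le> K \<Longrightarrow> AE \<omega> in Q.
       L2norm P (\<lambda>w. avg_dir \<rho>1 (law (X (dir \<omega>) k)) (X (dir \<omega>) k w) - A (real k * h) w)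
         \<le> L * L2norm P (\<lambda>w. X (dir \<omega>) k w - Y (real k * h) w)"
begin

lemma time_mem:
  assumes "k \<le> K"
  shows "real k * h \<in> {0..tbar}"
proof -
  have "real k * h \<le> real K * h" using assms h by (intro mult_right_mono) auto
  then have "real k * h \<le> tbar" using Kh by (rule order_trans)
  then show ?thesis using h by simp
qed

definition growth :: real where "growth = exp ((\<Lambda> * L + 1) * tbar)"

text \<open>The square of the Gronwall bound \<open>growth * (m + C2 * h)\<close>, with
  \<open>m\<close> the maximum of the martingale, after the square of the sum is split with a factor
  2.\<close>

definition error_bound :: "'v \<Rightarrow> real" where
  "error_bound \<omega> = 2 * growth\<^sup>2 * ((runmax (\<lambda>j. L2norm P (mart (dir \<omega>) j)) K)\<^sup>2 + (C2 * h)\<^sup>2)"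

text \<open>The factor 16 is Doob's 4 times the square of the 2 in the bound on the noise; one
  factor \<open>h\<close> of \<open>h^2\<close> has been used up by the number of steps through
  \<open>K * h \<le> tbar\<close>.\<close>

definition rate :: real where
  "rate = 2 * growth\<^sup>2 * (16 * tbar * (\<Lambda> * (exp (\<Lambda> * tbar) * (L2norm P x0 + R1)))\<^sup>2 + C2\<^sup>2)"

lemma power_le_exp:
  assumes "0 \<le> c" "k \<le> K"
  shows "(1 + h * c) ^ k \<le> exp (c * tbar)"
proof -
  have "(1 + h * c) ^ k \<le> exp (h * c) ^ k"
    using assms h by (intro power_mono) (auto simp: add_nonneg_nonneg)
  also have "\<dots> = exp (c * (real k * h))" by (simp add: exp_of_nat_mult[symmetric] ac_simps)
  also have "\<dots> \<le> exp (c * tbar)"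
    using time_mem[OF assms(2)] assms(1) by (simp add: mult_left_mono)
  finally show ?thesis .
qed

text \<open>Discrete Gronwall argument for \<open>X k - mart k - Y (k * h)\<close>, from which the martingale part of
  the error has been removed.\<close>

lemma AE_error_le:
  "AE \<omega> in Q. \<forall>k\<le>K. (L2norm P (\<lambda>w. X (dir \<omega>) k w - Y (real k * h) w))\<^sup>2 \<le> error_bound \<omega>"
proof -
  have "AE \<omega> in Q. \<forall>k\<in>{..K}.
       L2norm P (\<lambda>w. avg_dir \<rho>1 (law (X (dir \<omega>) k)) (X (dir \<omega>) k w) - A (real k * h) w)
         \<le> L * L2norm P (\<lambda>w. X (dir \<omega>) k w - Y (real k * h) w)"
    using stab_scheme by (intro AE_finite_allI) auto
  with AE_dir_unit show ?thesis
  proof eventually_elim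
    case (elim \<omega>)
    let ?X = "X (dir \<omega>)" and ?S = "mart (dir \<omega>)" and ?Y = "\<lambda>k. Y (real k * h)"
    let ?g = "\<lambda>k w. avg_dir \<rho>1 (law (?X k)) (?X k w)"
    define m where "m = runmax (\<lambda>j. L2norm P (?S j)) K"
    define f where "f k w = ?X k w - ?S k w - ?Y k w" for k w
    \<comment> \<open>With this forcing term the quantity \<open>L2norm P (f k) + q\<close> obeys a
      homogeneous recursion with factor \<open>1 + h * \<beta>\<close>. The summand 1 in \<beta>
      pays for the truncation error \<open>h * (C2 * h)\<close>.\<close>
    define q where "q = m + C2 * h"
    define \<beta> where "\<beta> = \<Lambda> * L + 1"
    have ac: "ac_rv (?X k)" if "k \<le> K" for k using elim(1) that by (intro ac_rv_X) auto
    have sX: "sqint P (?X k)" and sg: "sqint P (?g k)" and sS: "sqint P (?S k)" if "k \<le> K" for k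
      using ac_rv_sqint[OF ac[OF that]] sqint_avg_dir[OF ac[OF that]] sqint_mart[of k "dir \<omega>"] that elim(1)
      by auto
    have sY: "sqint P (?Y k)" and sA: "sqint P (A (real k * h))" if "k \<le> K" for k
      by (rule sqint_Y[OF time_mem[OF that]], rule sqint_A[OF time_mem[OF that]])
    have sf: "sqint P (f k)" if "k \<le> K" for k
      using sqint_diff[OF sqint_diff[OF sX[OF that] sS[OF that]] sY[OF that]] by (simp add: f_def[abs_def])
    have m: "L2norm P (?S k) \<le> m" if "k \<le> K" for k
      unfolding m_def using runmax_ge[OF that, of "\<lambda>j. L2norm P (?S j)"] .
    have m0: "0 \<le> m" using m[of 0] L2norm_nonneg[of P "?S 0"] by simp
    \<comment> \<open>Stability compares the averaged directions at the true iterates, so the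
      martingale reappears here, bounded uniformly in \<open>k\<close> by its maximum
      \<open>m\<close>.\<close>
    have e_le: "L2norm P (\<lambda>w. ?X k w - ?Y k w) \<le> L2norm P (f k) + m" if "k \<le> K" for k
      using L2norm_triangle[OF sf[OF that] sS[OF that]] m[OF that] by (simp add: f_def)
    have \<Lambda>0: "0 \<le> \<Lambda>" by (rule \<Lambda>_bounds)
    have \<beta>0: "0 \<le> \<beta>" using \<Lambda>0 L by (simp add: \<beta>_def)
    have step: "L2norm P (f (Suc k)) \<le> L2norm P (f k) + h * \<beta> * (L2norm P (f k) + q)" if k: "k < K" for k
    proof -
      have kK: "k \<le> K" "Suc k \<le> K" using k by auto
      \<comment> \<open>\<open>?d\<close> is the stability term, \<open>?r\<close> the error of one
        Euler step for the averaged flow.\<close>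
      let ?d = "\<lambda>w. step k *\<^sub>R (?g k w - A (real k * h) w)"
      let ?r = "\<lambda>w. ?Y (Suc k) w - ?Y k w + step k *\<^sub>R A (real k * h) w"
      have hk: "real (Suc k) * h - real k * h = h" by (simp add: algebra_simps)
      have "f (Suc k) = (\<lambda>w. f k w - ?d w - ?r w)"
        unfolding f_def using X_minus_mart_Suc[of "dir \<omega>" k] by (auto simp: fun_eq_iff algebra_simps simp del: iterate.simps mart.simps)
      moreover have "sqint P ?d" "sqint P ?r"
        by (intro sqint_add sqint_diff sqint_scaleR sg sA sY kK)+
      ultimately have "L2norm P (f (Suc k)) \<le> L2norm P (f k) + L2norm P ?d + L2norm P ?r"
        using L2norm_triangle_diff[OF sqint_diff[OF sf[OF kK(1)], of ?d] , of ?r] L2norm_triangle_diff[OF sf[OF kK(1)], of ?d]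
        by simp
      moreover have "L2norm P ?d \<le> (h * \<Lambda>) * (L * (L2norm P (f k) + m))"
      proof -
        have "L2norm P (\<lambda>w. ?g k w - A (real k * h) w) \<le> L * L2norm P (\<lambda>w. ?X k w - ?Y k w)"
          using elim(2) kK by auto
        also have "\<dots> \<le> L * (L2norm P (f k) + m)" by (intro mult_left_mono e_le kK L)
        finally show ?thesis
          unfolding L2norm_scaleR using step_bounds[OF k] by (intro mult_mono L2norm_nonneg) auto
      qed
      moreover have "L2norm P ?r \<le> C2 * h\<^sup>2"
        using truncation[of "real k * h" "real (Suc k) * h"] time_mem[OF kK(1)] time_mem[OF kK(2)] h
        unfolding hk step_def by (auto simp: algebra_simps)
      moreover have "(h * \<Lambda>) * (L * (L2norm P (f k) + m)) + C2 * h\<^sup>2 \<le> h * \<beta> * (L2norm P (f k) + q)"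
      proof -
        have "h * \<beta> * (L2norm P (f k) + q) - ((h * \<Lambda>) * (L * (L2norm P (f k) + m)) + C2 * h\<^sup>2)
          = h * (L2norm P (f k) + m) + h * (\<Lambda> * L * (C2 * h))"
          by (simp add: \<beta>_def q_def algebra_simps power2_eq_square)
        moreover have "0 \<le> h * (L2norm P (f k) + m) + h * (\<Lambda> * L * (C2 * h))"
          using h m0 \<Lambda>0 L C L2norm_nonneg[of P "f k"] by (intro add_nonneg_nonneg mult_nonneg_nonneg) auto
        ultimately show ?thesis by linarith
      qed
      ultimately show ?thesis by linarith
    qed
    have q0: "0 \<le> q" using m0 C h by (simp add: q_def)
    have f_le: "L2norm P (f k) + q \<le> (1 + h * \<beta>) ^ k * q" if "k \<le> K" for k
      using that
    proof (induction k)
      case 0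
      have "f 0 = (\<lambda>w. 0)"
        using flow by (simp add: f_def Y_def averaged_flow_def fun_eq_iff)
      then show ?case by (simp add: L2norm_zero)
    next
      case (Suc k)
      then have "L2norm P (f (Suc k)) + q \<le> (1 + h * \<beta>) * (L2norm P (f k) + q)"
        using step[of k] by (simp add: algebra_simps)
      also have "\<dots> \<le> (1 + h * \<beta>) * ((1 + h * \<beta>) ^ k * q)"
        using Suc h \<beta>0 by (intro mult_left_mono) auto
      finally show ?case by simp
    qed
    show ?case
    proof (intro allI impI)
      fix k assume k: "k \<le> K"
      have "L2norm P (\<lambda>w. ?X k w - ?Y k w) \<le> L2norm P (f k) + q"
      proof -
        have "m \<le> q" using C h by (simp add: q_def)
        then show ?thesis using e_le[OF k] by linarith
      qed
      also have "\<dots> \<le> (1 + h * \<beta>) ^ k * q" by (rule f_le[OF k])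
      also have "\<dots> \<le> growth * q"
        unfolding growth_def \<beta>_def[symmetric] by (intro mult_right_mono power_le_exp \<beta>0 k q0)
      finally have "(L2norm P (\<lambda>w. ?X k w - ?Y k w))\<^sup>2 \<le> (growth * q)\<^sup>2"
        by (intro power_mono L2norm_nonneg)
      also have "\<dots> \<le> growth\<^sup>2 * (2 * m\<^sup>2 + 2 * (C2 * h)\<^sup>2)"
        unfolding power_mult_distrib q_def using norm_add_sq_le[of m "C2 * h"]
        by (intro mult_left_mono) (auto simp: power_mult_distrib)
      also have "\<dots> = error_bound \<omega>" by (simp add: error_bound_def m_def algebra_simps)
      finally show "(L2norm P (\<lambda>w. ?X k w - ?Y k w))\<^sup>2 \<le> error_bound \<omega>" .
    qed
  qed
qed

lemma nn_integral_error_bound: "(\<integral>\<^sup>+\<omega>. ennreal (error_bound \<omega>) \<partial>Q) \<le> ennreal (rate * h)"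
proof -
  let ?m = "\<lambda>\<omega>. runmax (\<lambda>j. L2norm P (mart (dir \<omega>) j)) K"
  have mm[measurable]: "?m \<in> borel_measurable Q"
    by (intro borel_measurable_runmax borel_measurable_L2norm_mart) simp
  define b where "b = exp (\<Lambda> * tbar) * (L2norm P x0 + R1)"
  have BB: "B \<le> b" unfolding B_def b_def
    using L2norm_nonneg[of P x0] R1_nonneg by (intro mult_right_mono power_le_exp \<Lambda>_bounds) auto
  have le: "4 * real K * (2 * (h * \<Lambda>) * B)\<^sup>2 \<le> 16 * tbar * (\<Lambda> * b)\<^sup>2 * h"
  proof -
    have "4 * real K * (2 * (h * \<Lambda>) * B)\<^sup>2 = 16 * (real K * h) * (\<Lambda> * B)\<^sup>2 * h"
      by (simp add: power2_eq_square algebra_simps)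
    also have "\<dots> \<le> 16 * tbar * (\<Lambda> * b)\<^sup>2 * h"
      using Kh h BB B_nonneg \<Lambda>_bounds(1) tbar by (intro mult_right_mono mult_mono power_mono mult_left_mono) auto
    finally show ?thesis .
  qed
  have "(\<integral>\<^sup>+\<omega>. ennreal (error_bound \<omega>) \<partial>Q)
     = (\<integral>\<^sup>+\<omega>. ennreal (2 * growth\<^sup>2) * (ennreal ((?m \<omega>)\<^sup>2) + ennreal ((C2 * h)\<^sup>2)) \<partial>Q)"
    unfolding error_bound_def
    by (intro nn_integral_cong, subst ennreal_mult, simp, simp, subst ennreal_plus, simp, simp, rule refl)
  also have "\<dots> = ennreal (2 * growth\<^sup>2) * ((\<integral>\<^sup>+\<omega>. ennreal ((?m \<omega>)\<^sup>2) \<partial>Q) + ennreal ((C2 * h)\<^sup>2))"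
    by (subst nn_integral_cmult, simp, subst nn_integral_add) (auto simp: Q.emeasure_space_1)
  also have "\<dots> \<le> ennreal (2 * growth\<^sup>2) * (ennreal (16 * tbar * (\<Lambda> * b)\<^sup>2 * h) + ennreal (C2\<^sup>2 * h))"
  proof (intro mult_left_mono add_mono)
    show "(\<integral>\<^sup>+\<omega>. ennreal ((?m \<omega>)\<^sup>2) \<partial>Q) \<le> ennreal (16 * tbar * (\<Lambda> * b)\<^sup>2 * h)"
      by (rule order_trans[OF mart_maximal ennreal_leI[OF le]])
    \<comment> \<open>The truncation part is even O(\<open>h^2\<close>); it is weakened to the order
      of the martingale part.\<close>
    have "h\<^sup>2 \<le> h" using h h1 by (simp add: power2_eq_square mult_left_le)
    then have "C2\<^sup>2 * h\<^sup>2 \<le> C2\<^sup>2 * h" by (intro mult_left_mono) auto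
    then show "ennreal ((C2 * h)\<^sup>2) \<le> ennreal (C2\<^sup>2 * h)"
      by (intro ennreal_leI) (simp add: power_mult_distrib)
  qed simp
  also have "\<dots> = ennreal (2 * growth\<^sup>2 * (16 * tbar * (\<Lambda> * b)\<^sup>2 * h + C2\<^sup>2 * h))"
    using h tbar by (subst ennreal_mult) (auto simp: ennreal_plus)
  also have "2 * growth\<^sup>2 * (16 * tbar * (\<Lambda> * b)\<^sup>2 * h + C2\<^sup>2 * h) = rate * h"
    by (simp add: rate_def b_def algebra_simps)
  finally show ?thesis .
qed

lemma error_bound_nonneg: "0 \<le> error_bound \<omega>"
  by (simp add: error_bound_def)

lemma AE_W2sq_le:
  "AE \<omega> in Q. \<forall>k\<le>K. W2sq (iterate_law P x0 \<rho>1 lam h (dir \<omega>) k) (\<rho> (real k * h)) \<le> ennreal (error_bound \<omega>)"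
  using AE_error_le AE_dir_unit
proof eventually_elim
  case (elim \<omega>)
  show ?case
  proof (intro allI impI)
    fix k assume k: "k \<le> K"
    have "W2sq (law (X (dir \<omega>) k)) (law (Y (real k * h)))
        \<le> ennreal ((L2norm P (\<lambda>w. X (dir \<omega>) k w - Y (real k * h) w))\<^sup>2)"
      using elim(2) k by (intro W2sq_distr_le prob_space_axioms ac_rv_sqint ac_rv_X ac_rv_Y time_mem) auto
    also have "\<dots> \<le> ennreal (error_bound \<omega>)" using elim(1) k by (intro ennreal_leI) auto
    finally show "W2sq (iterate_law P x0 \<rho>1 lam h (dir \<omega>) k) (\<rho> (real k * h)) \<le> ennreal (error_bound \<omega>)"
      by (simp only: iterate_law_def law_Y[OF time_mem[OF k]])
  qed
qed

text \<open>Stated for any discrepancy dominated by \<open>W2sq\<close>, so that it covers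
  \<open>W2sq\<close> and \<open>SW2sq\<close> at once.\<close>

lemma expected_max_le:
  assumes D: "\<And>\<mu> \<nu> :: 'a measure. D \<mu> \<nu> \<le> W2sq \<mu> \<nu>"
  shows "(\<integral>\<^sup>+ \<omega>. (MAX k\<in>{0..K}. D (iterate_law P x0 \<rho>1 lam h (dir \<omega>) k) (\<rho> (real k * h))) \<partial>Q) \<le> ennreal (rate * h)"
proof -
  have "(\<integral>\<^sup>+ \<omega>. (MAX k\<in>{0..K}. D (iterate_law P x0 \<rho>1 lam h (dir \<omega>) k) (\<rho> (real k * h))) \<partial>Q)
    \<le> (\<integral>\<^sup>+ \<omega>. ennreal (error_bound \<omega>) \<partial>Q)"
  proof (rule nn_integral_mono_AE, use AE_W2sq_le in eventually_elim)
    case (elim \<omega>)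
    then show ?case by (intro Max.boundedI) (auto intro!: order_trans[OF D])
  qed
  also note nn_integral_error_bound
  finally show ?thesis .
qed

text \<open>A fixed time lies within \<open>h\<close> of its grid time, and the Lipschitz bound of
  the flow covers the gap; the factors 2 come from squaring the sum of the two errors.\<close>

lemma expected_W2sq_between_le:
  assumes t: "t \<in> {0..tbar}" and k: "k \<le> K" "real k * h \<le> t" "t - real k * h \<le> h"
  shows "(\<integral>\<^sup>+ \<omega>. W2sq (iterate_law P x0 \<rho>1 lam h (dir \<omega>) k) (\<rho> t) \<partial>Q) \<le> ennreal (2 * (rate * h) + 2 * (C1 * h)\<^sup>2)"
proof -
  have "(\<integral>\<^sup>+ \<omega>. W2sq (iterate_law P x0 \<rho>1 lam h (dir \<omega>) k) (\<rho> t) \<partial>Q)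
    \<le> (\<integral>\<^sup>+ \<omega>. 2 * ennreal (error_bound \<omega>) + ennreal (2 * (C1 * h)\<^sup>2) \<partial>Q)"
  proof (rule nn_integral_mono_AE, use AE_error_le AE_dir_unit in eventually_elim)
    case (elim \<omega>)
    let ?e = "\<lambda>w. X (dir \<omega>) k w - Y (real k * h) w" and ?d = "\<lambda>w. Y t w - Y (real k * h) w"
    have sq: "sqint P (X (dir \<omega>) k)" "sqint P (Y (real k * h))" "sqint P (Y t)"
      using elim(2) k t by (auto intro!: ac_rv_sqint ac_rv_X ac_rv_Y time_mem)
    have "L2norm P (\<lambda>w. X (dir \<omega>) k w - Y t w) \<le> L2norm P ?e + L2norm P ?d"
      using L2norm_triangle_diff[OF sqint_diff[OF sq(1,2)] sqint_diff[OF sq(3,2)]] by simp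
    also have "\<dots> \<le> L2norm P ?e + C1 * h"
    proof -
      have "L2norm P ?d \<le> C1 * (t - real k * h)" using t k(2) h by (intro increment) auto
      also have "\<dots> \<le> C1 * h" using k C by (intro mult_left_mono) auto
      finally show ?thesis by simp
    qed
    finally have "(L2norm P (\<lambda>w. X (dir \<omega>) k w - Y t w))\<^sup>2 \<le> (L2norm P ?e + C1 * h)\<^sup>2"
      by (intro power_mono L2norm_nonneg)
    also have "\<dots> \<le> 2 * (L2norm P ?e)\<^sup>2 + 2 * (C1 * h)\<^sup>2"
      using norm_add_sq_le[of "L2norm P ?e" "C1 * h"] by simp
    also have "\<dots> \<le> 2 * error_bound \<omega> + 2 * (C1 * h)\<^sup>2" using elim(1) k by auto
    finally have "ennreal ((L2norm P (\<lambda>w. X (dir \<omega>) k w - Y t w))\<^sup>2) \<le> ennreal (2 * error_bound \<omega> + 2 * (C1 * h)\<^sup>2)"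
      by (rule ennreal_leI)
    also have "\<dots> = 2 * ennreal (error_bound \<omega>) + ennreal (2 * (C1 * h)\<^sup>2)"
      using error_bound_nonneg[of \<omega>] by (simp add: ennreal_plus ennreal_mult)
    finally show ?case
      using W2sq_distr_le[OF prob_space_axioms sq(1,3)] by (simp only: iterate_law_def law_Y[OF t] order_trans)
  qed
  also have "\<dots> = 2 * (\<integral>\<^sup>+ \<omega>. ennreal (error_bound \<omega>) \<partial>Q) + ennreal (2 * (C1 * h)\<^sup>2)"
  proof -
    have [measurable]: "(\<lambda>\<omega>. runmax (\<lambda>j. L2norm P (mart (dir \<omega>) j)) K) \<in> borel_measurable Q"
      by (intro borel_measurable_runmax borel_measurable_L2norm_mart) simp
    have [measurable]: "error_bound \<in> borel_measurable Q" unfolding error_bound_def by measurable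
    show ?thesis by (subst nn_integral_add) (auto simp: nn_integral_cmult Q.emeasure_space_1)
  qed
  also have "\<dots> \<le> 2 * ennreal (rate * h) + ennreal (2 * (C1 * h)\<^sup>2)"
    by (intro add_right_mono mult_left_mono nn_integral_error_bound) simp
  also have "\<dots> = ennreal (2 * (rate * h) + 2 * (C1 * h)\<^sup>2)"
  proof -
    have "0 \<le> rate * h" using h tbar by (simp add: rate_def)
    then show ?thesis by (simp add: ennreal_plus ennreal_mult)
  qed
  finally show ?thesis .
qed

end

section \<open>Time grid, bounds on the step weight, and the convergence statement\<close>

lemma num_steps_bounds:
  assumes "0 < h" "0 \<le> t"
  shows "real (num_steps t h) * h \<le> t" "t - real (num_steps t h) * h \<le> h"
proof -
  have nn: "0 \<le> \<lfloor>t / h\<rfloor>" using assms by simp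
  have eq: "real (num_steps t h) = of_int \<lfloor>t / h\<rfloor>" unfolding num_steps_def using nn by simp
  have "real (num_steps t h) \<le> t / h" unfolding eq by (rule of_int_floor_le)
  then show "real (num_steps t h) * h \<le> t" using assms by (simp add: pos_le_divide_eq)
  have "t / h \<le> real (num_steps t h) + 1" unfolding eq by linarith
  then show "t - real (num_steps t h) * h \<le> h" using assms by (simp add: pos_divide_le_eq algebra_simps)
qed

lemma num_steps_mono: "0 < h \<Longrightarrow> s \<le> t \<Longrightarrow> num_steps s h \<le> num_steps t h"
  unfolding num_steps_def by (intro nat_mono floor_mono divide_right_mono) auto

lemma C1_on_interval_bounds:
  assumes "C1_on_interval f a b"
  shows "continuous_on {a..b} f"
    and "\<exists>c\<ge>0. \<forall>s\<in>{a..b}. \<forall>t\<in>{a..b}. \<bar>f s - f t\<bar> \<le> c * \<bar>s - t\<bar>"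
proof -
  obtain f' where f': "continuous_on {a..b} f'"
    and d: "\<And>t. t \<in> {a..b} \<Longrightarrow> (f has_real_derivative f' t) (at t within {a..b})"
    using assms unfolding C1_on_interval_def by blast
  show "continuous_on {a..b} f" by (rule DERIV_continuous_on[OF d])
  have "bounded (f' ` {a..b})"
    by (intro compact_imp_bounded compact_continuous_image f') simp
  then obtain c where c: "0 < c" "\<And>t. t \<in> {a..b} \<Longrightarrow> norm (f' t) \<le> c"
    unfolding bounded_pos by auto
  have "\<bar>f s - f t\<bar> \<le> c * \<bar>s - t\<bar>" if "s \<in> {a..b}" "t \<in> {a..b}" for s t
    using field_differentiable_bound[OF _ d c(2), of s t] that by simp
  then show "\<exists>c\<ge>0. \<forall>s\<in>{a..b}. \<forall>t\<in>{a..b}. \<bar>f s - f t\<bar> \<le> c * \<bar>s - t\<bar>"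
    using c(1) by (intro exI[of _ c]) auto
qed

theorem theorem3:
  fixes \<rho>0 \<rho>1 :: "(real^'n) measure"
    and lam :: "real \<Rightarrow> real" and tbar hbar L :: real
    and P0 :: "'w measure" and x0 :: "'w \<Rightarrow> real^'n"
    and Q :: "'v measure" and \<theta> :: "nat \<Rightarrow> 'v \<Rightarrow> real^'n"
    and \<rho> :: "real \<Rightarrow> (real^'n) measure" and \<Phi> :: "real \<Rightarrow> real^'n \<Rightarrow> real^'n"
  assumes "\<rho>0 \<in> P2ac" and "\<rho>1 \<in> P2"
    and "0 < tbar" and "tbar < 1"
    and "\<forall>t\<in>{0..<1}. 0 \<le> lam t" and "C1_on_interval lam 0 tbar"
    and "prob_space P0" and "x0 \<in> borel_measurable P0" and "distr P0 borel x0 = \<rho>0"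
    and "prob_space Q" and "prob_space.indep_vars Q (\<lambda>_. borel) \<theta> UNIV"
    and "\<forall>k. distr Q borel (\<theta> k) = unif_sphere"
    and "averaged_flow tbar lam \<rho>0 \<rho>1 \<rho> \<Phi>"
    and "stability tbar lam P0 x0 \<rho>1 Q \<theta> \<rho> \<Phi> hbar L"
  shows "(\<exists>C::real. \<forall>h\<in>{0<..hbar}.
            (\<integral>\<^sup>+ \<omega>. (MAX k\<in>{0..num_steps tbar h}.
                W2sq (iterate_law P0 x0 \<rho>1 lam h (\<lambda>j. \<theta> j \<omega>) k) (\<rho> (real k * h))) \<partial>Q)
              \<le> ennreal (C * h) \<and>
            (\<integral>\<^sup>+ \<omega>. (MAX k\<in>{0..num_steps tbar h}.
                SW2sq (iterate_law P0 x0 \<rho>1 lam h (\<lambda>j. \<theta> j \<omega>) k) (\<rho> (real k * h))) \<partial>Q)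
              \<le> ennreal (C / real CARD('n) * h))
       \<and> (\<forall>t\<in>{0..tbar}.
            ((\<lambda>h. \<integral>\<^sup>+ \<omega>. W2sq (iterate_law P0 x0 \<rho>1 lam h (\<lambda>j. \<theta> j \<omega>) (num_steps t h)) (\<rho> t) \<partial>Q)
               \<longlongrightarrow> 0) (at_right 0))"
proof -
  note \<rho>0 = assms(1) and \<rho>1 = assms(2) and tbar = assms(3,4) and lam_pos = assms(5) and C1 = assms(6)
    and P0 = assms(7) and x0 = assms(8,9) and Q = assms(10) and ind = assms(11) and unif = assms(12)
    and flow = assms(13) and stab = assms(14)
  define \<Lambda> where "\<Lambda> = (SUP t\<in>{0..tbar}. lam t)"
  have hbar: "0 < hbar" "hbar \<le> 1" "hbar * \<Lambda> < 1"
    and stab1: "\<And>h k. h \<in> {0<..hbar} \<Longrightarrow> k \<le> num_steps tbar h \<Longrightarrow> AE \<omega> in Q.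
        L2norm P0 (\<lambda>w. avg_dir \<rho>1 (iterate_law P0 x0 \<rho>1 lam h (\<lambda>j. \<theta> j \<omega>) k)
                           (iterate P0 x0 \<rho>1 lam h (\<lambda>j. \<theta> j \<omega>) k w)
                         - avg_dir \<rho>1 (\<rho> (real k * h)) (\<Phi> (real k * h) (x0 w)))
        \<le> L * L2norm P0 (\<lambda>w. iterate P0 x0 \<rho>1 lam h (\<lambda>j. \<theta> j \<omega>) k w
                             - \<Phi> (real k * h) (x0 w))"
    and stab2: "\<And>s t. s \<in> {0..tbar} \<Longrightarrow> t \<in> {0..tbar} \<Longrightarrow>
        L2norm P0 (\<lambda>w. avg_dir \<rho>1 (\<rho> s) (\<Phi> s (x0 w)) - avg_dir \<rho>1 (\<rho> t) (\<Phi> t (x0 w)))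
        \<le> L * L2norm P0 (\<lambda>w. \<Phi> s (x0 w) - \<Phi> t (x0 w))"
    using stab unfolding stability_def \<Lambda>_def by blast+
  obtain \<Lambda>' where \<Lambda>': "0 \<le> \<Lambda>'" "\<And>s t. s \<in> {0..tbar} \<Longrightarrow> t \<in> {0..tbar} \<Longrightarrow> \<bar>lam s - lam t\<bar> \<le> \<Lambda>' * \<bar>s - t\<bar>"
    using C1_on_interval_bounds(2)[OF C1] by blast
  have bdd: "bdd_above (lam ` {0..tbar})"
    by (intro bounded_imp_bdd_above compact_imp_bounded compact_continuous_image
        C1_on_interval_bounds(1)[OF C1]) simp
  have lam: "0 \<le> lam t \<and> lam t \<le> \<Lambda>" if "t \<in> {0..tbar}" for t
    unfolding \<Lambda>_def using that lam_pos tbar cSUP_upper[OF that bdd] by auto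
  have \<Lambda>0: "0 \<le> \<Lambda>" using lam[of 0] tbar by auto
  \<comment> \<open>The stability assumption leaves the sign of \<open>L\<close> open;
    \<open>max L 0\<close> gives weaker bounds of the same form with a nonnegative constant.\<close>
  define L' where "L' = max L 0"
  have L': "0 \<le> L'" "\<And>a b. a \<le> L * L2norm P0 b \<Longrightarrow> a \<le> L' * L2norm P0 (b :: 'w \<Rightarrow> real^'n)"
    using L2norm_nonneg order_trans[OF _ mult_right_mono[of L L']] by (auto simp: L'_def)
  interpret T: sliced_target P0 \<rho>1
    using P0 \<rho>1 by (simp add: sliced_target_def sliced_target_axioms_def)
  interpret F: sliced_flow P0 \<rho>1 x0 lam tbar \<Lambda> \<Lambda>' L' \<rho> \<Phi>
    using x0 flow tbar lam \<Lambda>' L' stab2 by unfold_locales auto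
  obtain C1 C2 where C12: "0 \<le> C1" "0 \<le> C2"
    "\<And>u v. 0 \<le> u \<Longrightarrow> u \<le> v \<Longrightarrow> v \<le> tbar \<Longrightarrow> L2norm P0 (\<lambda>w. F.Y v w - F.Y u w) \<le> C1 * (v - u)"
    "\<And>u v. 0 \<le> u \<Longrightarrow> u \<le> v \<Longrightarrow> v \<le> tbar \<Longrightarrow>
       L2norm P0 (\<lambda>w. F.Y v w - F.Y u w + ((v - u) * lam u) *\<^sub>R F.A u w) \<le> C2 * (v - u)\<^sup>2"
    using F.flow_estimates by blast
  \<comment> \<open>Proved as a predicate for every admissible \<open>h\<close>, with
    \<open>C1\<close> and \<open>C2\<close> already fixed, so that each claim can interpret it at
    its own step size.\<close>
  have coupling: "sliced_coupling P0 \<rho>1 x0 lam tbar \<Lambda> \<Lambda>' L' \<rho> \<Phi> Q h (num_steps tbar h) \<theta> C1 C2"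
    if h: "h \<in> {0<..hbar}" for h
  proof -
    have hp: "0 < h" "h \<le> hbar" using h by auto
    have Kh: "real (num_steps tbar h) * h \<le> tbar" using num_steps_bounds[OF hp(1), of tbar] tbar by simp
    have kh: "real k * h \<in> {0..tbar}" if "k \<le> num_steps tbar h" for k
    proof -
      have "real k * h \<le> real (num_steps tbar h) * h" using that hp by (intro mult_right_mono) auto
      then have "real k * h \<le> tbar" using Kh by (rule order_trans)
      then show ?thesis using hp by simp
    qed
    have h\<Lambda>: "h * \<Lambda> < 1" using mult_right_mono[OF hp(2) \<Lambda>0] hbar(3) by linarith
    have x0ac: "T.ac_rv x0" using x0 \<rho>0 by (simp add: T.ac_rv_def)
    interpret Q: prob_space Q by (rule Q)
    interpret S: sliced_scheme P0 \<rho>1 Q x0 lam h \<Lambda> "num_steps tbar h" \<theta>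
    proof unfold_locales
      show "0 \<le> lam (real k * h) \<and> lam (real k * h) \<le> \<Lambda>" if "k < num_steps tbar h" for k
        using lam[OF kh] that by simp
    qed (use x0ac hp \<Lambda>0 h\<Lambda> ind unif in auto)
    show ?thesis
    proof unfold_locales
      show "AE \<omega> in Q. L2norm P0 (\<lambda>w. avg_dir \<rho>1 (distr P0 borel (S.X (\<lambda>j. \<theta> j \<omega>) k)) (S.X (\<lambda>j. \<theta> j \<omega>) k w) - F.A (real k * h) w)
         \<le> L' * L2norm P0 (\<lambda>w. S.X (\<lambda>j. \<theta> j \<omega>) k w - F.Y (real k * h) w)"
        if "k \<le> num_steps tbar h" for k
        using stab1[OF h that]
        by eventually_elim (unfold F.A_def F.Y_def iterate_law_def, rule L'(2))
    qed (use Kh hp hbar C12 in auto)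
  qed
  \<comment> \<open>The value of \<open>rate\<close> written without \<open>h\<close>, available
    before a step size is chosen and identified with \<open>H.rate\<close> in each
    interpretation.\<close>
  define R where "R = 2 * (exp ((\<Lambda> * L' + 1) * tbar))\<^sup>2 *
      (16 * tbar * (\<Lambda> * (exp (\<Lambda> * tbar) * (L2norm P0 x0 + T.R1)))\<^sup>2 + C2\<^sup>2)"
  have R0: "0 \<le> R" using tbar by (simp add: R_def)
  define n where "n = real CARD('n)"
  have n: "1 \<le> n" by (simp add: n_def Suc_leI)
  \<comment> \<open>The constant may depend on the dimension \<open>n\<close>, so with \<open>n * R\<close> the crude comparison
    \<open>SW2sq \<le> W2sq\<close> already gives the second bound.\<close>
  show ?thesis
  proof (intro conjI exI[of _ "n * R"] ballI)
    fix h assume h: "h \<in> {0<..hbar}"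
    interpret H: sliced_coupling P0 \<rho>1 x0 lam tbar \<Lambda> \<Lambda>' L' \<rho> \<Phi> Q h "num_steps tbar h" \<theta> C1 C2
      by (rule coupling[OF h])
    have rate: "H.rate = R" by (simp add: H.rate_def H.growth_def R_def)
    have "R \<le> n * R" using n R0 by (simp add: mult_le_cancel_right1)
    then have "R * h \<le> n * R * h" using h by (intro mult_right_mono) auto
    then show "(\<integral>\<^sup>+ \<omega>. (MAX k\<in>{0..num_steps tbar h}.
          W2sq (iterate_law P0 x0 \<rho>1 lam h (\<lambda>j. \<theta> j \<omega>) k) (\<rho> (real k * h))) \<partial>Q) \<le> ennreal (n * R * h)"
      using H.expected_max_le[of W2sq] unfolding rate by (meson ennreal_leI order_refl order_trans)
    have "n * R / n * h = R * h" using n by simp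
    with H.expected_max_le[of SW2sq, OF SW2sq_le_W2sq] show "(\<integral>\<^sup>+ \<omega>. (MAX k\<in>{0..num_steps tbar h}.
          SW2sq (iterate_law P0 x0 \<rho>1 lam h (\<lambda>j. \<theta> j \<omega>) k) (\<rho> (real k * h))) \<partial>Q) \<le> ennreal (n * R / real CARD('n) * h)"
      unfolding rate n_def[symmetric] by (simp only:)
  next
    fix t assume t: "t \<in> {0..tbar}"
    let ?E = "\<lambda>h. \<integral>\<^sup>+ \<omega>. W2sq (iterate_law P0 x0 \<rho>1 lam h (\<lambda>j. \<theta> j \<omega>) (num_steps t h)) (\<rho> t) \<partial>Q"
    have le: "?E h \<le> ennreal (2 * (R * h) + 2 * (C1 * h)\<^sup>2)" if h: "h \<in> {0<..hbar}" for h
    proof -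
      interpret H: sliced_coupling P0 \<rho>1 x0 lam tbar \<Lambda> \<Lambda>' L' \<rho> \<Phi> Q h "num_steps tbar h" \<theta> C1 C2
        by (rule coupling[OF h])
      have rate: "H.rate = R" by (simp add: H.rate_def H.growth_def R_def)
      show ?thesis unfolding rate[symmetric]
        by (rule H.expected_W2sq_between_le[OF t num_steps_mono num_steps_bounds]) (use h t in auto)
    qed
    have "((\<lambda>h. 2 * (R * h) + 2 * (C1 * h)\<^sup>2) \<longlongrightarrow> 2 * (R * 0) + 2 * (C1 * 0)\<^sup>2) (at_right 0)"
      by (intro tendsto_intros)
    then have "((\<lambda>h. 2 * (R * h) + 2 * (C1 * h)\<^sup>2) \<longlongrightarrow> 0) (at_right 0)" by simp
    from tendsto_ennrealI[OF this]
    have lim: "((\<lambda>h. ennreal (2 * (R * h) + 2 * (C1 * h)\<^sup>2)) \<longlongrightarrow> 0) (at_right 0)" by simp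
    show "(?E \<longlongrightarrow> 0) (at_right 0)"
    proof (rule tendsto_sandwich[OF _ _ tendsto_const lim])
      show "\<forall>\<^sub>F h in at_right 0. ?E h \<le> ennreal (2 * (R * h) + 2 * (C1 * h)\<^sup>2)"
        using eventually_at_right_less[of "0::real"] eventually_at_right_real[OF hbar(1)]
        by eventually_elim (rule le, auto)
    qed simp
  qed
qed

end
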